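(* Assume (Z). For each $h\in\mathcal H$, $V(\cdot,h)\in C([a,b])\cap C^1(\mathcal I)\cap C^2(\mathcal I\setminus\partial\mathcal C_h)$, and for every $x_0\in\partial\mathcal C_h\cap\mathcal I$, $\lim_{\mathcal C_h\ni x\to x_0}\partial_{xx}V(x,h)=\frac{2}{\sigma^2x_0^2}\big(-rx_0M'(x_0)+2rM(x_0)-f(x_0,h)\big)$. In particular $\partial_xV(x_0,h)=M'(x_0)$ at such points (smooth fit).
   Context: Let $(\Omega,\mathcal F,\mathsf P)$ carry a standard Brownian motion $W$ with natural filtration $\mathbb F$ satisfying the usual conditions. Fix $r>0$, $\sigma>0$, $K>0$. For $x>0$ let $S^x$ solve $\mathrm dS_t=rS_t\,\mathrm dt+\sigma S_t\,\mathrm dW_t$, $S_0=x$; $\mathsf E_x$ denotes expectation when $S_0=x$. Put $d=2r/\sigma^2$, $\hat a=K/(1+1/d)$, $P(x)=\frac1d\hat a^{1+d}x^{-d}$ for $x\ge\hat a$ and $P(x)=K-x$ for $0\le x\le\hat a$, so $P'(x)=\max\{-(\hat a/x)^{1+d},-1\}$. Fix $\hat a\le a<b<\infty$, $\mathcal I=(a,b)$, $\tau^x_{\mathcal I}=\inf\{t\ge0:S^x_t\notin\mathcal I\}$ (written $\tau_{\mathcal I}$ under $\mathsf E_x$), $\mathcal T_x$ the set of $\mathbb F$-stopping times $\tau\le\tau^x_{\mathcal I}$ a.s., $\mathcal H=[P'(a),P'(b)]$, $f(x,\theta)=(\theta-P'(x))^2\sigma^2x^2$. For $x\in[a,b]$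 let $\gamma_1(x)=\mathsf E_x[\int_0^{\tau_{\mathcal I}}e^{-2ru}\sigma^2S_u^2\,\mathrm du]$, $\gamma_2(x)=\mathsf E_x[\int_0^{\tau_{\mathcal I}}e^{-2ru}P'(S_u)\sigma^2S_u^2\,\mathrm du]$, $\gamma_3(x)=\mathsf E_x[\int_0^{\tau_{\mathcal I}}e^{-2ru}(P'(S_u))^2\sigma^2S_u^2\,\mathrm du]$; for $x\in\mathcal I$ set $\Gamma(x)=\gamma_2(x)/\gamma_1(x)$ and $M(x)=\gamma_3(x)-\gamma_2(x)^2/\gamma_1(x)$, and set $M(a)=M(b)=0$ ($M\in C^\infty(\mathcal I)$). For $(x,h)\in[a,b]\times\mathcal H$ define $V(x,h)=\inf_{\tau\in\mathcal T_x}\mathsf E_x\big[\int_0^\tau e^{-2ru}f(S_u,h)\,\mathrm du+e^{-2r\tau}M(S_\tau)\big]$ and $\mathcal C_h=\{x\in[a,b]:V(x,h)<M(x)\}$. Let $\mathcal Lv(x)=\frac{\sigma^2}{2}x^2v''(x)+rxv'(x)$ and $G(x,h)=(\mathcal L-2r)M(x)+f(x,h)$ for $x\in\mathcal I$. Assumption (Z): for each $h\in\mathcal H$, the equation $G(x,h)=0$ has at most two roots $x\in\mathcal I$. *)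

theory Defs
  imports "HOL-Probability.Probability"
begin

definition is_std_BM :: "'a measure \<Rightarrow> (real \<Rightarrow> 'a \<Rightarrow> real) \<Rightarrow> bool" where
  "is_std_BM M W \<longleftrightarrow> prob_space M \<and>
     (\<forall>t. W t \<in> borel_measurable M) \<and>
     (\<forall>\<omega>\<in>space M. W 0 \<omega> = 0 \<and> continuous_on {0..} (\<lambda>t. W t \<omega>)) \<and>
     (\<forall>s t. 0 \<le> s \<longrightarrow> s < t \<longrightarrow>
        distributed M lborel (\<lambda>\<omega>. W t \<omega> - W s \<omega>) (normal_density 0 (sqrt (t - s))) \<and>
        prob_space.indep_set M
          (sigma_sets (space M) (\<Union>u\<in>{0..s}. {W u -` A \<inter> space M | A. A \<in> sets borel}))
          (sigma_sets (space M) {(\<lambda>\<omega>. W t \<omega> - W s \<omega>) -` A \<inter> space M | A. A \<in> sets borel}))"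

definition BM_filtration :: "'a measure \<Rightarrow> (real \<Rightarrow> 'a \<Rightarrow> real) \<Rightarrow> real \<Rightarrow> 'a measure" where
  "BM_filtration M W t = sigma (space M)
     (\<Inter>s\<in>{t<..}. sigma_sets (space M)
        ((\<Union>u\<in>{0..s}. {W u -` A \<inter> space M | A. A \<in> sets borel}) \<union> null_sets M))"

text \<open>Strong solution of dS = r S dt + sigma S dW, S_0 = x.\<close>
definition gbm :: "real \<Rightarrow> real \<Rightarrow> (real \<Rightarrow> 'a \<Rightarrow> real) \<Rightarrow> real \<Rightarrow> real \<Rightarrow> 'a \<Rightarrow> real" where
  "gbm r \<sigma> W x t \<omega> = x * exp ((r - \<sigma>\<^sup>2 / 2) * t + \<sigma> * W t \<omega>)"

definition exit_time :: "(real \<Rightarrow> 'a \<Rightarrow> real) \<Rightarrow> real \<Rightarrow> real \<Rightarrow> 'a \<Rightarrow> ereal" where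
  "exit_time S a b \<omega> = Inf {ereal t | t. 0 \<le> t \<and> S t \<omega> \<notin> {a<..<b}}"

definition dpar :: "real \<Rightarrow> real \<Rightarrow> real" where
  "dpar r \<sigma> = 2 * r / \<sigma>\<^sup>2"

definition ahat :: "real \<Rightarrow> real \<Rightarrow> real \<Rightarrow> real" where
  "ahat r \<sigma> K = K / (1 + 1 / dpar r \<sigma>)"

definition Pfun :: "real \<Rightarrow> real \<Rightarrow> real \<Rightarrow> real \<Rightarrow> real" where
  "Pfun r \<sigma> K x = (if ahat r \<sigma> K \<le> x
      then (1 / dpar r \<sigma>) * ahat r \<sigma> K powr (1 + dpar r \<sigma>) * x powr (- dpar r \<sigma>)
      else K - x)"

text \<open>P'(x) = max{-(ahat/x)^(1+d), -1}, as given.\<close>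
definition Pd :: "real \<Rightarrow> real \<Rightarrow> real \<Rightarrow> real \<Rightarrow> real" where
  "Pd r \<sigma> K x = max (- ((ahat r \<sigma> K / x) powr (1 + dpar r \<sigma>))) (-1)"

definition fcost :: "real \<Rightarrow> real \<Rightarrow> real \<Rightarrow> real \<Rightarrow> real \<Rightarrow> real" where
  "fcost r \<sigma> K x \<theta> = (\<theta> - Pd r \<sigma> K x)\<^sup>2 * \<sigma>\<^sup>2 * x\<^sup>2"

definition exp_run :: "'a measure \<Rightarrow> (real \<Rightarrow> 'a \<Rightarrow> real) \<Rightarrow> real \<Rightarrow> real \<Rightarrow> real \<Rightarrow> real
                        \<Rightarrow> (real \<Rightarrow> real) \<Rightarrow> real \<Rightarrow> real" where
  "exp_run M W r \<sigma> a b g x = (\<integral>\<omega>. interval_lebesgue_integral lborel 0 (exit_time (gbm r \<sigma> W x) a b \<omega>)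
        (\<lambda>u. exp (- 2 * r * u) * g (gbm r \<sigma> W x u \<omega>)) \<partial>M)"

definition gamma1 where
  "gamma1 M W r \<sigma> a b = exp_run M W r \<sigma> a b (\<lambda>y. \<sigma>\<^sup>2 * y\<^sup>2)"

definition gamma2 where
  "gamma2 M W r \<sigma> K a b = exp_run M W r \<sigma> a b (\<lambda>y. Pd r \<sigma> K y * \<sigma>\<^sup>2 * y\<^sup>2)"

definition gamma3 where
  "gamma3 M W r \<sigma> K a b = exp_run M W r \<sigma> a b (\<lambda>y. (Pd r \<sigma> K y)\<^sup>2 * \<sigma>\<^sup>2 * y\<^sup>2)"

definition Gam where
  "Gam M W r \<sigma> K a b x = gamma2 M W r \<sigma> K a b x / gamma1 M W r \<sigma> a b x"

definition Mfun :: "'a measure \<Rightarrow> (real \<Rightarrow> 'a \<Rightarrow> real) \<Rightarrow> real \<Rightarrow> real \<Rightarrow> real \<Rightarrow> real \<Rightarrow> real \<Rightarrow> real \<Rightarrow> real" where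
  "Mfun M W r \<sigma> K a b x = (if a < x \<and> x < b
      then gamma3 M W r \<sigma> K a b x - (gamma2 M W r \<sigma> K a b x)\<^sup>2 / gamma1 M W r \<sigma> a b x
      else 0)"

definition admissible :: "'a measure \<Rightarrow> (real \<Rightarrow> 'a \<Rightarrow> real) \<Rightarrow> real \<Rightarrow> real \<Rightarrow> real \<Rightarrow> real \<Rightarrow> real
                          \<Rightarrow> ('a \<Rightarrow> real) set" where
  "admissible M W r \<sigma> a b x = {\<tau>. stopping_time (BM_filtration M W) \<tau> \<and> (\<forall>\<omega>\<in>space M. 0 \<le> \<tau> \<omega>) \<and>
      (AE \<omega> in M. ereal (\<tau> \<omega>) \<le> exit_time (gbm r \<sigma> W x) a b \<omega>)}"

definition Vfun :: "'a measure \<Rightarrow> (real \<Rightarrow> 'a \<Rightarrow> real) \<Rightarrow> real \<Rightarrow> real \<Rightarrow> real \<Rightarrow> real \<Rightarrow> real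
                    \<Rightarrow> real \<Rightarrow> real \<Rightarrow> real" where
  "Vfun M W r \<sigma> K a b x h = (INF \<tau>\<in>admissible M W r \<sigma> a b x.
      (\<integral>\<omega>. interval_lebesgue_integral lborel 0 (ereal (\<tau> \<omega>))
              (\<lambda>u. exp (- 2 * r * u) * fcost r \<sigma> K (gbm r \<sigma> W x u \<omega>) h)
            + exp (- 2 * r * \<tau> \<omega>) * Mfun M W r \<sigma> K a b (gbm r \<sigma> W x (\<tau> \<omega>) \<omega>) \<partial>M))"

definition contset where
  "contset M W r \<sigma> K a b h = {x \<in> {a..b}. Vfun M W r \<sigma> K a b x h < Mfun M W r \<sigma> K a b x}"

text \<open>G(x,h) = (L - 2r) M(x) + f(x,h).\<close>
definition Gfun where
  "Gfun M W r \<sigma> K a b x h =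
     \<sigma>\<^sup>2 / 2 * x\<^sup>2 * deriv (deriv (Mfun M W r \<sigma> K a b)) x
     + r * x * deriv (Mfun M W r \<sigma> K a b) x - 2 * r * Mfun M W r \<sigma> K a b x + fcost r \<sigma> K x h"

end

(* For every real p, e^{-2rt} S_t^p is, up to the running term char_poly p * int e^{-2ru} S_u^p du, a
   multiple of an exponential martingale of W, and on [a,b] the running cost f(.,h) is a combination of
   powers of x. Hence Dynkin's formula reduces everything to optional stopping of exponential martingales:
   the gammas are explicit combinations of powers, and with a power sum phi solving (L - 2r) phi = -f,
   V = phi - sup_tau E[e^{-2r tau} (phi - M)(S_tau)]. After division by one homogeneous solution and a
   change of scale the supremum is the least concave majorant of an explicit continuous function: affine
   majorants give the upper bound (they correspond to martingales), and exit times from the intervals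
   between contact points attain it. The least concave majorant of a differentiable function is C^1, and
   it is affine wherever it lies above the function, which yields all the regularity claims. *)
theory Submission
  imports Defs
begin

section \<open>The least concave majorant on an interval\<close>

text \<open>Two features of the data make explicit solutions possible. Since
  \<open>ahat r \<sigma> K\<close> <= a, the maximum in \<open>Pd\<close> resolves on [a,b] to a
  single power, so the running cost is a combination of three powers; and none of their exponents 2,
  1 - d, -2d is a root of \<open>char_poly\<close>, so each source is inverted by a multiple of
  itself, without logarithms. Admissible stopping times can be unbounded. Optional stopping is
  therefore obtained at bounded times, and discounting together with confinement to [a,b] supplies
  the domination for the limit. The hull is encoded as the infimum of affine majorants, stored as
  (intercept, slope). In the coordinate y = \<open>s powr \<delta>\<close> a line is a homogeneous
  solution divided by \<open>s powr \<beta>m\<close>, so one majorant bounds the reward of all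
  stopping rules at once. Functions are carried as pairs (solution, source) satisfying both Dynkin's
  formula and the differential equation. Both properties are checked on powers and are linear in the
  pair, which replaces stochastic calculus.\<close>

definition concave_hull :: "real \<Rightarrow> real \<Rightarrow> (real \<Rightarrow> real) \<Rightarrow> real \<Rightarrow> real" where
  "concave_hull p q H y =
     (INF l\<in>{l. \<forall>z\<in>{p..q}. H z \<le> fst l + snd l * z}. fst l + snd l * y)"

locale hull_setup =
  fixes p q :: real and H :: "real \<Rightarrow> real"
  assumes pq: "p < q" and H_cont: "continuous_on {p..q} H"
begin

abbreviation "env \<equiv> concave_hull p q H"

lemma hull_le:
  assumes "\<And>z. z \<in> {p..q} \<Longrightarrow> H z \<le> A + B * z" "y \<in> {p..q}"
  shows "env y \<le> A + B * y"
proof -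
  have "env y \<le> fst (A, B) + snd (A, B) * y"
    unfolding concave_hull_def
  proof (rule cINF_lower)
    show "bdd_below ((\<lambda>l. fst l + snd l * y) ` {l. \<forall>z\<in>{p..q}. H z \<le> fst l + snd l * z})"
      using assms(2) by (auto intro!: bdd_belowI[of _ "H y"])
  qed (use assms(1) in auto)
  then show ?thesis by simp
qed

text \<open>A steep enough line starting slightly above \<open>H p\<close> dominates
  \<open>H\<close>: near p by continuity, further away because it has risen past the bound on
  \<open>H\<close>. It also shows that the set of majorants is nonempty.\<close>

lemma majorant_near_left:
  assumes "e > 0"
  shows "\<exists>A B. (\<forall>z\<in>{p..q}. H z \<le> A + B * z) \<and> A + B * p < H p + e"
proof -
  have "bounded (H ` {p..q})"
    using H_cont by (intro compact_imp_bounded compact_continuous_image) auto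
  then obtain C where C: "\<And>z. z \<in> {p..q} \<Longrightarrow> \<bar>H z\<bar> \<le> C"
    unfolding bounded_iff by (metis imageI real_norm_def)
  obtain d where d: "d > 0" "\<And>z. z \<in> {p..q} \<Longrightarrow> dist z p < d \<Longrightarrow> dist (H z) (H p) < e/2"
    using H_cont assms pq unfolding continuous_on_iff by (metis atLeastAtMost_iff half_gt_zero less_eq_real_def)
  \<comment> \<open>\<open>H\<close> varies by at most 2 * C, and this slope gains exactly that over
    the distance d beyond which continuity gives no control.\<close>
  define B where "B = 2 * C / d"
  have C0: "C \<ge> 0" using C[of p] pq by auto
  have "H z \<le> (H p + e/2 - B * p) + B * z" if "z \<in> {p..q}" for z
  proof (cases "z - p < d")
    case True
    then have "\<bar>H z - H p\<bar> < e/2" using d(2)[of z] that unfolding dist_real_def by auto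
    then have "H z \<le> H p + e/2" by linarith
    moreover have "B * (z - p) \<ge> 0" using C0 d that unfolding B_def by auto
    ultimately show ?thesis by (simp add: algebra_simps)
  next
    case False
    then have "B * (z - p) \<ge> B * d" using C0 d unfolding B_def by (intro mult_left_mono) auto
    moreover have "B * d = 2 * C" using d by (simp add: B_def)
    moreover have "H z \<le> C" "- C \<le> H p" using C[OF that] C[of p] pq by auto
    ultimately show ?thesis using assms by (simp add: algebra_simps)
  qed
  then show ?thesis using assms
    by (intro exI[of _ "H p + e/2 - B * p"] exI[of _ B]) auto
qed

lemma majorant_near_right:
  assumes "e > 0"
  shows "\<exists>A B. (\<forall>z\<in>{p..q}. H z \<le> A + B * z) \<and> A + B * q < H q + e"
proof -
  interpret R: hull_setup "-q" "-p" "\<lambda>y. H (-y)"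
    by unfold_locales (use pq H_cont in \<open>auto intro!: continuous_on_compose2[OF H_cont] continuous_intros\<close>)
  obtain A B where AB: "\<forall>z\<in>{-q..-p}. H (-z) \<le> A + B * z" "A + B * (-q) < H q + e"
    using R.majorant_near_left[OF assms] by auto
  have "H z \<le> A + (-B) * z" if "z \<in> {p..q}" for z
    using AB(1)[rule_format, of "-z"] that by auto
  then show ?thesis using AB(2) by (intro exI[of _ A] exI[of _ "-B"]) auto
qed

lemma hull_greatest:
  assumes "\<And>A B. (\<And>z. z \<in> {p..q} \<Longrightarrow> H z \<le> A + B * z) \<Longrightarrow> v \<le> A + B * y"
  shows "v \<le> env y"
  unfolding concave_hull_def
proof (rule cINF_greatest)
  obtain A B where "\<forall>z\<in>{p..q}. H z \<le> A + B * z" using majorant_near_left[of 1] by auto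
  then have "(A, B) \<in> {l. \<forall>z\<in>{p..q}. H z \<le> fst l + snd l * z}" by simp
  then show "{l. \<forall>z\<in>{p..q}. H z \<le> fst l + snd l * z} \<noteq> {}" by blast
qed (use assms in auto)

lemma le_hull:
  assumes "y \<in> {p..q}"
  shows "H y \<le> env y"
  unfolding concave_hull_def
proof (rule cINF_greatest)
  obtain A B where "\<forall>z\<in>{p..q}. H z \<le> A + B * z" using majorant_near_left[of 1] by auto
  then have "(A, B) \<in> {l. \<forall>z\<in>{p..q}. H z \<le> fst l + snd l * z}" by simp
  then show "{l. \<forall>z\<in>{p..q}. H z \<le> fst l + snd l * z} \<noteq> {}" by blast
qed (use assms in auto)

text \<open>An infimum of affine functions is concave; it is phrased for the negative because the
  subgradient and continuity facts used later speak of \<open>convex_on\<close>.\<close>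

lemma hull_concave: "convex_on {p..q} (\<lambda>y. - env y)"
proof (rule convex_onI)
  fix t x y :: real assume t: "0 < t" "t < 1" and xy: "x \<in> {p..q}" "y \<in> {p..q}"
  obtain A0 B0 where AB0: "\<forall>z\<in>{p..q}. H z \<le> A0 + B0 * z" using majorant_near_left[of 1] by auto
  have "(1 - t) * env x + t * env y \<le> env ((1 - t) *\<^sub>R x + t *\<^sub>R y)"
    unfolding concave_hull_def[of p q H "(1 - t) *\<^sub>R x + t *\<^sub>R y"]
  proof (rule cINF_greatest)
    have "(A0, B0) \<in> {l. \<forall>z\<in>{p..q}. H z \<le> fst l + snd l * z}" using AB0 by simp
    then show "{l. \<forall>z\<in>{p..q}. H z \<le> fst l + snd l * z} \<noteq> {}" by blast
  next
    fix l assume l: "l \<in> {l. \<forall>z\<in>{p..q}. H z \<le> fst l + snd l * z}"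
    have "env x \<le> fst l + snd l * x" "env y \<le> fst l + snd l * y"
      using l xy by (auto intro!: hull_le)
    then have "(1 - t) * env x + t * env y
        \<le> (1 - t) * (fst l + snd l * x) + t * (fst l + snd l * y)"
      using t by (intro add_mono mult_left_mono) auto
    then show "(1 - t) * env x + t * env y \<le> fst l + snd l * ((1 - t) *\<^sub>R x + t *\<^sub>R y)"
      by (simp add: algebra_simps)
  qed
  then show "- env ((1 - t) *\<^sub>R x + t *\<^sub>R y) \<le> (1 - t) * - env x + t * - env y"
    by simp
qed auto

section \<open>Supporting lines and their contact points\<close>

text \<open>The infimum of the difference quotients of \<open>- env\<close> to the right of
  \<open>y0\<close> is a subgradient of this convex function; its negative is the slope.\<close>

lemma hull_support:
  assumes "y0 \<in> {p<..<q}"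
  shows "\<exists>B. \<forall>y\<in>{p..q}. env y \<le> env y0 + B * (y - y0)"
proof -
  have "- env y \<ge> - env y0 + Inf ((\<lambda>t. (- env y0 - - env t) / (y0 - t)) ` ({y0<..} \<inter> {p..q})) * (y - y0)"
    if "y \<in> {p..q}" for y
    using convex_le_Inf_differential[OF hull_concave, of y0 y] assms that by simp
  then show ?thesis
    by (intro exI[of _ "- Inf ((\<lambda>t. (- env y0 - - env t) / (y0 - t)) ` ({y0<..} \<inter> {p..q}))"]) force
qed

text \<open>A supporting line of the hull that misses the graph of \<open>H\<close> on the left of \<open>y0\<close> could be
  tilted to a majorant with a smaller value at \<open>y0\<close>.\<close>

lemma hull_contact_left:
  assumes y0: "y0 \<in> {p<..<q}" and AB: "\<And>y. y \<in> {p..q} \<Longrightarrow> H y \<le> A + B * y"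
    and eq: "env y0 = A + B * y0" and lt: "H y0 < env y0"
  shows "\<exists>c\<in>{p..<y0}. H c = A + B * c"
proof (rule ccontr)
  assume "\<not> ?thesis"
  then have gap: "A + B * y - H y > 0" if "y \<in> {p..y0}" for y
    using AB[of y] that y0 eq lt by (cases "y = y0") force+
  have "continuous_on {p..y0} (\<lambda>y. A + B * y - H y)"
    by (intro continuous_intros continuous_on_subset[OF H_cont]) (use y0 in auto)
  then obtain m where m: "m \<in> {p..y0}" "\<And>y. y \<in> {p..y0} \<Longrightarrow> A + B * m - H m \<le> A + B * y - H y"
    using continuous_attains_inf[of "{p..y0}" "\<lambda>y. A + B * y - H y"] y0 by force
  define e where "e = A + B * m - H m"
  have e: "e > 0" using gap m(1) by (simp add: e_def)
  have "continuous_on {p..q} (\<lambda>y. A + B * y - H y)" by (intro continuous_intros H_cont)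
  then obtain d where d: "d > 0"
     "\<And>z. z \<in> {p..q} \<Longrightarrow> dist z y0 < d \<Longrightarrow> dist (A + B * z - H z) (A + B * y0 - H y0) < e/2"
    using e y0 unfolding continuous_on_iff
    by (metis atLeastAtMost_iff greaterThanLessThan_iff half_gt_zero less_eq_real_def)
  \<comment> \<open>The gap between the line and \<open>H\<close> is at least e on [p, y0] and, by
    continuity, stays above e/2 up to y1. The line can thus be pivoted at a point strictly to the
    right of y0.\<close>
  define y1 where "y1 = y0 + d/2"
  have e2: "A + B * y - H y > e/2" if "y \<in> {p..q}" "y \<le> y1" for y
  proof (cases "y \<le> y0")
    case True then show ?thesis using m(2)[of y] that e by (auto simp: e_def)
  next
    case False
    then have "dist y y0 < d" using that d by (auto simp: dist_real_def y1_def)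
    then have "\<bar>(A + B * y - H y) - (A + B * y0 - H y0)\<bar> < e/2"
      using d(2)[OF that(1)] by (simp add: dist_real_def)
    moreover have "e \<le> A + B * y0 - H y0" using m(2)[of y0] y0 by (auto simp: e_def)
    ultimately show ?thesis by linarith
  qed
  \<comment> \<open>Adding slope k about the pivot y1 lowers the line on the left of y1 by at most
    e/2, the amount reached at p, and raises it on the right. At y0 it drops strictly, which
    contradicts the minimality of the hull.\<close>
  define k where "k = e / (2 * (y1 - p))"
  have y1p: "y1 - p > 0" using y0 d by (auto simp: y1_def)
  have k: "k > 0" using e y1p by (simp add: k_def)
  have "H y \<le> (A - k * y1) + (B + k) * y" if y: "y \<in> {p..q}" for y
  proof (cases "y \<le> y1")
    case True
    have "k * (y1 - y) \<le> k * (y1 - p)" using y k by (intro mult_left_mono) auto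
    also have "\<dots> = e/2" using y1p unfolding k_def by (metis divide_divide_eq_left less_irrefl nonzero_eq_divide_eq times_divide_eq_left mult.commute)
    finally show ?thesis using e2[OF y True] by (simp add: algebra_simps)
  next
    case False
    then have "k * (y - y1) \<ge> 0" using k by auto
    then show ?thesis using AB[OF y] by (simp add: algebra_simps)
  qed
  then have "env y0 \<le> (A - k * y1) + (B + k) * y0" using y0 by (intro hull_le) auto
  then have "k * (y1 - y0) \<le> 0" using eq by (simp add: algebra_simps)
  then show False using k d by (simp add: y1_def mult_le_0_iff)
qed

text \<open>Reflection negates slopes and keeps intercepts, so majorants correspond to majorants.
  This carries the contact statement from the left side to the right side.\<close>

lemma hull_reflect: "concave_hull (-q) (-p) (\<lambda>y. H (-y)) y = env (-y)"
proof -
  have "(\<lambda>l. fst l + snd l * y) ` {l. \<forall>z\<in>{-q..-p}. H (-z) \<le> fst l + snd l * z}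
      = (\<lambda>l. fst l + snd l * (-y)) ` {l. \<forall>z\<in>{p..q}. H z \<le> fst l + snd l * z}"
    (is "?f ` ?S = ?g ` ?T")
  proof (intro equalityI subsetI)
    fix v assume "v \<in> ?f ` ?S"
    then obtain l where l: "l \<in> ?S" "v = ?f l" by auto
    have "(fst l, - snd l) \<in> ?T" using l(1) by (auto dest!: bspec[of _ _ "- z" for z])
    moreover have "v = ?g (fst l, - snd l)" using l by simp
    ultimately show "v \<in> ?g ` ?T" by (rule rev_image_eqI)
  next
    fix v assume "v \<in> ?g ` ?T"
    then obtain l where l: "l \<in> ?T" "v = ?g l" by auto
    have "(fst l, - snd l) \<in> ?S" using l(1) by (auto dest!: bspec[of _ _ "- z" for z])
    moreover have "v = ?f (fst l, - snd l)" using l by simp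
    ultimately show "v \<in> ?f ` ?S" by (rule rev_image_eqI)
  qed
  then show ?thesis unfolding concave_hull_def by simp
qed

lemma hull_contact_right:
  assumes y0: "y0 \<in> {p<..<q}" and AB: "\<And>y. y \<in> {p..q} \<Longrightarrow> H y \<le> A + B * y"
    and eq: "env y0 = A + B * y0" and lt: "H y0 < env y0"
  shows "\<exists>c\<in>{y0<..q}. H c = A + B * c"
proof -
  interpret R: hull_setup "-q" "-p" "\<lambda>y. H (-y)"
    by unfold_locales (use pq H_cont in \<open>auto intro!: continuous_on_compose2[OF H_cont] continuous_intros\<close>)
  have "\<exists>c\<in>{-q..<-y0}. H (-c) = A + (-B) * c"
  proof (rule R.hull_contact_left)
    show "H (- y) \<le> A + - B * y" if "y \<in> {- q..- p}" for y using AB[of "-y"] that by auto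
  qed (use y0 eq lt in \<open>auto simp: hull_reflect\<close>)
  then obtain c where "c \<in> {-q..<-y0}" "H (-c) = A + (-B) * c" by blast
  then show ?thesis by (intro bexI[of _ "-c"]) auto
qed

text \<open>A supporting line at \<open>y0\<close> majorises \<open>H\<close> and therefore meets
  its graph on both sides of \<open>y0\<close>; between the two contacts concavity lifts the hull to
  the line. The contact points become the barriers of the optimal exit time.\<close>

lemma hull_chord:
  assumes y0: "y0 \<in> {p<..<q}" and lt: "H y0 < env y0"
  shows "\<exists>c e A B. p \<le> c \<and> c < y0 \<and> y0 < e \<and> e \<le> q \<and> H c = A + B * c \<and> H e = A + B * e \<and>
           (\<forall>y\<in>{c..e}. env y = A + B * y)"
proof -
  obtain B where B: "\<And>y. y \<in> {p..q} \<Longrightarrow> env y \<le> env y0 + B * (y - y0)"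
    using hull_support[OF y0] by blast
  define A where "A = env y0 - B * y0"
  have up: "env y \<le> A + B * y" if "y \<in> {p..q}" for y
    using B[OF that] by (simp add: A_def algebra_simps)
  have maj: "H y \<le> A + B * y" if "y \<in> {p..q}" for y
    using up[OF that] le_hull[OF that] by simp
  have eq: "env y0 = A + B * y0" by (simp add: A_def)
  obtain c where c: "c \<in> {p..<y0}" "H c = A + B * c" using hull_contact_left[OF y0 maj eq lt] by blast
  obtain e where e: "e \<in> {y0<..q}" "H e = A + B * e" using hull_contact_right[OF y0 maj eq lt] by blast
  have "env y = A + B * y" if y: "y \<in> {c..e}" for y
  proof (rule antisym)
    show "env y \<le> A + B * y" using y c e by (intro up) auto
    show "A + B * y \<le> env y"
    proof -
      define t where "t = (y - c) / (e - c)"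
      have ce: "e - c > 0" using c e by auto
      have t: "0 \<le> t" "t \<le> 1" using y ce by (auto simp: t_def)
      have "t * (e - c) = y - c" using ce by (simp add: t_def)
      then have yt: "y = (1 - t) * c + t * e" by (simp add: algebra_simps)
      have "- env ((1 - t) *\<^sub>R c + t *\<^sub>R e) \<le> (1 - t) * - env c + t * - env e"
        using c e t by (intro convex_onD[OF hull_concave]) auto
      then have 1: "(1 - t) * env c + t * env e \<le> env y" using yt by simp
      have "A + B * c \<le> env c" "A + B * e \<le> env e" using le_hull[of c] le_hull[of e] c e y0 by auto
      then have "(1 - t) * (A + B * c) + t * (A + B * e) \<le> (1 - t) * env c + t * env e"
        using t by (intro add_mono mult_left_mono) auto
      moreover have "(1 - t) * (A + B * c) + t * (A + B * e) = A + B * y"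
        by (simp add: yt algebra_simps)
      ultimately show ?thesis using 1 by simp
    qed
  qed
  then show ?thesis using c e
    by (intro exI[of _ c] exI[of _ e] exI[of _ A] exI[of _ B]) auto
qed

section \<open>Endpoint contact, continuity and smoothness of the hull\<close>

text \<open>Contact at the ends is what later keeps a and b outside the continuation set.\<close>

lemma hull_left: "env p = H p"
proof (rule antisym)
  show "env p \<le> H p"
  proof (rule field_le_epsilon)
    fix e :: real assume "e > 0"
    then obtain A B where AB: "\<forall>z\<in>{p..q}. H z \<le> A + B * z" "A + B * p < H p + e"
      using majorant_near_left by blast
    then show "env p \<le> H p + e" using hull_le[of A B p] pq by auto
  qed
qed (use le_hull[of p] pq in auto)

lemma hull_right: "env q = H q"
proof (rule antisym)
  show "env q \<le> H q"
  proof (rule field_le_epsilon)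
    fix e :: real assume "e > 0"
    then obtain A B where AB: "\<forall>z\<in>{p..q}. H z \<le> A + B * z" "A + B * q < H q + e"
      using majorant_near_right by blast
    then show "env q \<le> H q + e" using hull_le[of A B q] pq by auto
  qed
qed (use le_hull[of q] pq in auto)

text \<open>Concavity gives continuity only in the interior. At an endpoint the hull is squeezed
  between \<open>H\<close> and a line that almost touches it.\<close>

lemma hull_continuous_contact:
  assumes y0: "y0 \<in> {p..q}"
    and near: "\<And>e. e > 0 \<Longrightarrow> \<exists>A B. (\<forall>z\<in>{p..q}. H z \<le> A + B * z) \<and> A + B * y0 < H y0 + e"
  shows "continuous (at y0 within {p..q}) env"
proof -
  have "env y0 \<le> H y0"
  proof (rule field_le_epsilon)
    fix e :: real assume "e > 0"
    then show "env y0 \<le> H y0 + e" using near[of e] hull_le[of _ _ y0] y0 by fastforce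
  qed
  then have eq: "env y0 = H y0" using le_hull[OF y0] by simp
  show ?thesis
    unfolding continuous_within eq
  proof (rule order_tendstoI)
    fix v assume v: "v < H y0"
    have "(H \<longlongrightarrow> H y0) (at y0 within {p..q})" using H_cont y0 by (simp add: continuous_on)
    then have "\<forall>\<^sub>F y in at y0 within {p..q}. v < H y" using v by (rule order_tendstoD)
    moreover have "\<forall>\<^sub>F y in at y0 within {p..q}. y \<in> {p..q}" by (simp add: eventually_at_filter)
    ultimately show "\<forall>\<^sub>F y in at y0 within {p..q}. v < env y"
      by eventually_elim (use le_hull in force)
  next
    fix v assume v: "H y0 < v"
    then obtain A B where AB: "\<forall>z\<in>{p..q}. H z \<le> A + B * z" "A + B * y0 < v"
      using near[of "v - H y0"] by auto
    have "((\<lambda>y. A + B * y) \<longlongrightarrow> A + B * y0) (at y0 within {p..q})" by (intro tendsto_intros)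
    then have "\<forall>\<^sub>F y in at y0 within {p..q}. A + B * y < v" using AB(2) by (rule order_tendstoD)
    moreover have "\<forall>\<^sub>F y in at y0 within {p..q}. y \<in> {p..q}" by (simp add: eventually_at_filter)
    ultimately show "\<forall>\<^sub>F y in at y0 within {p..q}. env y < v"
      by eventually_elim (use hull_le[of A B] AB(1) in force)
  qed
qed

lemma hull_continuous: "continuous_on {p..q} env"
proof -
  have "isCont (\<lambda>y. - env y) y" if "y \<in> {p<..<q}" for y
  proof -
    have "continuous_on {p<..<q} (\<lambda>y. - env y)"
      by (rule convex_on_continuous[OF open_greaterThanLessThan])
         (auto intro: convex_on_subset[OF hull_concave])
    then show ?thesis using that by (simp add: continuous_on_eq_continuous_at)
  qed
  then have "isCont env y" if "y \<in> {p<..<q}" for y using that continuous_minus[of "at y" "\<lambda>y. - env y"] by force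
  then have "continuous (at y within {p..q}) env" if "y \<in> {p..q}" for y
    using that hull_continuous_contact[of p] hull_continuous_contact[of q]
      majorant_near_left majorant_near_right continuous_at_imp_continuous_at_within[of y env]
    by (cases "y = p"; cases "y = q") auto
  then show ?thesis by (simp add: continuous_on_eq_continuous_within)
qed

text \<open>At a contact point the hull is squeezed between \<open>H\<close> and a supporting line, which must be
  tangent to \<open>H\<close>.\<close>

lemma hull_differentiable:
  assumes y0: "y0 \<in> {p<..<q}" and H': "(H has_real_derivative D) (at y0)"
  shows "\<exists>D'. (env has_real_derivative D') (at y0)"
proof (cases "H y0 < env y0")
  case True
  then obtain c e A B where ce: "c < y0" "y0 < e" "\<And>y. y \<in> {c..e} \<Longrightarrow> env y = A + B * y"
    using hull_chord[OF y0] by blast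
  have "((\<lambda>y. A + B * y) has_real_derivative B) (at y0)" by (auto intro!: derivative_eq_intros)
  then have "(env has_real_derivative B) (at y0)"
    by (rule has_field_derivative_transform_within_open[of _ _ _ "{c<..<e}"]) (use ce in auto)
  then show ?thesis by blast
next
  case False
  then have eq: "env y0 = H y0" using le_hull[of y0] y0 by auto
  obtain B where B: "\<And>y. y \<in> {p..q} \<Longrightarrow> env y \<le> env y0 + B * (y - y0)"
    using hull_support[OF y0] by blast
  obtain d where d: "d > 0" "ball y0 d \<subseteq> {p<..<q}"
    using y0 open_greaterThanLessThan openE by blast
  \<comment> \<open>The supporting line minus \<open>H\<close> has a local minimum 0 at the contact
    point, so its slope must be D.\<close>
  have "((\<lambda>y. env y0 + B * (y - y0) - H y) has_real_derivative (B - D)) (at y0)"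
    by (auto intro!: derivative_eq_intros H')
  then have "B - D = 0"
  proof (rule DERIV_local_min[OF _ d(1)], intro allI impI)
    fix y assume "\<bar>y0 - y\<bar> < d"
    then have "y \<in> ball y0 d" by (simp add: dist_real_def)
    then have "y \<in> {p..q}" using d(2) by auto
    then show "env y0 + B * (y0 - y0) - H y0 \<le> env y0 + B * (y - y0) - H y"
      using B[of y] le_hull[of y] eq by simp
  qed
  then have BD: "B = D" by simp
  \<comment> \<open>After subtraction of D * h the increment of the hull lies between that of
    \<open>H\<close> and 0, so the error of its difference quotient is dominated by that of
    \<open>H\<close>.\<close>
  have "((\<lambda>h. (H (y0 + h) - H y0) / h - D) \<longlongrightarrow> 0) (at 0)"
    using H' unfolding DERIV_def by (simp add: LIM_zero)
  then have "((\<lambda>h. (env (y0 + h) - env y0) / h - D) \<longlongrightarrow> 0) (at 0)"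
  proof (rule tendsto_0_le[where K = 1])
    have "\<forall>\<^sub>F h in at 0. h \<noteq> 0 \<and> \<bar>h\<bar> < d"
      using d(1) by (auto simp: eventually_at dist_real_def intro!: exI[of _ d])
    then show "\<forall>\<^sub>F h in at 0. norm ((env (y0 + h) - env y0) / h - D)
        \<le> norm ((H (y0 + h) - H y0) / h - D) * 1"
    proof eventually_elim
      case (elim h)
      then have "y0 + h \<in> ball y0 d" by (simp add: dist_real_def)
          then have y: "y0 + h \<in> {p..q}" using d(2) by auto
      have "H (y0 + h) - H y0 - D * h \<le> env (y0 + h) - env y0 - D * h"
        using le_hull[OF y] eq by simp
      moreover have "env (y0 + h) - env y0 - D * h \<le> 0" using B[OF y] BD by simp
      ultimately have "\<bar>env (y0 + h) - env y0 - D * h\<bar> \<le> \<bar>H (y0 + h) - H y0 - D * h\<bar>" by simp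
      moreover have "(u - D * h) / h = u / h - D" for u using elim by (simp add: diff_divide_distrib)
      ultimately show ?case using elim
        by (metis abs_divide abs_ge_zero divide_right_mono mult.right_neutral real_norm_def)
    qed
  qed
  then have "(env has_real_derivative D) (at y0)"
    unfolding DERIV_def by (rule LIM_zero_cancel)
  then show ?thesis by blast
qed

text \<open>A differentiable concave function has a continuous derivative. Fix z near y0 whose
  secant slope already beats the level v and move the base point y: the tangent inequality compares
  \<open>D y\<close> with the secant from y to z, which is continuous in y.\<close>

lemma hull_C1:
  assumes H': "\<And>y. y \<in> {p<..<q} \<Longrightarrow> \<exists>D. (H has_real_derivative D) (at y)"
  shows "\<exists>D. (\<forall>y\<in>{p<..<q}. (env has_real_derivative D y) (at y)) \<and> continuous_on {p<..<q} D"
proof -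
  have "\<exists>D'. (env has_real_derivative D') (at y)" if "y \<in> {p<..<q}" for y
    using H'[OF that] hull_differentiable[OF that] by blast
  then obtain D where D: "\<And>y. y \<in> {p<..<q} \<Longrightarrow> (env has_real_derivative D y) (at y)" by metis
  have tangent: "env z \<le> env y + D y * (z - y)" if y: "y \<in> {p<..<q}" and z: "z \<in> {p..q}" for y z
  proof -
    obtain B where B: "\<And>y'. y' \<in> {p..q} \<Longrightarrow> env y' \<le> env y + B * (y' - y)"
      using hull_support[OF y] by blast
    obtain d where d: "d > 0" "ball y d \<subseteq> {p<..<q}"
      using y open_greaterThanLessThan openE by blast
    have "((\<lambda>y'. env y + B * (y' - y) - env y') has_real_derivative (B - D y)) (at y)"
      by (auto intro!: derivative_eq_intros D[OF y])
    then have "B - D y = 0"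
    proof (rule DERIV_local_min[OF _ d(1)], intro allI impI)
      fix y' assume "\<bar>y - y'\<bar> < d"
      then have "y' \<in> ball y d" by (simp add: dist_real_def)
      then have "y' \<in> {p..q}" using d(2) by auto
      then show "env y + B * (y - y) - env y \<le> env y + B * (y' - y) - env y'"
        using B[of y'] by simp
    qed
    then show ?thesis using B[OF z] by simp
  qed
  have "isCont D y0" if y0: "y0 \<in> {p<..<q}" for y0
    unfolding isCont_def
  proof (rule order_tendstoI)
    have hc: "(env \<longlongrightarrow> env y0) (at y0)" using D[OF y0] DERIV_isCont isCont_def by blast
    have ev: "\<forall>\<^sub>F y in at y0. y \<in> {p<..<q}" using y0 by (intro eventually_at_in_open') auto
    have dq: "((\<lambda>z. (env z - env y0) / (z - y0)) \<longlongrightarrow> D y0) (at y0)"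
      using D[OF y0] by (simp add: has_field_derivative_iff)
    {
      fix v assume v: "v < D y0"
      have "\<forall>\<^sub>F z in at_right y0. v < (env z - env y0) / (z - y0)"
        using order_tendstoD(1)[OF dq v] by (simp add: eventually_at_split)
      moreover have "\<forall>\<^sub>F z in at_right y0. z \<in> {y0<..<q}" using y0 by (intro eventually_at_right_real) auto
      ultimately have "\<exists>z. v < (env z - env y0) / (z - y0) \<and> z \<in> {y0<..<q}"
        by (intro eventually_happens'[OF trivial_limit_at_right_real] eventually_conj)
      then obtain z where z: "v < (env z - env y0) / (z - y0)" "z \<in> {y0<..<q}" by blast
      have "((\<lambda>y. (env z - env y) / (z - y)) \<longlongrightarrow> (env z - env y0) / (z - y0)) (at y0)"
        using z by (intro tendsto_intros hc) auto
      then have "\<forall>\<^sub>F y in at y0. v < (env z - env y) / (z - y)" using z(1) by (rule order_tendstoD)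
      moreover have "\<forall>\<^sub>F y in at y0. y < z" using z by (intro order_tendstoD[OF tendsto_ident_at]) auto
      ultimately show "\<forall>\<^sub>F y in at y0. v < D y" using ev
      proof eventually_elim
        case (elim y)
        from elim z have "v * (z - y) < env z - env y" by (simp add: field_simps)
          also have "\<dots> \<le> D y * (z - y)" using tangent[of y z] elim z by auto
          finally show ?case using elim by simp
      qed
    next
      \<comment> \<open>For the upper bound z is taken to the left, where dividing the tangent
        inequality by z - y reverses it.\<close>
      fix v assume v: "D y0 < v"
      have "\<forall>\<^sub>F z in at_left y0. (env z - env y0) / (z - y0) < v"
        using order_tendstoD(2)[OF dq v] by (simp add: eventually_at_split)
      moreover have "\<forall>\<^sub>F z in at_left y0. z \<in> {p<..<y0}" using y0 by (intro eventually_at_left_real) auto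
      ultimately have "\<exists>z. (env z - env y0) / (z - y0) < v \<and> z \<in> {p<..<y0}"
        by (intro eventually_happens'[OF trivial_limit_at_left_real] eventually_conj)
      then obtain z where z: "(env z - env y0) / (z - y0) < v" "z \<in> {p<..<y0}" by blast
      have "((\<lambda>y. (env z - env y) / (z - y)) \<longlongrightarrow> (env z - env y0) / (z - y0)) (at y0)"
        using z by (intro tendsto_intros hc) auto
      then have "\<forall>\<^sub>F y in at y0. (env z - env y) / (z - y) < v" using z(1) by (rule order_tendstoD)
      moreover have "\<forall>\<^sub>F y in at y0. z < y" using z by (intro order_tendstoD[OF tendsto_ident_at]) auto
      ultimately show "\<forall>\<^sub>F y in at y0. D y < v" using ev
      proof eventually_elim
        case (elim y)
        from elim z have "v * (z - y) < env z - env y" by (simp add: field_simps)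
          then have "D y * (y - z) < v * (y - z)"
            using tangent[of y z] elim z by (simp add: algebra_simps)
          then show ?case using elim by simp
      qed
    }
  qed
  then have "continuous_on {p<..<q} D" by (simp add: continuous_on_eq_continuous_at)
  with D show ?thesis by blast
qed

end

section \<open>Optional stopping for the exponential martingale\<close>

text \<open>Completing the square: exponential tilting only moves the mean, so the tilted density is
  again a probability density.\<close>

lemma normal_density_exp_shift:
  assumes "u > 0"
  shows "normal_density 0 (sqrt u) x * exp (\<theta> * x - \<theta>\<^sup>2 * u / 2) = normal_density (\<theta> * u) (sqrt u) x"
proof -
  have "- (x - 0)\<^sup>2 / (2 * (sqrt u)\<^sup>2) + (\<theta> * x - \<theta>\<^sup>2 * u / 2) = - (x - \<theta> * u)\<^sup>2 / (2 * (sqrt u)\<^sup>2)"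
    using assms by (simp add: field_simps power2_eq_square)
  then show ?thesis unfolding normal_density_def by (simp flip: exp_add)
qed

lemma exp_set_integral:
  assumes "0 \<le> t" "c \<noteq> 0"
  shows "(\<integral>\<^sup>+u. indicator {0..t} u * ennreal (exp (c * u)) \<partial>lborel) = ennreal ((exp (c * t) - 1) / c)"
proof -
  have "(\<integral>\<^sup>+u. ennreal (exp (c * u)) * indicator {0..t} u \<partial>lborel)
      = ennreal (exp (c * t) / c - exp (c * 0) / c)"
    by (rule nn_integral_FTC_Icc) (use assms in \<open>auto intro!: derivative_eq_intros\<close>)
  then show ?thesis by (simp add: mult.commute diff_divide_distrib)
qed

lemma powr_le_max:
  fixes s :: real
  assumes "0 < a" "s \<in> {a..b}"
  shows "s powr p \<le> max (a powr p) (b powr p)"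
proof (cases "p \<ge> 0")
  case True
  then have "s powr p \<le> b powr p" using assms by (intro powr_mono2) auto
  then show ?thesis by simp
next
  case False
  then have "s powr p \<le> a powr p" using assms by (intro powr_mono2') auto
  then show ?thesis by simp
qed

section \<open>Brownian motion, its augmented past and stopping times\<close>

locale brownian_motion =
  fixes M :: "'a measure" and W :: "real \<Rightarrow> 'a \<Rightarrow> real"
  assumes BM: "is_std_BM M W"

sublocale brownian_motion \<subseteq> prob_space M
  using BM by (simp add: is_std_BM_def)

context brownian_motion
begin

abbreviation past_gen :: "real \<Rightarrow> 'a set set" where
  "past_gen s \<equiv> (\<Union>u\<in>{0..s}. {W u -` A \<inter> space M | A. A \<in> sets borel})"

definition past :: "real \<Rightarrow> 'a set set" where
  "past s = sigma_sets (space M) (past_gen s)"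

text \<open>Augmented by null sets, but before right limits are taken: \<open>BM_filtration\<close>
  at t is the intersection of these families over s > t.\<close>

definition past_null :: "real \<Rightarrow> 'a set set" where
  "past_null s = sigma_sets (space M) (past_gen s \<union> null_sets M)"

lemma W_measurable [measurable]: "W t \<in> borel_measurable M"
  using BM by (simp add: is_std_BM_def)

lemma W_0: "\<omega> \<in> space M \<Longrightarrow> W 0 \<omega> = 0"
  using BM by (simp add: is_std_BM_def)

lemma W_continuous: "\<omega> \<in> space M \<Longrightarrow> continuous_on {0..} (\<lambda>t. W t \<omega>)"
  using BM by (simp add: is_std_BM_def)

lemma W_increment:
  assumes "0 \<le> s" "s < t"
  shows "distributed M lborel (\<lambda>\<omega>. W t \<omega> - W s \<omega>) (normal_density 0 (sqrt (t - s)))"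
    and "indep_set (past s)
          (sigma_sets (space M) {(\<lambda>\<omega>. W t \<omega> - W s \<omega>) -` A \<inter> space M | A. A \<in> sets borel})"
  using BM assms by (auto simp: is_std_BM_def past_def)

lemma past_gen_Pow: "past_gen s \<subseteq> Pow (space M)" by auto

lemma past_subset_events: "past s \<subseteq> events"
  unfolding past_def by (rule sets.sigma_sets_subset) auto

lemma past_null_subset_events: "past_null s \<subseteq> events"
  unfolding past_null_def by (rule sets.sigma_sets_subset) auto

lemma sigma_algebra_past_null: "sigma_algebra (space M) (past_null s)"
  unfolding past_null_def by (rule sigma_algebra_sigma_sets) (auto dest: null_setsD2 sets.sets_into_space)

lemma past_subset_past_null: "s \<le> t \<Longrightarrow> past s \<subseteq> past_null t"
  unfolding past_def past_null_def by (intro sigma_sets_subseteq) fastforce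

lemma null_subset_past_null: "null_sets M \<subseteq> past_null t"
  unfolding past_null_def by (auto intro: sigma_sets.Basic)

text \<open>An intersection of sigma-algebras is a sigma-algebra, hence a fixed point of
  \<open>sigma_sets\<close>.\<close>

lemma sets_BM_filtration: "sets (BM_filtration M W t) = (\<Inter>s\<in>{t<..}. past_null s)"
proof -
  let ?X = "\<Inter>s\<in>{t<..}. past_null s"
  have "past_null (t + 1) \<subseteq> Pow (space M)"
    using past_null_subset_events sets.space_closed by blast
  then have X: "?X \<subseteq> Pow (space M)" by (rule order_trans[rotated]) (auto intro!: INF_lower)
  have "sigma_sets (space M) ?X = ?X"
  proof (intro equalityI INF_greatest)
    fix s assume "s \<in> {t<..}"
    then show "sigma_sets (space M) ?X \<subseteq> past_null s"
      by (intro sigma_algebra.sigma_sets_subset[OF sigma_algebra_past_null] INF_lower)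
  qed (rule sigma_sets_superset_generator)
  then show ?thesis
    unfolding BM_filtration_def past_null_def[symmetric] using X by simp
qed

lemma space_BM_filtration: "space (BM_filtration M W t) = space M"
  unfolding BM_filtration_def by (simp add: space_measure_of_conv)

text \<open>The working form of the stopping property: knowledge of \<tau> <= t is available at
  every strictly later time s, not necessarily at t itself.\<close>

lemma stopping_time_iff:
  "stopping_time (BM_filtration M W) \<tau> \<longleftrightarrow> (\<forall>t s. t < s \<longrightarrow> {\<omega>\<in>space M. \<tau> \<omega> \<le> t} \<in> past_null s)"
  unfolding stopping_time_def pred_def space_BM_filtration sets_BM_filtration by auto

lemma stopping_time_min_const:
  assumes "stopping_time (BM_filtration M W) \<tau>" "0 \<le> T"
  shows "stopping_time (BM_filtration M W) (\<lambda>\<omega>. min (\<tau> \<omega>) T)"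
  unfolding stopping_time_iff
proof (intro allI impI)
  fix t s :: real assume "t < s"
  interpret S: sigma_algebra "space M" "past_null s" by (rule sigma_algebra_past_null)
  show "{\<omega> \<in> space M. min (\<tau> \<omega>) T \<le> t} \<in> past_null s"
    using assms(1) \<open>t < s\<close> by (cases "T \<le> t") (auto simp: stopping_time_iff min_le_iff_disj)
qed

lemma stopping_time_measurable:
  assumes "stopping_time (BM_filtration M W) \<tau>"
  shows "\<tau> \<in> borel_measurable M"
proof (rule borel_measurableI_le)
  fix t
  have "{\<omega>\<in>space M. \<tau> \<omega> \<le> t} \<in> past_null (t + 1)" using assms by (simp add: stopping_time_iff)
  then show "{\<omega>\<in>space M. \<tau> \<omega> \<le> t} \<in> events" using past_null_subset_events by blast
qed

text \<open>Independence of increments is given for the raw past only. Agreement with a raw event up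
  to a null set survives complements and countable unions, so it passes to the whole augmented
  sigma-algebra.\<close>

lemma past_null_approx:
  assumes "A \<in> past_null s"
  shows "\<exists>B\<in>past s. \<exists>N\<in>null_sets M. (A - B) \<union> (B - A) \<subseteq> N"
  using assms unfolding past_null_def
proof (induction rule: sigma_sets.induct)
  case (Basic A)
  then show ?case
  proof
    assume "A \<in> past_gen s"
    then have "A \<in> past s" unfolding past_def by (rule sigma_sets.Basic)
    then show ?thesis by (intro bexI[of _ A] bexI[of _ "{}"]) auto
  next
    assume "A \<in> null_sets M"
    then show ?thesis unfolding past_def
      by (intro bexI[of _ "{}"] bexI[of _ A]) (auto intro: sigma_sets.Empty)
  qed
next
  case Empty
  then show ?case unfolding past_def
    by (intro bexI[of _ "{}"] bexI[of _ "{}"]) (auto intro: sigma_sets.Empty)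
next
  case (Compl A)
  then obtain B N where "B \<in> past s" "N \<in> null_sets M" "(A - B) \<union> (B - A) \<subseteq> N" by blast
  then show ?case unfolding past_def
    by (intro bexI[of _ "space M - B"] bexI[of _ N])
       (auto intro: sigma_sets.Compl dest: sigma_sets_into_sp[OF past_gen_Pow])
next
  case (Union A)
  then have "\<forall>i. \<exists>B N. B \<in> past s \<and> N \<in> null_sets M \<and> (A i - B) \<union> (B - A i) \<subseteq> N" by blast
  then obtain B N where BN: "\<And>i. B i \<in> past s" "\<And>i. N i \<in> null_sets M"
     "\<And>i. (A i - B i) \<union> (B i - A i) \<subseteq> N i" by metis
  show ?case
  proof (rule bexI[of _ "\<Union>i. B i"], rule bexI[of _ "\<Union>i. N i"])
    show "(\<Union>i. A i) - (\<Union>i. B i) \<union> ((\<Union>i. B i) - (\<Union>i. A i)) \<subseteq> (\<Union>i. N i)" using BN(3) by fast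
    show "(\<Union>i. N i) \<in> null_sets M" using BN(2) by auto
    show "(\<Union>i. B i) \<in> past s" using BN(1) unfolding past_def by (intro sigma_sets.Union) auto
  qed
qed

section \<open>The exponential martingale at deterministic times\<close>

definition expm :: "real \<Rightarrow> real \<Rightarrow> 'a \<Rightarrow> real" where
  "expm \<theta> t \<omega> = exp (\<theta> * W t \<omega> - \<theta>\<^sup>2 * t / 2)"

lemma expm_measurable [measurable]: "expm \<theta> t \<in> borel_measurable M"
  unfolding expm_def[abs_def] by measurable

lemma expm_pos: "expm \<theta> t \<omega> > 0" by (simp add: expm_def)

lemma expm_sq: "(expm \<theta> t \<omega>)\<^sup>2 = exp (\<theta>\<^sup>2 * t) * expm (2 * \<theta>) t \<omega>"
  by (simp add: expm_def power2_eq_square algebra_simps flip: exp_add)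

lemma expm_increment:
  assumes "0 \<le> s" "s < t"
  shows "integrable M (\<lambda>\<omega>. exp (\<theta> * (W t \<omega> - W s \<omega>) - \<theta>\<^sup>2 * (t - s) / 2))" (is ?I)
    and "expectation (\<lambda>\<omega>. exp (\<theta> * (W t \<omega> - W s \<omega>) - \<theta>\<^sup>2 * (t - s) / 2)) = 1" (is ?E)
proof -
  note D = W_increment(1)[OF assms]
  have ts: "t - s > 0" using assms by simp
  have "integrable lborel (\<lambda>x. normal_density 0 (sqrt (t - s)) x * exp (\<theta> * x - \<theta>\<^sup>2 * (t - s) / 2))"
    unfolding normal_density_exp_shift[OF ts] using ts by simp
  then show ?I by (subst (asm) distributed_integrable[OF D]) auto
  have "expectation (\<lambda>\<omega>. exp (\<theta> * (W t \<omega> - W s \<omega>) - \<theta>\<^sup>2 * (t - s) / 2))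
     = (\<integral>x. normal_density 0 (sqrt (t - s)) x * exp (\<theta> * x - \<theta>\<^sup>2 * (t - s) / 2) \<partial>lborel)"
    by (subst distributed_integral[OF D]) auto
  then show ?E unfolding normal_density_exp_shift[OF ts] using ts by simp
qed

lemma expm_integrable:
  assumes "0 \<le> t"
  shows "integrable M (expm \<theta> t)" and "expectation (expm \<theta> t) = 1"
proof -
  have "integrable M (expm \<theta> t) \<and> expectation (expm \<theta> t) = 1"
  proof (cases "t = 0")
    case True
    have "integrable M (expm \<theta> t) = integrable M (\<lambda>_. 1::real)"
      by (rule Bochner_Integration.integrable_cong) (auto simp: True expm_def W_0)
    moreover have "expectation (expm \<theta> t) = expectation (\<lambda>_. 1)"
      by (rule Bochner_Integration.integral_cong) (auto simp: True expm_def W_0)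
    ultimately show ?thesis by (simp add: prob_space)
  next
    case False
    then have t: "0 < t" using assms by simp
    have "integrable M (expm \<theta> t) = integrable M (\<lambda>\<omega>. exp (\<theta> * (W t \<omega> - W 0 \<omega>) - \<theta>\<^sup>2 * (t - 0) / 2))"
      by (rule Bochner_Integration.integrable_cong) (auto simp: expm_def W_0)
    moreover have "expectation (expm \<theta> t) = expectation (\<lambda>\<omega>. exp (\<theta> * (W t \<omega> - W 0 \<omega>) - \<theta>\<^sup>2 * (t - 0) / 2))"
      by (rule Bochner_Integration.integral_cong) (auto simp: expm_def W_0)
    ultimately show ?thesis using expm_increment[of 0 t \<theta>] t by simp
  qed
  then show "integrable M (expm \<theta> t)" "expectation (expm \<theta> t) = 1" by auto
qed

lemma expm_integrable_on:
  assumes "0 \<le> t" "A \<in> events"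
  shows "integrable M (\<lambda>\<omega>. indicator A \<omega> * expm \<theta> t \<omega>)"
  using integrable_real_mult_indicator[OF assms(2) expm_integrable(1)[OF assms(1)]]
  by (simp add: mult.commute)

text \<open>The value at t is the value at s times a factor that depends on the increment alone;
  this factor is independent of the past and has mean 1.\<close>

lemma expm_martingale_past:
  assumes "0 \<le> s" "s < t" and B: "B \<in> past s"
  shows "expectation (\<lambda>\<omega>. indicator B \<omega> * expm \<theta> t \<omega>) = expectation (\<lambda>\<omega>. indicator B \<omega> * expm \<theta> s \<omega>)"
proof -
  define Z where "Z = (\<lambda>\<omega>. exp (\<theta> * (W t \<omega> - W s \<omega>) - \<theta>\<^sup>2 * (t - s) / 2))"
  define X where "X = (\<lambda>\<omega>. indicator B \<omega> * expm \<theta> s \<omega>)"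
  \<comment> \<open>Both sigma-algebras are turned into measure spaces, so that measurability of X
    and Z with respect to them can be derived by rule and then read back as inclusion of the
    generated families.\<close>
  let ?S = "sigma (space M) (past_gen s)"
  let ?D = "sigma (space M) {(\<lambda>\<omega>. W t \<omega> - W s \<omega>) -` A \<inter> space M | A. A \<in> sets borel}"
  have sS: "sets ?S = past s" unfolding past_def by (rule sets_measure_of) auto
  have sD: "sets ?D = sigma_sets (space M) {(\<lambda>\<omega>. W t \<omega> - W s \<omega>) -` A \<inter> space M | A. A \<in> sets borel}"
    by (rule sets_measure_of) auto
  have B': "B \<in> events" using B past_subset_events by blast
  have "W s \<in> borel_measurable ?S"
  proof (rule measurableI)
    fix A :: "real set" assume "A \<in> sets borel"
    then have "W s -` A \<inter> space M \<in> past_gen s" using assms(1) by (intro UN_I[of s]) auto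
    then show "W s -` A \<inter> space ?S \<in> sets ?S"
      unfolding sS past_def space_measure_of_conv by (rule sigma_sets.Basic)
  qed auto
  moreover have "B \<in> sets ?S" using B sS by simp
  ultimately have XS: "X \<in> borel_measurable ?S" unfolding X_def expm_def by measurable
  have "(\<lambda>\<omega>. W t \<omega> - W s \<omega>) \<in> borel_measurable ?D"
  proof (rule measurableI)
    fix A :: "real set" assume "A \<in> sets borel"
    then show "(\<lambda>\<omega>. W t \<omega> - W s \<omega>) -` A \<inter> space ?D \<in> sets ?D" 
      unfolding sD space_measure_of_conv by (intro sigma_sets.Basic) auto
  qed auto
  then have ZD: "Z \<in> borel_measurable ?D" unfolding Z_def by measurable
  have "indep_var borel X borel Z"
    unfolding indep_var_eq
  proof (intro conjI)
    show "random_variable borel X" unfolding X_def using B' by measurable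
    show "random_variable borel Z" unfolding Z_def by measurable
    have 1: "sigma_sets (space M) {X -` A \<inter> space M |A. A \<in> sets borel} \<subseteq> past s"
      using measurable_sets[OF XS] unfolding sS space_measure_of_conv
      by (intro sigma_algebra.sigma_sets_subset sigma_algebra_sigma_sets[of "past_gen s" "space M", folded past_def])
         auto
    have 2: "sigma_sets (space M) {Z -` A \<inter> space M |A. A \<in> sets borel} \<subseteq> sets ?D"
      using measurable_sets[OF ZD] unfolding sD space_measure_of_conv
      by (intro sigma_algebra.sigma_sets_subset sigma_algebra_sigma_sets) auto
    note I = W_increment(2)[OF assms(1,2), folded sD]
    show "indep_set (sigma_sets (space M) {X -` A \<inter> space M |A. A \<in> sets borel})
       (sigma_sets (space M) {Z -` A \<inter> space M |A. A \<in> sets borel})"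
    proof (rule indep_setI)
      show "sigma_sets (space M) {X -` A \<inter> space M |A. A \<in> sets borel} \<subseteq> events"
        using 1 past_subset_events by blast
      show "sigma_sets (space M) {Z -` A \<inter> space M |A. A \<in> sets borel} \<subseteq> events"
        by (rule sets.sigma_sets_subset) (auto simp: Z_def)
    qed (use 1 2 indep_setD[OF I] in blast)
  qed
  then have "expectation (\<lambda>\<omega>. X \<omega> * Z \<omega>) = expectation X * expectation Z"
    using expm_increment(1)[OF assms(1,2)] expm_integrable_on[OF assms(1) B']
    by (intro indep_var_lebesgue_integral) (auto simp: X_def Z_def)
  also have "(\<lambda>\<omega>. X \<omega> * Z \<omega>) = (\<lambda>\<omega>. indicator B \<omega> * expm \<theta> t \<omega>)"
    by (auto simp: X_def Z_def expm_def indicator_def algebra_simps diff_divide_distrib simp flip: exp_add)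
  finally show ?thesis using expm_increment(2)[OF assms(1,2)] by (simp add: X_def Z_def)
qed

lemma expm_martingale:
  assumes "0 \<le> s" "s < t" and A: "A \<in> past_null s"
  shows "expectation (\<lambda>\<omega>. indicator A \<omega> * expm \<theta> t \<omega>) = expectation (\<lambda>\<omega>. indicator A \<omega> * expm \<theta> s \<omega>)"
proof -
  obtain B N where B: "B \<in> past s" and N: "N \<in> null_sets M" "(A - B) \<union> (B - A) \<subseteq> N"
    using past_null_approx[OF A] by blast
  have [measurable]: "A \<in> events" "B \<in> events"
    using A B past_subset_events past_null_subset_events by auto
  have "AE \<omega> in M. \<omega> \<notin> N" using N(1) by (rule AE_not_in)
  then have AE: "AE \<omega> in M. (indicator A \<omega> :: real) = indicator B \<omega>"
    by eventually_elim (use N(2) in \<open>auto simp: indicator_def\<close>)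
  have "expectation (\<lambda>\<omega>. indicator A \<omega> * expm \<theta> u \<omega>) = expectation (\<lambda>\<omega>. indicator B \<omega> * expm \<theta> u \<omega>)" for u
    by (rule integral_cong_AE) (use AE in auto)
  then show ?thesis using expm_martingale_past[OF assms(1,2) B] by simp
qed

section \<open>Discretised times and joint measurability\<close>

text \<open>The grid time \<open>(\<lceil>n \<tau>\<rceil> + 1) / n\<close> lies strictly beyond \<open>\<tau>\<close>, so that each of its level sets
  already belongs to the augmented past without taking right limits of the filtration.\<close>

definition grid :: "nat \<Rightarrow> real \<Rightarrow> real" where
  "grid n t = (real (nat \<lceil>real (Suc n) * t\<rceil>) + 1) / real (Suc n)"

text \<open>Rounding up costs less than one grid step and the extra step costs one more, so three
  steps are a safe strict bound; this is the origin of the horizon T + 3 below.\<close>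

lemma grid_bounds:
  assumes "0 \<le> t"
  shows "t \<le> grid n t" and "grid n t < t + 3 / real (Suc n)"
proof -
  have n: "real (Suc n) > 0" by simp
  have c: "real (nat \<lceil>real (Suc n) * t\<rceil>) = of_int \<lceil>real (Suc n) * t\<rceil>"
    using assms by (simp add: of_nat_nat)
  have lo: "real (Suc n) * t \<le> of_int \<lceil>real (Suc n) * t\<rceil>" by (rule le_of_int_ceiling)
  have hi: "of_int \<lceil>real (Suc n) * t\<rceil> < real (Suc n) * t + 1" by linarith
  show "t \<le> grid n t"
    unfolding grid_def c pos_le_divide_eq[OF n] mult.commute[of t] using lo by linarith
  have "q * t + 3 = (t + 3 / q) * q" if "q > 0" for q :: real using that by (simp add: field_simps)
  from this[OF n] have "real (Suc n) * t + 3 = (t + 3 / real (Suc n)) * real (Suc n)" .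
  then show "grid n t < t + 3 / real (Suc n)" unfolding grid_def c pos_divide_less_eq[OF n] using hi by linarith
qed

lemma grid_nonneg: "0 \<le> t \<Longrightarrow> 0 \<le> grid n t"
  using grid_bounds(1)[of t n] by simp

lemma grid_le:
  assumes "0 \<le> t" "t \<le> T"
  shows "grid n t < T + 3"
proof -
  have "3 / real (Suc n) \<le> 3" by (simp add: divide_le_eq)
  then show ?thesis using grid_bounds(2)[OF assms(1), of n] assms(2) by linarith
qed

lemma grid_tendsto:
  assumes "0 \<le> t"
  shows "(\<lambda>n. grid n t) \<longlonglongrightarrow> t"
proof (rule tendsto_sandwich[of "\<lambda>_. t" _ _ "\<lambda>n. t + 3 / real (Suc n)"])
  have "(\<lambda>n. 3 * inverse (real (Suc n))) \<longlonglongrightarrow> 3 * 0"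
    by (intro tendsto_intros LIMSEQ_inverse_real_of_nat)
  then have "(\<lambda>n. t + 3 * inverse (real (Suc n))) \<longlonglongrightarrow> t + 0" by (intro tendsto_add) auto
  then show "(\<lambda>n. t + 3 / real (Suc n)) \<longlonglongrightarrow> t" by (simp add: divide_inverse)
qed (use grid_bounds[OF assms] in \<open>auto intro!: always_eventually less_imp_le\<close>)

lemma W_grid_tendsto:
  assumes "\<omega> \<in> space M" "0 \<le> t"
  shows "(\<lambda>n. W (grid n t) \<omega>) \<longlonglongrightarrow> W t \<omega>"
  by (rule continuous_on_tendsto_compose[OF W_continuous[OF assms(1)] grid_tendsto[OF assms(2)]])
     (use assms(2) in \<open>auto intro: always_eventually grid_nonneg\<close>)

text \<open>For fixed n the grid has countably many times, so this is a countable selection among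
  the measurable maps \<open>W t\<close>.\<close>

lemma joint_measurable_grid:
  "(\<lambda>(t, \<omega>). W (grid n (max 0 t)) \<omega>) \<in> borel_measurable (borel \<Otimes>\<^sub>M M)"
proof -
  have "(\<lambda>x. (\<lambda>k x. W ((real k + 1) / real (Suc n)) (snd x)) (nat \<lceil>real (Suc n) * max 0 (fst x)\<rceil>) x)
      \<in> borel_measurable (borel \<Otimes>\<^sub>M M)"
    by (rule measurable_compose_countable) measurable
  then show ?thesis by (simp add: grid_def split_beta')
qed

text \<open>A pointwise limit of the grid versions. Path continuity is given on nonnegative times
  only, hence \<open>max 0 t\<close>.\<close>

lemma joint_measurable [measurable]:
  "(\<lambda>(t, \<omega>). W (max 0 t) \<omega>) \<in> borel_measurable (borel \<Otimes>\<^sub>M M)"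
proof (rule borel_measurable_LIMSEQ_real[where u = "\<lambda>n (t, \<omega>). W (grid n (max 0 t)) \<omega>"])
  fix x :: "real \<times> 'a" assume "x \<in> space (borel \<Otimes>\<^sub>M M)"
  then show "(\<lambda>n. (\<lambda>(t, \<omega>). W (grid n (max 0 t)) \<omega>) x) \<longlonglongrightarrow> (\<lambda>(t, \<omega>). W (max 0 t) \<omega>) x"
    by (auto simp: space_pair_measure intro!: W_grid_tendsto)
qed (rule joint_measurable_grid)

lemma W_stopped_measurable:
  assumes [measurable]: "\<tau> \<in> borel_measurable M" and "\<And>\<omega>. \<omega> \<in> space M \<Longrightarrow> 0 \<le> \<tau> \<omega>"
  shows "(\<lambda>\<omega>. W (\<tau> \<omega>) \<omega>) \<in> borel_measurable M"
proof -
  have "(\<lambda>\<omega>. (\<lambda>(t, \<omega>). W (max 0 t) \<omega>) (\<tau> \<omega>, \<omega>)) \<in> borel_measurable M" by measurable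
  then show ?thesis by (rule measurable_cong[THEN iffD1, rotated]) (use assms(2) in \<open>auto simp: max_def\<close>)
qed

section \<open>Optional stopping at bounded times\<close>

context
  fixes \<tau> :: "'a \<Rightarrow> real" and T :: real
  assumes \<tau>: "stopping_time (BM_filtration M W) \<tau>" and \<tau>0: "\<And>\<omega>. \<omega> \<in> space M \<Longrightarrow> 0 \<le> \<tau> \<omega>"
    and \<tau>T: "\<And>\<omega>. \<omega> \<in> space M \<Longrightarrow> \<tau> \<omega> \<le> T"
begin

lemma \<tau>_measurable [measurable]: "\<tau> \<in> borel_measurable M"
  using \<tau> by (rule stopping_time_measurable)

text \<open>The grid time takes finitely many values. On each of its level sets the martingale
  property moves the value to the common horizon T + 3, and adding up the partition leaves a
  deterministic time.\<close>

lemma optional_stopping_grid: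
  shows "integrable M (\<lambda>\<omega>. expm \<theta> (grid n (\<tau> \<omega>)) \<omega>)"
    and "expectation (\<lambda>\<omega>. expm \<theta> (grid n (\<tau> \<omega>)) \<omega>) = 1"
proof -
  define N where "N = real (Suc n)"
  have N: "N \<ge> 1" by (simp add: N_def)
  define J where "J = nat \<lceil>N * T\<rceil>"
  define A where "A j = {\<omega> \<in> space M. nat \<lceil>N * \<tau> \<omega>\<rceil> = j}" for j
  have T0: "T \<ge> 0"
    using not_empty \<tau>0 \<tau>T by (meson ex_in_conv order_trans)
  have Jle: "nat \<lceil>N * \<tau> \<omega>\<rceil> \<le> J" if "\<omega> \<in> space M" for \<omega>
    unfolding J_def using \<tau>T[OF that] N by (intro nat_mono ceiling_mono mult_left_mono) auto
  have jT: "(real j + 1) / N < T + 3" if "j \<le> J" for j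
  proof -
    have "real j \<le> real J" using that by simp
    also have "\<dots> = of_int \<lceil>N * T\<rceil>" unfolding J_def using T0 N by (simp add: of_nat_nat)
    also have "\<dots> < N * T + 1" by linarith
    finally have "real j + 1 < (T + 3) * N" using N by (simp add: algebra_simps)
    then show ?thesis using N by (simp add: divide_less_eq)
  qed
  \<comment> \<open>Membership in \<open>A j\<close> is decided by comparing \<tau> with j / N and,
    for positive j, with (j - 1) / N. Both lie strictly below (j + 1) / N, as
    \<open>stopping_time_iff\<close> demands.\<close>
  have A: "A j \<in> past_null ((real j + 1) / N)" for j
  proof -
    interpret S: sigma_algebra "space M" "past_null ((real j + 1) / N)" by (rule sigma_algebra_past_null)
    have le: "{\<omega>\<in>space M. \<tau> \<omega> \<le> t} \<in> past_null ((real j + 1) / N)" if "t < (real j + 1) / N" for t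
      using \<tau> that by (simp add: stopping_time_iff)
    have iff: "nat \<lceil>N * \<tau> \<omega>\<rceil> \<le> k \<longleftrightarrow> \<tau> \<omega> \<le> real k / N" for k \<omega>
      using N by (simp add: nat_le_iff ceiling_le_iff pos_le_divide_eq mult.commute)
    show ?thesis
    proof (cases j)
      case 0
      then have "A j = {\<omega>\<in>space M. \<tau> \<omega> \<le> real j / N}" unfolding A_def iff[symmetric] by auto
      then show ?thesis using N by (auto intro!: le divide_strict_right_mono)
    next
      case (Suc i)
      have "A j = {\<omega>\<in>space M. nat \<lceil>N * \<tau> \<omega>\<rceil> \<le> j} - {\<omega>\<in>space M. nat \<lceil>N * \<tau> \<omega>\<rceil> \<le> i}"
      proof (rule set_eqI)
        fix \<omega>
        have "m = Suc i \<longleftrightarrow> m \<le> Suc i \<and> \<not> m \<le> i" for m :: nat by linarith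
        then show "\<omega> \<in> A j \<longleftrightarrow> \<omega> \<in> {\<omega>\<in>space M. nat \<lceil>N * \<tau> \<omega>\<rceil> \<le> j} - {\<omega>\<in>space M. nat \<lceil>N * \<tau> \<omega>\<rceil> \<le> i}"
          unfolding A_def Suc Diff_iff mem_Collect_eq by blast
      qed
      also have "\<dots> = {\<omega>\<in>space M. \<tau> \<omega> \<le> real j / N} - {\<omega>\<in>space M. \<tau> \<omega> \<le> real i / N}"
        unfolding iff ..
      finally have Aj: "A j = \<dots>" .
      have "real j / N < (real j + 1) / N" "real i / N < (real j + 1) / N"
        using N Suc by (auto intro!: divide_strict_right_mono)
      then show ?thesis unfolding Aj by (intro S.Diff le)
    qed
  qed
  have Aev: "A j \<in> events" for j using A past_null_subset_events by blast
  have eq: "expm \<theta> (grid n (\<tau> \<omega>)) \<omega> = (\<Sum>j\<le>J. indicator (A j) \<omega> * expm \<theta> ((real j + 1) / N) \<omega>)"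
    if \<omega>: "\<omega> \<in> space M" for \<omega>
  proof -
    have "(\<Sum>j\<le>J. indicator (A j) \<omega> * expm \<theta> ((real j + 1) / N) \<omega>)
        = (\<Sum>j\<le>J. if j = nat \<lceil>N * \<tau> \<omega>\<rceil> then expm \<theta> ((real j + 1) / N) \<omega> else 0)"
      using \<omega> by (intro sum.cong) (auto simp: A_def indicator_def)
    also have "\<dots> = expm \<theta> (grid n (\<tau> \<omega>)) \<omega>"
      using Jle[OF \<omega>] by (simp add: grid_def N_def)
    finally show ?thesis by simp
  qed
  have one: "(\<Sum>j\<le>J. indicator (A j) \<omega> * c) = c" if \<omega>: "\<omega> \<in> space M" for \<omega> and c :: real
  proof -
    have "(\<Sum>j\<le>J. indicator (A j) \<omega> * c) = (\<Sum>j\<le>J. if j = nat \<lceil>N * \<tau> \<omega>\<rceil> then c else 0)"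
      using \<omega> by (intro sum.cong) (auto simp: A_def indicator_def)
    also have "\<dots> = c" using Jle[OF \<omega>] by simp
    finally show ?thesis .
  qed
  have int: "integrable M (\<lambda>\<omega>. indicator (A j) \<omega> * expm \<theta> ((real j + 1) / N) \<omega>)" for j
    using N by (intro expm_integrable_on Aev) auto
  have intT: "integrable M (\<lambda>\<omega>. indicator (A j) \<omega> * expm \<theta> (T + 3) \<omega>)" for j
    using T0 by (intro expm_integrable_on Aev) auto
  show "integrable M (\<lambda>\<omega>. expm \<theta> (grid n (\<tau> \<omega>)) \<omega>)"
    by (rule iffD2[OF Bochner_Integration.integrable_cong[OF refl eq]])
       (assumption, intro Bochner_Integration.integrable_sum int)
  have "expectation (\<lambda>\<omega>. expm \<theta> (grid n (\<tau> \<omega>)) \<omega>)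
      = expectation (\<lambda>\<omega>. \<Sum>j\<le>J. indicator (A j) \<omega> * expm \<theta> ((real j + 1) / N) \<omega>)"
    by (rule Bochner_Integration.integral_cong[OF refl eq])
  also have "\<dots> = (\<Sum>j\<le>J. expectation (\<lambda>\<omega>. indicator (A j) \<omega> * expm \<theta> ((real j + 1) / N) \<omega>))"
    by (intro Bochner_Integration.integral_sum int)
  also have "\<dots> = (\<Sum>j\<le>J. expectation (\<lambda>\<omega>. indicator (A j) \<omega> * expm \<theta> (T + 3) \<omega>))"
    using N by (intro sum.cong refl expm_martingale[symmetric] jT A) auto
  also have "\<dots> = expectation (\<lambda>\<omega>. \<Sum>j\<le>J. indicator (A j) \<omega> * expm \<theta> (T + 3) \<omega>)"
    by (intro Bochner_Integration.integral_sum[symmetric] intT)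
  also have "\<dots> = expectation (expm \<theta> (T + 3))"
    by (intro Bochner_Integration.integral_cong refl one)
  finally show "expectation (\<lambda>\<omega>. expm \<theta> (grid n (\<tau> \<omega>)) \<omega>) = 1"
    using expm_integrable(2)[of "T + 3" \<theta>] T0 by simp
qed

lemma expm_stopped_measurable [measurable]: "(\<lambda>\<omega>. expm \<theta> (\<tau> \<omega>) \<omega>) \<in> borel_measurable M"
  unfolding expm_def using W_stopped_measurable[OF \<tau>_measurable \<tau>0] by measurable

text \<open>The squares along the grid are bounded in mean, because \<open>(expm \<theta> t)\<^sup>2\<close> is a bounded
  multiple of \<open>expm (2 * \<theta>) t\<close>; with \<open>y \<le> min y k + y\<^sup>2 / k\<close> this gives uniform integrability.\<close>

lemma optional_stopping:
  shows "integrable M (\<lambda>\<omega>. expm \<theta> (\<tau> \<omega>) \<omega>)"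
    and "expectation (\<lambda>\<omega>. expm \<theta> (\<tau> \<omega>) \<omega>) = 1"
proof -
  define Y where "Y n \<omega> = expm \<theta> (grid n (\<tau> \<omega>)) \<omega>" for n \<omega>
  define Z where "Z \<omega> = expm \<theta> (\<tau> \<omega>) \<omega>" for \<omega>
  define C where "C = exp (\<theta>\<^sup>2 * (T + 3))"
  have C: "C > 0" by (simp add: C_def)
  have Yint: "integrable M (Y n)" "expectation (Y n) = 1" for n
    using optional_stopping_grid[of \<theta> n] by (auto simp: Y_def[abs_def])
  have [measurable]: "Y n \<in> borel_measurable M" for n using Yint(1)[of n] by auto
  have [measurable]: "Z \<in> borel_measurable M" unfolding Z_def[abs_def] by measurable
  have pos: "Y n \<omega> > 0" "Z \<omega> > 0" for n \<omega> by (auto simp: Y_def Z_def expm_pos)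
  have lim: "(\<lambda>n. Y n \<omega>) \<longlonglongrightarrow> Z \<omega>" if "\<omega> \<in> space M" for \<omega>
    unfolding Y_def Z_def expm_def
    by (intro tendsto_intros W_grid_tendsto grid_tendsto that \<tau>0) auto
  have sq: "(Y n \<omega>)\<^sup>2 \<le> C * expm (2 * \<theta>) (grid n (\<tau> \<omega>)) \<omega>" if "\<omega> \<in> space M" for n \<omega>
  proof -
    have "\<theta>\<^sup>2 * grid n (\<tau> \<omega>) \<le> \<theta>\<^sup>2 * (T + 3)"
      using grid_le[OF \<tau>0[OF that] \<tau>T[OF that], of n] by (intro mult_left_mono) auto
    then have "exp (\<theta>\<^sup>2 * grid n (\<tau> \<omega>)) \<le> C" by (simp add: C_def)
    then show ?thesis
      unfolding Y_def expm_sq by (rule mult_right_mono) (rule less_imp_le[OF expm_pos])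
  qed
  have minint: "integrable M (\<lambda>\<omega>. min (Y n \<omega>) k)" "integrable M (\<lambda>\<omega>. min (Z \<omega>) k)" if "k > 0" for n k
    using that pos by (auto intro!: integrable_const_bound[where B = k] AE_I2 simp: abs_of_pos)
  \<comment> \<open>Truncation at level k loses at most C / k of the mean, uniformly in n.\<close>
  have lower: "1 \<le> expectation (\<lambda>\<omega>. min (Y n \<omega>) k) + C / k" if k: "k > 0" for n k
  proof -
    have "1 = expectation (Y n)" by (simp add: Yint)
    also have "\<dots> \<le> expectation (\<lambda>\<omega>. min (Y n \<omega>) k + C / k * expm (2 * \<theta>) (grid n (\<tau> \<omega>)) \<omega>)"
    proof (intro integral_mono Bochner_Integration.integrable_add minint[OF k] integrable_mult_right
        optional_stopping_grid(1) Yint(1))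
      fix \<omega> assume \<omega>: "\<omega> \<in> space M"
      have "Y n \<omega> \<le> min (Y n \<omega>) k + (Y n \<omega>)\<^sup>2 / k"
      proof (cases "Y n \<omega> \<le> k")
        case False
        then have "Y n \<omega> * k \<le> (Y n \<omega>)\<^sup>2" using pos(1)[of n \<omega>] by (simp add: power2_eq_square)
        then have "Y n \<omega> \<le> (Y n \<omega>)\<^sup>2 / k" using k by (simp add: pos_le_divide_eq)
        then show ?thesis using k False by (simp add: min_def)
      qed (use k in simp)
      also have "(Y n \<omega>)\<^sup>2 / k \<le> C / k * expm (2 * \<theta>) (grid n (\<tau> \<omega>)) \<omega>"
        using divide_right_mono[OF sq[OF \<omega>, of n], of k] k by simp
      finally show "Y n \<omega> \<le> min (Y n \<omega>) k + C / k * expm (2 * \<theta>) (grid n (\<tau> \<omega>)) \<omega>" by simp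
    qed
    also have "\<dots> = expectation (\<lambda>\<omega>. min (Y n \<omega>) k) + C / k"
      using optional_stopping_grid[of "2 * \<theta>" n] minint[OF k] by simp
    finally show ?thesis .
  qed
  have upper: "expectation (\<lambda>\<omega>. min (Y n \<omega>) k) \<le> 1" if k: "k > 0" for n k
    using integral_mono[OF minint(1)[OF k, of n] Yint(1)[of n]] Yint(2)[of n] by simp
  have conv: "(\<lambda>n. expectation (\<lambda>\<omega>. min (Y n \<omega>) k)) \<longlonglongrightarrow> expectation (\<lambda>\<omega>. min (Z \<omega>) k)" if k: "k > 0" for k
  proof (rule integral_dominated_convergence[where w = "\<lambda>_. k"])
    show "AE \<omega> in M. (\<lambda>n. min (Y n \<omega>) k) \<longlonglongrightarrow> min (Z \<omega>) k"
      by (intro AE_I2 tendsto_intros lim)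
    show "AE \<omega> in M. norm (min (Y n \<omega>) k) \<le> k" for n
      using k pos(1)[of n] by (intro AE_I2) (auto simp: min_def abs_of_pos)
  qed auto
  have minZ: "expectation (\<lambda>\<omega>. min (Z \<omega>) k) \<le> 1" "1 - C / k \<le> expectation (\<lambda>\<omega>. min (Z \<omega>) k)" if k: "k > 0" for k
    using LIMSEQ_le_const2[OF conv[OF k], of 1] LIMSEQ_le_const[OF conv[OF k], of "1 - C / k"]
      upper[OF k] lower[OF k] by (auto simp: algebra_simps)
  \<comment> \<open>The grid limit was taken by dominated convergence with the truncation level
    fixed; now the level tends to infinity and monotone convergence applies.\<close>
  have lim1: "(\<lambda>i. expectation (\<lambda>\<omega>. min (Z \<omega>) (real (Suc i)))) \<longlonglongrightarrow> 1"
  proof (rule tendsto_sandwich[of "\<lambda>i. 1 - C / real (Suc i)" _ _ "\<lambda>_. 1"])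
    have "(\<lambda>n. 1 - C * inverse (real (Suc n))) \<longlonglongrightarrow> 1 - C * 0"
      by (intro tendsto_intros LIMSEQ_inverse_real_of_nat)
    then show "(\<lambda>i. 1 - C / real (Suc i)) \<longlonglongrightarrow> 1" by (simp add: divide_inverse)
  qed (use minZ in \<open>auto intro!: always_eventually\<close>)
  have mono: "AE \<omega> in M. mono (\<lambda>i. min (Z \<omega>) (real (Suc i)))"
    by (intro AE_I2 monoI min.mono) auto
  have limk: "AE \<omega> in M. (\<lambda>i. min (Z \<omega>) (real (Suc i))) \<longlonglongrightarrow> Z \<omega>"
  proof (intro AE_I2 tendsto_eventually)
    fix \<omega>
    obtain m where "Z \<omega> \<le> real m" using real_arch_simple by blast
    then show "\<forall>\<^sub>F i in sequentially. min (Z \<omega>) (real (Suc i)) = Z \<omega>"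
      by (intro eventually_sequentiallyI[of m]) (auto simp: min_def)
  qed
  have "integrable M Z" "expectation Z = 1"
    using integrable_monotone_convergence[OF _ mono limk lim1] integral_monotone_convergence[OF _ mono limk lim1]
      minint(2) by auto
  then show "integrable M (\<lambda>\<omega>. expm \<theta> (\<tau> \<omega>) \<omega>)" "expectation (\<lambda>\<omega>. expm \<theta> (\<tau> \<omega>) \<omega>) = 1"
    by (auto simp: Z_def[abs_def])
qed

end

section \<open>Dynkin's formula for discounted exponential martingales\<close>

text \<open>Stopping at \<tau> and at min \<tau> u gives the same mean 1, and the two stopped values
  differ only where u < \<tau>. This replaces conditioning on the past of u.\<close>

lemma expm_before_stopping:
  assumes \<tau>: "stopping_time (BM_filtration M W) \<tau>" and \<tau>0: "\<And>\<omega>. \<omega> \<in> space M \<Longrightarrow> 0 \<le> \<tau> \<omega>"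
    and \<tau>T: "\<And>\<omega>. \<omega> \<in> space M \<Longrightarrow> \<tau> \<omega> \<le> T" and u: "0 \<le> u"
  shows "(\<integral>\<^sup>+\<omega>. indicator {u..} (\<tau> \<omega>) * ennreal (expm \<theta> u \<omega>) \<partial>M)
       = (\<integral>\<^sup>+\<omega>. indicator {u..} (\<tau> \<omega>) * ennreal (expm \<theta> (\<tau> \<omega>) \<omega>) \<partial>M)"
proof -
  have [measurable]: "\<tau> \<in> borel_measurable M" using \<tau> by (rule stopping_time_measurable)
  have \<tau>u: "stopping_time (BM_filtration M W) (\<lambda>\<omega>. min (\<tau> \<omega>) u)" using stopping_time_min_const[OF \<tau> u] .
  note O1 = optional_stopping[OF \<tau> \<tau>0 \<tau>T, of \<theta>]
  have O2: "integrable M (\<lambda>\<omega>. expm \<theta> (min (\<tau> \<omega>) u) \<omega>)" "expectation (\<lambda>\<omega>. expm \<theta> (min (\<tau> \<omega>) u) \<omega>) = 1"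
    using optional_stopping[OF \<tau>u, of u \<theta>] \<tau>0 u by auto
  let ?I = "\<lambda>\<omega>. indicator {u..} (\<tau> \<omega>) :: real"
  have i1: "integrable M (\<lambda>\<omega>. ?I \<omega> * expm \<theta> (\<tau> \<omega>) \<omega>)"
  proof (rule Bochner_Integration.integrable_bound[OF O1(1)])
    show "(\<lambda>\<omega>. ?I \<omega> * expm \<theta> (\<tau> \<omega>) \<omega>) \<in> borel_measurable M"
      using borel_measurable_integrable[OF O1(1)] by measurable
  qed (auto simp: indicator_def expm_pos abs_of_pos less_imp_le)
  have i2: "integrable M (\<lambda>\<omega>. ?I \<omega> * expm \<theta> u \<omega>)"
    by (rule Bochner_Integration.integrable_bound[OF expm_integrable(1)[OF u]])
       (auto simp: indicator_def expm_pos abs_of_pos less_imp_le)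
  have "expectation (\<lambda>\<omega>. ?I \<omega> * expm \<theta> (\<tau> \<omega>) \<omega> - ?I \<omega> * expm \<theta> u \<omega>)
      = expectation (\<lambda>\<omega>. expm \<theta> (\<tau> \<omega>) \<omega> - expm \<theta> (min (\<tau> \<omega>) u) \<omega>)"
    by (rule Bochner_Integration.integral_cong) (auto simp: indicator_def min_def)
  also have "\<dots> = 0" using O1 O2 by simp
  finally have "expectation (\<lambda>\<omega>. ?I \<omega> * expm \<theta> u \<omega>) = expectation (\<lambda>\<omega>. ?I \<omega> * expm \<theta> (\<tau> \<omega>) \<omega>)"
    using i1 i2 by simp
  then have "(\<integral>\<^sup>+\<omega>. ennreal (?I \<omega> * expm \<theta> u \<omega>) \<partial>M) = (\<integral>\<^sup>+\<omega>. ennreal (?I \<omega> * expm \<theta> (\<tau> \<omega>) \<omega>) \<partial>M)"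
    using i1 i2 by (simp add: nn_integral_eq_integral expm_pos less_imp_le)
  then show ?thesis by (simp add: ennreal_mult' ennreal_indicator)
qed

lemma expm_path_continuous:
  assumes "\<omega> \<in> space M"
  shows "continuous_on {0..t} (\<lambda>u. exp (c * u) * expm \<theta> u \<omega>)"
  unfolding expm_def
  by (intro continuous_intros continuous_on_subset[OF W_continuous[OF assms]]) auto

text \<open>Fubini takes the place of Ito's formula: for each u the value of \<open>expm\<close> at
  u may be exchanged, on u <= \<tau>, for its value at \<tau>, after which only
  \<open>exp (c * u)\<close> remains under the time integral. Nonnegative integrals are used first,
  so integrability of the running term is a result and not a premise.\<close>

lemma expm_dynkin:
  assumes \<tau>: "stopping_time (BM_filtration M W) \<tau>" and \<tau>0: "\<And>\<omega>. \<omega> \<in> space M \<Longrightarrow> 0 \<le> \<tau> \<omega>"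
    and \<tau>T: "\<And>\<omega>. \<omega> \<in> space M \<Longrightarrow> \<tau> \<omega> \<le> T"
  shows "integrable M (\<lambda>\<omega>. exp (c * \<tau> \<omega>) * expm \<theta> (\<tau> \<omega>) \<omega>)"
    and "integrable M (\<lambda>\<omega>. LINT u:{0..\<tau> \<omega>}|lborel. exp (c * u) * expm \<theta> u \<omega>)"
    and "expectation (\<lambda>\<omega>. exp (c * \<tau> \<omega>) * expm \<theta> (\<tau> \<omega>) \<omega>)
       = 1 + c * expectation (\<lambda>\<omega>. LINT u:{0..\<tau> \<omega>}|lborel. exp (c * u) * expm \<theta> u \<omega>)"
proof -
  have [measurable]: "\<tau> \<in> borel_measurable M" using \<tau> by (rule stopping_time_measurable)
  note O1 = optional_stopping[OF \<tau> \<tau>0 \<tau>T, of \<theta>]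
  have [measurable]: "(\<lambda>\<omega>. expm \<theta> (\<tau> \<omega>) \<omega>) \<in> borel_measurable M" using O1(1) by auto
  have expb: "exp (c * \<tau> \<omega>) \<le> exp (\<bar>c\<bar> * T)" if "\<omega> \<in> space M" for \<omega>
  proof -
    have "c * \<tau> \<omega> \<le> \<bar>c\<bar> * \<tau> \<omega>" using \<tau>0[OF that] by (intro mult_right_mono) auto
    also have "\<dots> \<le> \<bar>c\<bar> * T" using \<tau>T[OF that] by (intro mult_left_mono) auto
    finally show ?thesis by simp
  qed
  show int1: "integrable M (\<lambda>\<omega>. exp (c * \<tau> \<omega>) * expm \<theta> (\<tau> \<omega>) \<omega>)"
    by (rule Bochner_Integration.integrable_bound[OF integrable_mult_right[OF O1(1), of "exp (\<bar>c\<bar> * T)"]])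
       (use expb in \<open>auto simp: abs_mult expm_pos abs_of_pos\<close>)
  interpret P: pair_sigma_finite lborel M ..
  have J [measurable]: "(\<lambda>(u, \<omega>). expm \<theta> (max 0 u) \<omega>) \<in> borel_measurable (lborel \<Otimes>\<^sub>M M)"
  proof -
    have "(\<lambda>x. exp (\<theta> * (\<lambda>(u, \<omega>). W (max 0 u) \<omega>) x - \<theta>\<^sup>2 * max 0 (fst x) / 2)) \<in> borel_measurable (borel \<Otimes>\<^sub>M M)"
      by measurable
    then show ?thesis by (simp add: expm_def split_beta')
  qed
  have I [measurable]: "(\<lambda>(u, \<omega>). indicator {0..\<tau> \<omega>} u :: ennreal) \<in> borel_measurable (lborel \<Otimes>\<^sub>M M)"
  proof -
    have "(\<lambda>x. if 0 \<le> fst x \<and> fst x \<le> \<tau> (snd x) then 1 else 0 :: ennreal) \<in> borel_measurable (borel \<Otimes>\<^sub>M M)"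
      by measurable
    then show ?thesis by (simp add: indicator_def split_beta')
  qed
  have F1: "(\<lambda>(u, \<omega>). indicator {0..\<tau> \<omega>} u * (ennreal (exp (c * u)) * ennreal (expm \<theta> (max 0 u) \<omega>)))
      \<in> borel_measurable (lborel \<Otimes>\<^sub>M M)"
  proof -
    have "(\<lambda>x. (\<lambda>(u, \<omega>). indicator {0..\<tau> \<omega>} u) x * (ennreal (exp (c * fst x)) * ennreal ((\<lambda>(u, \<omega>). expm \<theta> (max 0 u) \<omega>) x)))
      \<in> borel_measurable (lborel \<Otimes>\<^sub>M M)" using I J by measurable
    then show ?thesis by (simp add: split_beta')
  qed
  have F2: "(\<lambda>(u, \<omega>). indicator {0..\<tau> \<omega>} u * (ennreal (exp (c * u)) * ennreal (expm \<theta> (\<tau> \<omega>) \<omega>)))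
      \<in> borel_measurable (lborel \<Otimes>\<^sub>M M)"
  proof -
    have "(\<lambda>x. (\<lambda>(u, \<omega>). indicator {0..\<tau> \<omega>} u) x * (ennreal (exp (c * fst x)) * ennreal (expm \<theta> (\<tau> (snd x)) (snd x))))
      \<in> borel_measurable (lborel \<Otimes>\<^sub>M M)" using I by measurable
    then show ?thesis by (simp add: split_beta')
  qed
  define G where "G \<omega> = (LINT u:{0..\<tau> \<omega>}|lborel. exp (c * u) * expm \<theta> u \<omega>)" for \<omega>
  have G: "ennreal (G \<omega>) = (\<integral>\<^sup>+u. indicator {0..\<tau> \<omega>} u * ennreal (exp (c * u) * expm \<theta> (max 0 u) \<omega>) \<partial>lborel)"
    if \<omega>: "\<omega> \<in> space M" for \<omega>
  proof -
    have "set_integrable lborel {0..\<tau> \<omega>} (\<lambda>u. exp (c * u) * expm \<theta> u \<omega>)"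
      by (intro borel_integrable_atLeastAtMost' expm_path_continuous \<omega>)
    then have "ennreal (G \<omega>) = (\<integral>\<^sup>+u. ennreal (indicator {0..\<tau> \<omega>} u *\<^sub>R (exp (c * u) * expm \<theta> u \<omega>)) \<partial>lborel)"
      unfolding G_def set_lebesgue_integral_def set_integrable_def
      by (intro nn_integral_eq_integral[symmetric]) (auto simp: expm_pos less_imp_le)
    also have "\<dots> = (\<integral>\<^sup>+u. indicator {0..\<tau> \<omega>} u * ennreal (exp (c * u) * expm \<theta> (max 0 u) \<omega>) \<partial>lborel)"
      by (intro nn_integral_cong) (auto simp: indicator_def max_def)
    finally show ?thesis .
  qed
  have Gnn: "G \<omega> \<ge> 0" for \<omega>
    unfolding G_def set_lebesgue_integral_def by (intro integral_nonneg_AE) (auto simp: expm_pos less_imp_le)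
  have swap: "(\<integral>\<^sup>+\<omega>. \<integral>\<^sup>+u. indicator {0..\<tau> \<omega>} u * (ennreal (exp (c * u)) * ennreal (expm \<theta> (max 0 u) \<omega>)) \<partial>lborel \<partial>M)
     = (\<integral>\<^sup>+\<omega>. \<integral>\<^sup>+u. indicator {0..\<tau> \<omega>} u * (ennreal (exp (c * u)) * ennreal (expm \<theta> (\<tau> \<omega>) \<omega>)) \<partial>lborel \<partial>M)"
  proof -
    have "(\<integral>\<^sup>+\<omega>. \<integral>\<^sup>+u. indicator {0..\<tau> \<omega>} u * (ennreal (exp (c * u)) * ennreal (expm \<theta> (max 0 u) \<omega>)) \<partial>lborel \<partial>M)
      = (\<integral>\<^sup>+u. \<integral>\<^sup>+\<omega>. indicator {0..\<tau> \<omega>} u * (ennreal (exp (c * u)) * ennreal (expm \<theta> (max 0 u) \<omega>)) \<partial>M \<partial>lborel)"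
      by (rule P.Fubini'[OF F1])
    also have "\<dots> = (\<integral>\<^sup>+u. \<integral>\<^sup>+\<omega>. indicator {0..\<tau> \<omega>} u * (ennreal (exp (c * u)) * ennreal (expm \<theta> (\<tau> \<omega>) \<omega>)) \<partial>M \<partial>lborel)"
    proof (rule nn_integral_cong)
      fix u :: real
      show "(\<integral>\<^sup>+\<omega>. indicator {0..\<tau> \<omega>} u * (ennreal (exp (c * u)) * ennreal (expm \<theta> (max 0 u) \<omega>)) \<partial>M)
          = (\<integral>\<^sup>+\<omega>. indicator {0..\<tau> \<omega>} u * (ennreal (exp (c * u)) * ennreal (expm \<theta> (\<tau> \<omega>) \<omega>)) \<partial>M)"
      proof (cases "0 \<le> u")
        case True
        have "(\<integral>\<^sup>+\<omega>. indicator {0..\<tau> \<omega>} u * (ennreal (exp (c * u)) * ennreal (expm \<theta> (max 0 u) \<omega>)) \<partial>M)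
            = (\<integral>\<^sup>+\<omega>. ennreal (exp (c * u)) * (indicator {u..} (\<tau> \<omega>) * ennreal (expm \<theta> u \<omega>)) \<partial>M)"
          using True by (intro nn_integral_cong) (auto simp: indicator_def max_def)
        also have "\<dots> = ennreal (exp (c * u)) * (\<integral>\<^sup>+\<omega>. indicator {u..} (\<tau> \<omega>) * ennreal (expm \<theta> u \<omega>) \<partial>M)"
          by (rule nn_integral_cmult) measurable
        also have "\<dots> = ennreal (exp (c * u)) * (\<integral>\<^sup>+\<omega>. indicator {u..} (\<tau> \<omega>) * ennreal (expm \<theta> (\<tau> \<omega>) \<omega>) \<partial>M)"
          using expm_before_stopping[OF \<tau> \<tau>0 \<tau>T True] by simp
        also have "\<dots> = (\<integral>\<^sup>+\<omega>. ennreal (exp (c * u)) * (indicator {u..} (\<tau> \<omega>) * ennreal (expm \<theta> (\<tau> \<omega>) \<omega>)) \<partial>M)"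
          by (rule nn_integral_cmult[symmetric]) measurable
        also have "\<dots> = (\<integral>\<^sup>+\<omega>. indicator {0..\<tau> \<omega>} u * (ennreal (exp (c * u)) * ennreal (expm \<theta> (\<tau> \<omega>) \<omega>)) \<partial>M)"
          using True by (intro nn_integral_cong) (auto simp: indicator_def)
        finally show ?thesis .
      qed (simp add: indicator_def)
    qed
    also have "\<dots> = (\<integral>\<^sup>+\<omega>. \<integral>\<^sup>+u. indicator {0..\<tau> \<omega>} u * (ennreal (exp (c * u)) * ennreal (expm \<theta> (\<tau> \<omega>) \<omega>)) \<partial>lborel \<partial>M)"
      by (rule P.Fubini'[OF F2, symmetric])
    finally show ?thesis .
  qed
  \<comment> \<open>This is the integral of \<open>exp (c * u)\<close> over [0, \<tau>], with its
    degenerate case c = 0.\<close>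
  define R where "R \<omega> = (if c = 0 then \<tau> \<omega> else (exp (c * \<tau> \<omega>) - 1) / c)" for \<omega>
  have R: "(\<integral>\<^sup>+u. indicator {0..\<tau> \<omega>} u * (ennreal (exp (c * u)) * ennreal (expm \<theta> (\<tau> \<omega>) \<omega>)) \<partial>lborel)
       = ennreal (R \<omega> * expm \<theta> (\<tau> \<omega>) \<omega>)" and Rnn: "R \<omega> \<ge> 0" if \<omega>: "\<omega> \<in> space M" for \<omega>
  proof -
    have t: "0 \<le> \<tau> \<omega>" using \<tau>0[OF \<omega>] .
    show Rn: "R \<omega> \<ge> 0"
      using t unfolding R_def by (cases "c > 0") (auto simp: zero_le_divide_iff zero_le_mult_iff mult_le_0_iff)
    have "(\<integral>\<^sup>+u. indicator {0..\<tau> \<omega>} u * ennreal (exp (c * u)) \<partial>lborel) = ennreal (R \<omega>)"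
      using t exp_set_integral[OF t, of c] by (auto simp: R_def)
    then have "(\<integral>\<^sup>+u. (indicator {0..\<tau> \<omega>} u * ennreal (exp (c * u))) * ennreal (expm \<theta> (\<tau> \<omega>) \<omega>) \<partial>lborel)
        = ennreal (R \<omega>) * ennreal (expm \<theta> (\<tau> \<omega>) \<omega>)"
      by (subst nn_integral_multc) auto
    then show "(\<integral>\<^sup>+u. indicator {0..\<tau> \<omega>} u * (ennreal (exp (c * u)) * ennreal (expm \<theta> (\<tau> \<omega>) \<omega>)) \<partial>lborel)
       = ennreal (R \<omega> * expm \<theta> (\<tau> \<omega>) \<omega>)"
      using Rn by (simp add: ennreal_mult expm_pos less_imp_le mult.assoc)
  qed
  have intR: "integrable M (\<lambda>\<omega>. R \<omega> * expm \<theta> (\<tau> \<omega>) \<omega>)"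
  proof (cases "c = 0")
    case True
    show ?thesis
      by (rule Bochner_Integration.integrable_bound[OF integrable_mult_right[OF O1(1), of T]])
         (use \<tau>0 \<tau>T in \<open>force simp: True R_def abs_mult expm_pos abs_of_pos intro!: AE_I2\<close>)+
  next
    case False
    have "integrable M (\<lambda>\<omega>. (exp (c * \<tau> \<omega>) * expm \<theta> (\<tau> \<omega>) \<omega> - expm \<theta> (\<tau> \<omega>) \<omega>) / c)"
      using int1 O1(1) by auto
    then show ?thesis using False by (simp add: R_def left_diff_distrib diff_divide_distrib)
  qed
  have Gm: "G \<in> borel_measurable M"
  proof -
    have "(\<lambda>\<omega>. \<integral>\<^sup>+u. indicator {0..\<tau> \<omega>} u * ennreal (exp (c * u) * expm \<theta> (max 0 u) \<omega>) \<partial>lborel) \<in> borel_measurable M"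
    proof -
      have "(\<lambda>(\<omega>, u). indicator {0..\<tau> \<omega>} u * ennreal (exp (c * u) * expm \<theta> (max 0 u) \<omega>)) \<in> borel_measurable (M \<Otimes>\<^sub>M lborel)"
        using measurable_compose[OF measurable_pair_swap' F1]
        by (simp add: split_beta' ennreal_mult expm_pos less_imp_le)
      then show ?thesis by (rule lborel.borel_measurable_nn_integral)
    qed
    then have "(\<lambda>\<omega>. enn2real (ennreal (G \<omega>))) \<in> borel_measurable M"
      using G by (subst measurable_cong[of _ _ "\<lambda>\<omega>. enn2real (\<integral>\<^sup>+u. indicator {0..\<tau> \<omega>} u * ennreal (exp (c * u) * expm \<theta> (max 0 u) \<omega>) \<partial>lborel)"]) auto
    then show ?thesis using Gnn by simp
  qed
  have eq: "(\<integral>\<^sup>+\<omega>. ennreal (G \<omega>) \<partial>M) = (\<integral>\<^sup>+\<omega>. ennreal (R \<omega> * expm \<theta> (\<tau> \<omega>) \<omega>) \<partial>M)"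
  proof -
    have "(\<integral>\<^sup>+\<omega>. ennreal (G \<omega>) \<partial>M)
      = (\<integral>\<^sup>+\<omega>. \<integral>\<^sup>+u. indicator {0..\<tau> \<omega>} u * (ennreal (exp (c * u)) * ennreal (expm \<theta> (max 0 u) \<omega>)) \<partial>lborel \<partial>M)"
      by (intro nn_integral_cong) (simp add: G ennreal_mult expm_pos less_imp_le)
    also have "\<dots> = (\<integral>\<^sup>+\<omega>. ennreal (R \<omega> * expm \<theta> (\<tau> \<omega>) \<omega>) \<partial>M)"
      unfolding swap by (intro nn_integral_cong R)
    finally show ?thesis .
  qed
  also have "\<dots> = ennreal (expectation (\<lambda>\<omega>. R \<omega> * expm \<theta> (\<tau> \<omega>) \<omega>))"
    by (intro nn_integral_eq_integral intR) (auto simp: Rnn expm_pos less_imp_le)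
  finally have nnG: "(\<integral>\<^sup>+\<omega>. ennreal (G \<omega>) \<partial>M) = ennreal (expectation (\<lambda>\<omega>. R \<omega> * expm \<theta> (\<tau> \<omega>) \<omega>))" .
  have intG: "integrable M G"
    by (rule integrableI_nonneg[OF Gm]) (auto simp: Gnn nnG)
  have EG: "expectation G = expectation (\<lambda>\<omega>. R \<omega> * expm \<theta> (\<tau> \<omega>) \<omega>)"
    by (rule integral_eq_nn_integral[THEN trans])
       (auto simp: Gm Gnn nnG Rnn expm_pos less_imp_le intro!: enn2real_ennreal integral_nonneg_AE)
  show "integrable M (\<lambda>\<omega>. LINT u:{0..\<tau> \<omega>}|lborel. exp (c * u) * expm \<theta> u \<omega>)"
    using intG by (simp add: G_def[abs_def])
  have "c * expectation G = expectation (\<lambda>\<omega>. c * (R \<omega> * expm \<theta> (\<tau> \<omega>) \<omega>))" by (simp add: EG)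
  also have "\<dots> = expectation (\<lambda>\<omega>. exp (c * \<tau> \<omega>) * expm \<theta> (\<tau> \<omega>) \<omega> - expm \<theta> (\<tau> \<omega>) \<omega>)"
    by (rule Bochner_Integration.integral_cong) (auto simp: R_def left_diff_distrib)
  also have "\<dots> = expectation (\<lambda>\<omega>. exp (c * \<tau> \<omega>) * expm \<theta> (\<tau> \<omega>) \<omega>) - 1"
    using int1 O1 by simp
  finally show "expectation (\<lambda>\<omega>. exp (c * \<tau> \<omega>) * expm \<theta> (\<tau> \<omega>) \<omega>)
       = 1 + c * expectation (\<lambda>\<omega>. LINT u:{0..\<tau> \<omega>}|lborel. exp (c * u) * expm \<theta> u \<omega>)"
    by (simp add: G_def[abs_def])
qed

end

section \<open>Discounted functionals of geometric Brownian motion\<close>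

locale gbm_model = brownian_motion M W
  for M :: "'a measure" and W :: "real \<Rightarrow> 'a \<Rightarrow> real" +
  fixes r \<sigma> :: real
  assumes r: "r > 0" and \<sigma>: "\<sigma> > 0"
begin

text \<open>The eigenvalue of the operator L - 2r on the power \<open>s powr p\<close>.\<close>

definition char_poly :: "real \<Rightarrow> real" where
  "char_poly p = \<sigma>\<^sup>2 / 2 * p * (p - 1) + r * p - 2 * r"

lemma gbm_pos: "x > 0 \<Longrightarrow> gbm r \<sigma> W x t \<omega> > 0"
  by (simp add: gbm_def)

lemma gbm_0: "\<omega> \<in> space M \<Longrightarrow> gbm r \<sigma> W x 0 \<omega> = x"
  by (simp add: gbm_def W_0)

lemma gbm_continuous: "\<omega> \<in> space M \<Longrightarrow> continuous_on {0..} (\<lambda>t. gbm r \<sigma> W x t \<omega>)"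
  unfolding gbm_def by (intro continuous_intros W_continuous)

lemma gbm_powr:
  assumes "x > 0"
  shows "exp (- 2 * r * t) * gbm r \<sigma> W x t \<omega> powr p
       = x powr p * (exp (char_poly p * t) * expm (p * \<sigma>) t \<omega>)"
proof -
  let ?E = "(r - \<sigma>\<^sup>2 / 2) * t + \<sigma> * W t \<omega>"
  have "gbm r \<sigma> W x t \<omega> powr p = x powr p * exp (?E * p)"
    using assms by (simp add: gbm_def powr_mult exp_powr_real)
  moreover have "- 2 * r * t + ?E * p = char_poly p * t + (p * \<sigma> * W t \<omega> - (p * \<sigma>)\<^sup>2 * t / 2)"
    by (simp add: char_poly_def power2_eq_square field_simps)
  ultimately show ?thesis by (simp add: expm_def mult.left_commute flip: exp_add)
qed

text \<open>Records only the confinement of the path up to \<tau>, which is what domination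
  arguments consume; Dynkin's formula can thus precede the study of exit times.\<close>

definition stays_in :: "real \<Rightarrow> real \<Rightarrow> real \<Rightarrow> ('a \<Rightarrow> real) set" where
  "stays_in a b x = {\<tau>. stopping_time (BM_filtration M W) \<tau> \<and> (\<forall>\<omega>\<in>space M. 0 \<le> \<tau> \<omega>) \<and>
     (AE \<omega> in M. \<forall>u\<in>{0..\<tau> \<omega>}. gbm r \<sigma> W x u \<omega> \<in> {a..b})}"

definition disc_run :: "(real \<Rightarrow> real) \<Rightarrow> real \<Rightarrow> ('a \<Rightarrow> real) \<Rightarrow> 'a \<Rightarrow> real" where
  "disc_run g x \<tau> \<omega> = (LINT u:{0..\<tau> \<omega>}|lborel. exp (- 2 * r * u) * g (gbm r \<sigma> W x u \<omega>))"

definition disc_end :: "(real \<Rightarrow> real) \<Rightarrow> real \<Rightarrow> ('a \<Rightarrow> real) \<Rightarrow> 'a \<Rightarrow> real" where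
  "disc_end \<phi> x \<tau> \<omega> = exp (- 2 * r * \<tau> \<omega>) * \<phi> (gbm r \<sigma> W x (\<tau> \<omega>) \<omega>)"

text \<open>Dynkin's formula as a relation between a function and its source g, stated without
  derivatives and linear in the pair. Continuity of g makes the pathwise running integrals exist, as
  additivity requires.\<close>

definition dynkin_pair :: "real \<Rightarrow> real \<Rightarrow> (real \<Rightarrow> real) \<Rightarrow> (real \<Rightarrow> real) \<Rightarrow> bool" where
  "dynkin_pair a b \<phi> g \<longleftrightarrow> continuous_on {0<..} g \<and>
     (\<forall>x \<tau>. 0 < x \<longrightarrow> \<tau> \<in> stays_in a b x \<longrightarrow> integrable M (disc_end \<phi> x \<tau>) \<and> integrable M (disc_run g x \<tau>) \<and>
        expectation (disc_end \<phi> x \<tau>) = \<phi> x - expectation (disc_run g x \<tau>))"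

lemma disc_run_set_integrable:
  assumes "continuous_on {0<..} g" "0 < x" "\<omega> \<in> space M"
  shows "set_integrable lborel {0..t} (\<lambda>u. exp (- 2 * r * u) * g (gbm r \<sigma> W x u \<omega>))"
  by (intro borel_integrable_atLeastAtMost' continuous_intros
        continuous_on_compose2[OF assms(1) continuous_on_subset[OF gbm_continuous[OF assms(3)]]])
     (auto simp: gbm_pos assms)

lemma dynkin_pair_add:
  assumes "dynkin_pair a b \<phi>1 g1" "dynkin_pair a b \<phi>2 g2"
  shows "dynkin_pair a b (\<lambda>s. \<phi>1 s + \<phi>2 s) (\<lambda>s. g1 s + g2 s)"
  unfolding dynkin_pair_def
proof (intro conjI allI impI)
  show "continuous_on {0<..} (\<lambda>s. g1 s + g2 s)"
    using assms by (auto simp: dynkin_pair_def intro!: continuous_intros)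
  fix x \<tau> assume x: "0 < x" and \<tau>: "\<tau> \<in> stays_in a b x"
  have I: "integrable M (disc_end \<phi>1 x \<tau>)" "integrable M (disc_run g1 x \<tau>)"
    "integrable M (disc_end \<phi>2 x \<tau>)" "integrable M (disc_run g2 x \<tau>)"
    "expectation (disc_end \<phi>1 x \<tau>) = \<phi>1 x - expectation (disc_run g1 x \<tau>)"
    "expectation (disc_end \<phi>2 x \<tau>) = \<phi>2 x - expectation (disc_run g2 x \<tau>)"
    using assms x \<tau> by (auto simp: dynkin_pair_def)
  have E: "disc_end (\<lambda>s. \<phi>1 s + \<phi>2 s) x \<tau> = (\<lambda>\<omega>. disc_end \<phi>1 x \<tau> \<omega> + disc_end \<phi>2 x \<tau> \<omega>)"
    by (simp add: disc_end_def fun_eq_iff distrib_left)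
  have R: "disc_run (\<lambda>s. g1 s + g2 s) x \<tau> \<omega> = disc_run g1 x \<tau> \<omega> + disc_run g2 x \<tau> \<omega>" if "\<omega> \<in> space M" for \<omega>
    using disc_run_set_integrable[OF _ x that, of g1] disc_run_set_integrable[OF _ x that, of g2] assms
    by (simp add: disc_run_def distrib_left set_integral_add dynkin_pair_def)
  show "integrable M (disc_end (\<lambda>s. \<phi>1 s + \<phi>2 s) x \<tau>)" unfolding E using I by simp
  have "integrable M (disc_run (\<lambda>s. g1 s + g2 s) x \<tau>)
      = integrable M (\<lambda>\<omega>. disc_run g1 x \<tau> \<omega> + disc_run g2 x \<tau> \<omega>)"
    by (rule Bochner_Integration.integrable_cong[OF refl R])
  then show "integrable M (disc_run (\<lambda>s. g1 s + g2 s) x \<tau>)" using I by simp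
  have "expectation (disc_run (\<lambda>s. g1 s + g2 s) x \<tau>) = expectation (\<lambda>\<omega>. disc_run g1 x \<tau> \<omega> + disc_run g2 x \<tau> \<omega>)"
    by (rule Bochner_Integration.integral_cong[OF refl R])
  then show "expectation (disc_end (\<lambda>s. \<phi>1 s + \<phi>2 s) x \<tau>)
      = \<phi>1 x + \<phi>2 x - expectation (disc_run (\<lambda>s. g1 s + g2 s) x \<tau>)"
    unfolding E using I by simp
qed

lemma dynkin_pair_scale:
  assumes "dynkin_pair a b \<phi> g"
  shows "dynkin_pair a b (\<lambda>s. k * \<phi> s) (\<lambda>s. k * g s)"
proof -
  have "disc_end (\<lambda>s. k * \<phi> s) x \<tau> = (\<lambda>\<omega>. k * disc_end \<phi> x \<tau> \<omega>)" for x \<tau>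
    by (simp add: disc_end_def fun_eq_iff)
  moreover have "disc_run (\<lambda>s. k * g s) x \<tau> = (\<lambda>\<omega>. k * disc_run g x \<tau> \<omega>)" for x \<tau>
    by (simp add: disc_run_def fun_eq_iff mult.left_commute[of _ k])
  ultimately show ?thesis using assms
    by (auto simp: dynkin_pair_def right_diff_distrib intro!: continuous_intros)
qed

lemma exp_discount_integral_le:
  assumes "0 \<le> t"
  shows "(LINT u:{0..t}|lborel. exp (- 2 * r * u) * C) = C * (1 - exp (- 2 * r * t)) / (2 * r)"
proof -
  have "(LINT u:{0..t}|lborel. exp (- 2 * r * u) * C)
     = - C * exp (- 2 * r * t) / (2 * r) - (- C * exp (- 2 * r * 0) / (2 * r))"
    unfolding set_lebesgue_integral_def
    by (rule integral_FTC_atLeastAtMost)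
       (use assms r in \<open>auto intro!: derivative_eq_intros continuous_intros
          simp flip: has_real_derivative_iff_has_vector_derivative\<close>)
  then show ?thesis using r by (simp add: field_simps)
qed

text \<open>The formula holds at min \<tau> n. Confinement to [a,b] bounds the terminal term,
  discounting bounds the running term, both uniformly in n, so n can tend to infinity.\<close>

lemma dynkin_power:
  assumes a: "0 < a"
  shows "dynkin_pair a b (\<lambda>s. s powr p) (\<lambda>s. - char_poly p * s powr p)"
  unfolding dynkin_pair_def
proof (intro conjI allI impI)
  show "continuous_on {0<..} (\<lambda>s. - char_poly p * s powr p)" by (auto intro!: continuous_intros)
  fix x \<tau> assume x: "0 < x" and "\<tau> \<in> stays_in a b x"
  then have \<tau>: "stopping_time (BM_filtration M W) \<tau>" "\<And>\<omega>. \<omega> \<in> space M \<Longrightarrow> 0 \<le> \<tau> \<omega>"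
    and in_ab: "AE \<omega> in M. \<forall>u\<in>{0..\<tau> \<omega>}. gbm r \<sigma> W x u \<omega> \<in> {a..b}"
    by (auto simp: stays_in_def)
  let ?q = "char_poly p"
  \<comment> \<open>A bound for the power on [a,b], divided by \<open>x powr p\<close> because h is
    normalised to start at 1.\<close>
  define C where "C = max (a powr p) (b powr p) / x powr p"
  define h where "h u \<omega> = exp (?q * u) * expm (p * \<sigma>) u \<omega>" for u \<omega>
  define A where "A t \<omega> = h (min (\<tau> \<omega>) t) \<omega>" for t \<omega>
  define B where "B t \<omega> = (LINT u:{0..min (\<tau> \<omega>) t}|lborel. h u \<omega>)" for t \<omega>
  define A' where "A' \<omega> = h (\<tau> \<omega>) \<omega>" for \<omega>
  define B' where "B' \<omega> = (LINT u:{0..\<tau> \<omega>}|lborel. h u \<omega>)" for \<omega>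
  have xp: "x powr p > 0" using x by simp
  have hpos: "h u \<omega> > 0" for u \<omega> by (simp add: h_def expm_pos)
  have h_gbm: "exp (- 2 * r * u) * gbm r \<sigma> W x u \<omega> powr p = x powr p * h u \<omega>" for u \<omega>
    unfolding h_def by (rule gbm_powr[OF x])
  have hb: "h u \<omega> \<le> exp (- 2 * r * u) * C" if "gbm r \<sigma> W x u \<omega> \<in> {a..b}" for u \<omega>
  proof -
    have "x powr p * h u \<omega> \<le> exp (- 2 * r * u) * max (a powr p) (b powr p)"
      unfolding h_gbm[symmetric] using powr_le_max[OF a that, of p] by (intro mult_left_mono) auto
    then show ?thesis using xp by (simp add: C_def pos_le_divide_eq mult.commute)
  qed
  have C: "C > 0" using a xp by (auto simp: C_def less_max_iff_disj intro!: divide_pos_pos)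
  have D: "integrable M (A (real n))" "integrable M (B (real n))"
    "expectation (A (real n)) = 1 + ?q * expectation (B (real n))" for n
    using expm_dynkin[OF stopping_time_min_const[OF \<tau>(1), of "real n"], of "real n" ?q "p * \<sigma>"] \<tau>(2)
    by (auto simp: A_def[abs_def] B_def[abs_def] h_def[abs_def])
  have ev: "\<forall>\<^sub>F n in sequentially. min (\<tau> \<omega>) (real n) = \<tau> \<omega>" for \<omega>
  proof -
    obtain m where "\<tau> \<omega> \<le> real m" using real_arch_simple by blast
    then show ?thesis by (intro eventually_sequentiallyI[of m]) (auto simp: min_def)
  qed
  have limA: "(\<lambda>n. A (real n) \<omega>) \<longlonglongrightarrow> A' \<omega>" for \<omega>
    unfolding A_def A'_def by (rule tendsto_eventually, rule eventually_mono[OF ev[of \<omega>]]) simp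
  have limB: "(\<lambda>n. B (real n) \<omega>) \<longlonglongrightarrow> B' \<omega>" for \<omega>
    unfolding B_def B'_def by (rule tendsto_eventually, rule eventually_mono[OF ev[of \<omega>]]) simp
  have Am: "A' \<in> borel_measurable M"
    by (rule borel_measurable_LIMSEQ_real[OF limA]) (use D(1) in auto)
  have Bm: "B' \<in> borel_measurable M"
    by (rule borel_measurable_LIMSEQ_real[OF limB]) (use D(2) in auto)
  have bA: "AE \<omega> in M. norm (A (real n) \<omega>) \<le> C" for n
    using in_ab AE_space
  proof eventually_elim
    case (elim \<omega>)
    let ?t = "min (\<tau> \<omega>) (real n)"
    have t: "0 \<le> ?t" using \<tau>(2)[OF elim(2)] by auto
    have "h ?t \<omega> \<le> exp (- 2 * r * ?t) * C" using elim(1) t by (intro hb) auto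
    also have "\<dots> \<le> 1 * C" using t r C by (intro mult_right_mono) auto
    finally show ?case unfolding A_def using hpos[of ?t \<omega>] by (simp add: abs_of_pos)
  qed
  have bB: "AE \<omega> in M. norm (B (real n) \<omega>) \<le> C / (2 * r)" for n
    using in_ab AE_space
  proof eventually_elim
    case (elim \<omega>)
    let ?t = "min (\<tau> \<omega>) (real n)"
    have t: "0 \<le> ?t" using \<tau>(2)[OF elim(2)] by auto
    have "B (real n) \<omega> \<le> (LINT u:{0..?t}|lborel. exp (- 2 * r * u) * C)"
      unfolding B_def
    proof (rule set_integral_mono)
      show "set_integrable lborel {0..?t} (\<lambda>u. h u \<omega>)"
        unfolding h_def by (intro borel_integrable_atLeastAtMost' expm_path_continuous elim)
      show "set_integrable lborel {0..?t} (\<lambda>u. exp (- 2 * r * u) * C)"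
        by (intro borel_integrable_atLeastAtMost' continuous_intros)
      fix u assume "u \<in> {0..?t}"
      then show "h u \<omega> \<le> exp (- 2 * r * u) * C" using elim(1) by (intro hb) auto
    qed
    also have "\<dots> = C * (1 - exp (- 2 * r * ?t)) / (2 * r)" by (rule exp_discount_integral_le[OF t])
    also have "\<dots> \<le> C / (2 * r)" using C r by (intro divide_right_mono) (auto simp: mult_le_cancel_left1)
    finally have "B (real n) \<omega> \<le> C / (2 * r)" .
    moreover have "B (real n) \<omega> \<ge> 0"
      unfolding B_def set_lebesgue_integral_def by (intro integral_nonneg_AE) (auto simp: hpos less_imp_le)
    ultimately show ?case by simp
  qed
  have cA: "integrable M A'" "(\<lambda>n. expectation (A (real n))) \<longlonglongrightarrow> expectation A'"
    using integrable_dominated_convergence[where s = "\<lambda>n. A (real n)" and f = A' and w = "\<lambda>_. C" and M = M]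
      integral_dominated_convergence[where s = "\<lambda>n. A (real n)" and f = A' and w = "\<lambda>_. C" and M = M]
      D(1) Am bA limA by auto
  have cB: "integrable M B'" "(\<lambda>n. expectation (B (real n))) \<longlonglongrightarrow> expectation B'"
    using integrable_dominated_convergence[where s = "\<lambda>n. B (real n)" and f = B' and w = "\<lambda>_. C / (2 * r)" and M = M]
      integral_dominated_convergence[where s = "\<lambda>n. B (real n)" and f = B' and w = "\<lambda>_. C / (2 * r)" and M = M]
      D(2) Bm bB limB by auto
  have "(\<lambda>n. expectation (A (real n))) \<longlonglongrightarrow> 1 + ?q * expectation B'"
    unfolding D(3) by (intro tendsto_intros cB)
  with cA(2) have EA: "expectation A' = 1 + ?q * expectation B'" by (rule LIMSEQ_unique)
  have E: "disc_end (\<lambda>s. s powr p) x \<tau> = (\<lambda>\<omega>. x powr p * A' \<omega>)"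
    unfolding disc_end_def A'_def by (rule ext) (rule h_gbm)
  have R: "disc_run (\<lambda>s. - ?q * s powr p) x \<tau> = (\<lambda>\<omega>. - ?q * x powr p * B' \<omega>)"
  proof
    fix \<omega>
    have H: "exp (- 2 * r * u) * (- ?q * gbm r \<sigma> W x u \<omega> powr p) = (- ?q * x powr p) * h u \<omega>" for u
      using h_gbm[of u \<omega>] by simp
    show "disc_run (\<lambda>s. - ?q * s powr p) x \<tau> \<omega> = - ?q * x powr p * B' \<omega>"
      unfolding disc_run_def B'_def by (simp only: H set_integral_mult_right)
  qed
  show "integrable M (disc_end (\<lambda>s. s powr p) x \<tau>)" unfolding E using cA by simp
  show "integrable M (disc_run (\<lambda>s. - ?q * s powr p) x \<tau>)" unfolding R using cB by simp
  show "expectation (disc_end (\<lambda>s. s powr p) x \<tau>) = x powr p - expectation (disc_run (\<lambda>s. - ?q * s powr p) x \<tau>)"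
    unfolding E R using EA by (simp add: algebra_simps)
qed

section \<open>Exit times\<close>

definition outside :: "real \<Rightarrow> real \<Rightarrow> real \<Rightarrow> 'a \<Rightarrow> real set" where
  "outside c e x \<omega> = {u \<in> {0..}. gbm r \<sigma> W x u \<omega> \<notin> {c<..<e}}"

text \<open>Real-valued version of the exit time, set to \<open>0\<close> on the null set of paths that never exit.\<close>

definition real_exit :: "real \<Rightarrow> real \<Rightarrow> real \<Rightarrow> 'a \<Rightarrow> real" where
  "real_exit c e x \<omega> = (if outside c e x \<omega> = {} then 0 else Inf (outside c e x \<omega>))"

lemma exit_time_eq_Inf: "exit_time (gbm r \<sigma> W x) c e \<omega> = Inf (ereal ` outside c e x \<omega>)"
  unfolding exit_time_def outside_def by (intro arg_cong[where f = Inf]) auto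

lemma outside_Inf:
  assumes \<omega>: "\<omega> \<in> space M" and ne: "outside c e x \<omega> \<noteq> {}"
  shows "Inf (outside c e x \<omega>) \<in> outside c e x \<omega>"
    and "\<And>u. u \<in> outside c e x \<omega> \<Longrightarrow> Inf (outside c e x \<omega>) \<le> u"
    and "exit_time (gbm r \<sigma> W x) c e \<omega> = ereal (Inf (outside c e x \<omega>))"
proof -
  have "closed ({0..} \<inter> (\<lambda>u. gbm r \<sigma> W x u \<omega>) -` (- {c<..<e}))"
    by (intro continuous_closed_preimage gbm_continuous \<omega>) auto
  also have "{0..} \<inter> (\<lambda>u. gbm r \<sigma> W x u \<omega>) -` (- {c<..<e}) = outside c e x \<omega>"
    by (auto simp: outside_def)
  finally have cl: "closed (outside c e x \<omega>)" .
  have bdd: "bdd_below (outside c e x \<omega>)" by (rule bdd_belowI[of _ 0]) (auto simp: outside_def)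
  show mem: "Inf (outside c e x \<omega>) \<in> outside c e x \<omega>" by (rule closed_contains_Inf[OF ne bdd cl])
  show le: "Inf (outside c e x \<omega>) \<le> u" if "u \<in> outside c e x \<omega>" for u
    using that bdd by (rule cInf_lower)
  show "exit_time (gbm r \<sigma> W x) c e \<omega> = ereal (Inf (outside c e x \<omega>))"
    unfolding exit_time_eq_Inf
    by (rule antisym) (use mem le in \<open>auto intro!: Inf_lower Inf_greatest\<close>)
qed

text \<open>At times strictly before t the path cannot have left; the value at t follows by
  continuity into the closed interval. The case t = 0 has no earlier times to take limits from and
  rests on the starting point.\<close>

lemma before_exit:
  assumes \<omega>: "\<omega> \<in> space M" and x: "x \<in> {c..e}" and t: "ereal t \<le> exit_time (gbm r \<sigma> W x) c e \<omega>"
    and u: "u \<in> {0..t}"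
  shows "gbm r \<sigma> W x u \<omega> \<in> {c..e}"
proof (cases "t = 0")
  case True
  then show ?thesis using u x gbm_0[OF \<omega>] by simp
next
  case False
  then have t0: "0 < t" using u by auto
  have "gbm r \<sigma> W x v \<omega> \<in> {c..e}" if v: "v \<in> {0..<t}" for v
  proof (rule ccontr)
    assume "\<not> ?thesis"
    then have "v \<in> outside c e x \<omega>" using v by (auto simp: outside_def)
    then have "exit_time (gbm r \<sigma> W x) c e \<omega> \<le> ereal v" unfolding exit_time_eq_Inf by (intro Inf_lower) auto
    then show False using t v by (meson atLeastLessThan_iff ereal_less_eq(3) not_le order_trans)
  qed
  then have "(\<lambda>v. gbm r \<sigma> W x v \<omega>) ` closure {0..<t} \<subseteq> {c..e}"
    using t0 by (intro image_closure_subset continuous_on_subset[OF gbm_continuous[OF \<omega>]])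
      (auto simp: closure_atLeastLessThan)
  moreover have "u \<in> closure {0..<t}" using u t0 by (simp add: closure_atLeastLessThan)
  ultimately show ?thesis by blast
qed

lemma admissible_stays_in:
  assumes x: "x \<in> {a..b}" and \<tau>: "\<tau> \<in> admissible M W r \<sigma> a b x"
  shows "\<tau> \<in> stays_in a b x"
proof -
  have "AE \<omega> in M. ereal (\<tau> \<omega>) \<le> exit_time (gbm r \<sigma> W x) a b \<omega>" using \<tau> by (simp add: admissible_def)
  then have "AE \<omega> in M. \<forall>u\<in>{0..\<tau> \<omega>}. gbm r \<sigma> W x u \<omega> \<in> {a..b}"
    using AE_space by eventually_elim (use before_exit x in blast)
  then show ?thesis using \<tau> by (simp add: admissible_def stays_in_def)
qed

definition stays_open :: "real \<Rightarrow> real \<Rightarrow> real \<Rightarrow> real \<Rightarrow> 'a set" where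
  "stays_open c e x t = {\<omega> \<in> space M. \<forall>u\<in>{0..t}. gbm r \<sigma> W x u \<omega> \<in> {c<..<e}}"

lemma real_exit_nonneg: "0 \<le> real_exit c e x \<omega>"
  unfolding real_exit_def by (auto intro!: cInf_greatest simp: outside_def)

text \<open>The second disjunct reflects the default value 0 on paths that never leave.\<close>

lemma real_exit_le_iff:
  assumes \<omega>: "\<omega> \<in> space M" and t: "0 \<le> t"
  shows "real_exit c e x \<omega> \<le> t \<longleftrightarrow> \<omega> \<notin> stays_open c e x t \<or> outside c e x \<omega> = {}"
proof (cases "outside c e x \<omega> = {}")
  case False
  show ?thesis
  proof
    assume "real_exit c e x \<omega> \<le> t"
    then have "Inf (outside c e x \<omega>) \<le> t" using False by (simp add: real_exit_def)
    then show "\<omega> \<notin> stays_open c e x t \<or> outside c e x \<omega> = {}"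
      using outside_Inf(1)[OF \<omega> False] by (auto simp: stays_open_def outside_def)
  next
    assume "\<omega> \<notin> stays_open c e x t \<or> outside c e x \<omega> = {}"
    then obtain u where "u \<in> {0..t}" "u \<in> outside c e x \<omega>" using \<omega> False by (auto simp: stays_open_def outside_def)
    then show "real_exit c e x \<omega> \<le> t" using outside_Inf(2)[OF \<omega> False, of u] False by (simp add: real_exit_def)
  qed
qed (use t in \<open>simp add: real_exit_def\<close>)

lemma outside_empty_iff:
  assumes "\<omega> \<in> space M"
  shows "outside c e x \<omega> = {} \<longleftrightarrow> (\<forall>n. \<omega> \<in> stays_open c e x (real n))"
proof
  assume R: "\<forall>n. \<omega> \<in> stays_open c e x (real n)"
  show "outside c e x \<omega> = {}"
  proof (rule ccontr)
    assume "outside c e x \<omega> \<noteq> {}"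
    then obtain u where u: "0 \<le> u" "gbm r \<sigma> W x u \<omega> \<notin> {c<..<e}" by (auto simp: outside_def)
    obtain n where "u \<le> real n" using real_arch_simple by blast
    then show False using R u by (auto simp: stays_open_def)
  qed
qed (use assms in \<open>auto simp: outside_def stays_open_def\<close>)

lemma sigma_algebra_past: "sigma_algebra (space M) (past t)"
  unfolding past_def by (rule sigma_algebra_sigma_sets) auto

text \<open>Reduces an uncountable intersection to countable operations: on the compact [0,t] a path
  inside an open interval keeps a positive distance from its ends, and staying in a slightly smaller
  closed interval can be tested on a countable dense set of times.\<close>

lemma stays_open_past:
  assumes t: "0 \<le> t"
  shows "stays_open c e x t \<in> past t"
proof -
  interpret S: sigma_algebra "space M" "past t" by (rule sigma_algebra_past)
  \<comment> \<open>The endpoint t is added by hand: the rationals approximating u are chosen to the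
    right of u, which is impossible for u = t.\<close>
  define Q where "Q = insert t (\<rat> \<inter> {0..t})"
  have Qc: "countable Q" unfolding Q_def by (intro countable_insert countable_Int1 countable_rat)
  have Qsub: "Q \<subseteq> {0..t}" using t by (auto simp: Q_def)
  have Qdense: "{0..t} \<subseteq> closure Q"
  proof
    fix u assume u: "u \<in> {0..t}"
    show "u \<in> closure Q"
    proof (cases "u = t")
      case True
      then show ?thesis using closure_subset[of Q] by (auto simp: Q_def)
    next
      case False
      show ?thesis unfolding closure_approachable
      proof (intro allI impI)
        fix d :: real assume "d > 0"
        then have "u < min (u + d) t" using u False by auto
        then obtain q where "q \<in> \<rat>" "u < q" "q < min (u + d) t" using Rats_dense_in_real by blast
        then show "\<exists>y\<in>Q. dist y u < d" using u
          by (intro bexI[of _ q]) (auto simp: Q_def dist_real_def)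
      qed
    qed
  qed
  define B where "B n u = {\<omega> \<in> space M. gbm r \<sigma> W x u \<omega> \<in> {c + 1 / real (Suc n)..e - 1 / real (Suc n)}}" for n u
  have Bm: "B n u \<in> past t" if "u \<in> {0..t}" for n u
  proof -
    define A where "A = {w. x * exp ((r - \<sigma>\<^sup>2 / 2) * u + \<sigma> * w) \<in> {c + 1 / real (Suc n)..e - 1 / real (Suc n)}}"
    have "A \<in> sets borel" unfolding A_def by measurable
    then have "W u -` A \<inter> space M \<in> past_gen t" using that by blast
    also have "W u -` A \<inter> space M = B n u" by (auto simp: A_def B_def gbm_def)
    finally show ?thesis unfolding past_def by (rule sigma_sets.Basic)
  qed
  have "stays_open c e x t = (\<Union>n. \<Inter>u\<in>Q. B n u)"
  proof (intro equalityI subsetI)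
    fix \<omega> assume "\<omega> \<in> stays_open c e x t"
    then have \<omega>: "\<omega> \<in> space M" and in_ce: "\<And>u. u \<in> {0..t} \<Longrightarrow> gbm r \<sigma> W x u \<omega> \<in> {c<..<e}"
      by (auto simp: stays_open_def)
    have ct: "continuous_on {0..t} (\<lambda>u. gbm r \<sigma> W x u \<omega>)"
      by (rule continuous_on_subset[OF gbm_continuous[OF \<omega>]]) auto
    obtain m1 where m1: "m1 \<in> {0..t}" "\<And>u. u \<in> {0..t} \<Longrightarrow> gbm r \<sigma> W x m1 \<omega> \<le> gbm r \<sigma> W x u \<omega>"
      using continuous_attains_inf[OF _ _ ct] t by auto
    obtain m2 where m2: "m2 \<in> {0..t}" "\<And>u. u \<in> {0..t} \<Longrightarrow> gbm r \<sigma> W x u \<omega> \<le> gbm r \<sigma> W x m2 \<omega>"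
      using continuous_attains_sup[OF _ _ ct] t by auto
    define d where "d = min (gbm r \<sigma> W x m1 \<omega> - c) (e - gbm r \<sigma> W x m2 \<omega>)"
    have "d > 0" using in_ce[OF m1(1)] in_ce[OF m2(1)] by (auto simp: d_def)
    then obtain n where n: "inverse (real (Suc n)) < d" using reals_Archimedean by blast
    have "\<omega> \<in> B n u" if "u \<in> Q" for u
      using m1(2)[of u] m2(2)[of u] that Qsub n \<omega> unfolding B_def d_def inverse_eq_divide by auto
    then show "\<omega> \<in> (\<Union>n. \<Inter>u\<in>Q. B n u)" by blast
  next
    fix \<omega> assume "\<omega> \<in> (\<Union>n. \<Inter>u\<in>Q. B n u)"
    then obtain n where n: "\<And>u. u \<in> Q \<Longrightarrow> \<omega> \<in> B n u" by blast
    have \<omega>: "\<omega> \<in> space M" using n[of t] by (simp add: Q_def B_def)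
    have cQ: "closure Q = {0..t}"
      using Qdense closure_minimal[OF Qsub] by auto
    have "(\<lambda>u. gbm r \<sigma> W x u \<omega>) ` closure Q \<subseteq> {c + 1 / real (Suc n)..e - 1 / real (Suc n)}"
      unfolding cQ by (rule image_closure_subset[of Q, unfolded cQ])
        (use n in \<open>auto simp: B_def intro!: continuous_on_subset[OF gbm_continuous[OF \<omega>]]\<close>)
    then have *: "gbm r \<sigma> W x u \<omega> \<in> {c + 1 / real (Suc n)..e - 1 / real (Suc n)}" if "u \<in> {0..t}" for u
      using that unfolding cQ by blast
    have "1 / real (Suc n) > 0" by simp
    then have "gbm r \<sigma> W x u \<omega> \<in> {c<..<e}" if "u \<in> {0..t}" for u
      using *[OF that] unfolding atLeastAtMost_iff greaterThanLessThan_iff by linarith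
    then show "\<omega> \<in> stays_open c e x t" using \<omega> by (simp add: stays_open_def)
  qed
  also have "\<dots> \<in> past t"
    by (intro S.countable_UN S.countable_INT' Qc image_subsetI Bm) (use Bm Qsub in \<open>auto simp: Q_def S.countable_INT'\<close>)
  finally show ?thesis .
qed

text \<open>The density of a centred normal law of variance t is at most 1 / sqrt (2 pi t).\<close>

lemma interval_hit_prob_le:
  assumes "0 < t" "\<alpha> \<le> \<beta>"
  shows "prob {\<omega> \<in> space M. W t \<omega> \<in> {\<alpha>..\<beta>}} \<le> (\<beta> - \<alpha>) / sqrt (2 * pi * t)"
proof -
  have D: "distributed M lborel (\<lambda>\<omega>. W t \<omega> - W 0 \<omega>) (normal_density 0 (sqrt t))"
    using W_increment(1)[of 0 t] assms by simp
  have "{\<omega> \<in> space M. W t \<omega> \<in> {\<alpha>..\<beta>}} = (\<lambda>\<omega>. W t \<omega> - W 0 \<omega>) -` {\<alpha>..\<beta>} \<inter> space M"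
    by (auto simp: W_0)
  then have "emeasure M {\<omega> \<in> space M. W t \<omega> \<in> {\<alpha>..\<beta>}}
      = (\<integral>\<^sup>+w. ennreal (normal_density 0 (sqrt t) w) * indicator {\<alpha>..\<beta>} w \<partial>lborel)"
    using distributed_emeasure[OF D, of "{\<alpha>..\<beta>}"] by simp
  also have "\<dots> \<le> (\<integral>\<^sup>+w. ennreal (1 / sqrt (2 * pi * t)) * indicator {\<alpha>..\<beta>} w \<partial>lborel)"
  proof (intro nn_integral_mono mult_right_mono ennreal_leI)
    fix w
    have "exp (- (w - 0)\<^sup>2 / (2 * (sqrt t)\<^sup>2)) \<le> 1" by simp
    then have "1 / sqrt (2 * pi * (sqrt t)\<^sup>2) * exp (- (w - 0)\<^sup>2 / (2 * (sqrt t)\<^sup>2)) \<le> 1 / sqrt (2 * pi * (sqrt t)\<^sup>2) * 1"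
      by (intro mult_left_mono) auto
    then show "normal_density 0 (sqrt t) w \<le> 1 / sqrt (2 * pi * t)"
      using assms by (simp add: normal_density_def)
  qed auto
  also have "\<dots> = ennreal (1 / sqrt (2 * pi * t)) * ennreal (\<beta> - \<alpha>)"
    using assms by (simp add: nn_integral_cmult)
  also have "\<dots> = ennreal ((\<beta> - \<alpha>) / sqrt (2 * pi * t))"
    using assms by (simp flip: ennreal_mult)
  finally show ?thesis using assms by (simp add: emeasure_eq_measure)
qed

text \<open>A path that never leaves forces W, at each positive integer time, into an interval whose
  position drifts but whose length L is fixed. The probability of this tends to 0.\<close>

lemma AE_exits:
  assumes c: "0 < c" and ce: "c < e" and x: "0 < x"
  shows "AE \<omega> in M. outside c e x \<omega> \<noteq> {}"
proof -
  have ev: "stays_open c e x (real n) \<in> events" for n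
    using stays_open_past[of "real n"] past_subset_events by force
  define L where "L = (ln e - ln c) / \<sigma>"
  have L: "L \<ge> 0" using c ce \<sigma> by (simp add: L_def)
  define N where "N = (\<Inter>n. stays_open c e x (real n))"
  have Nev: "N \<in> events" unfolding N_def using ev by auto
  have bound: "prob N \<le> L / sqrt (2 * pi * real (Suc n))" for n
  proof -
    define \<mu> where "\<mu> = (r - \<sigma>\<^sup>2 / 2) * real (Suc n)"
    define \<alpha> where "\<alpha> = (ln c - ln x - \<mu>) / \<sigma>"
    define \<beta> where "\<beta> = (ln e - ln x - \<mu>) / \<sigma>"
    have ab: "\<alpha> \<le> \<beta>" unfolding \<alpha>_def \<beta>_def using c ce \<sigma> by (intro divide_right_mono) auto
    have "stays_open c e x (real (Suc n)) \<subseteq> {\<omega> \<in> space M. W (real (Suc n)) \<omega> \<in> {\<alpha>..\<beta>}}"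
    proof
      fix \<omega> assume "\<omega> \<in> stays_open c e x (real (Suc n))"
      then have \<omega>: "\<omega> \<in> space M" and g: "gbm r \<sigma> W x (real (Suc n)) \<omega> \<in> {c<..<e}"
        by (auto simp: stays_open_def)
      have "ln (gbm r \<sigma> W x (real (Suc n)) \<omega>) = ln x + (\<mu> + \<sigma> * W (real (Suc n)) \<omega>)"
        using x by (simp add: gbm_def \<mu>_def ln_mult)
      moreover have "ln c < ln (gbm r \<sigma> W x (real (Suc n)) \<omega>)" "ln (gbm r \<sigma> W x (real (Suc n)) \<omega>) < ln e"
        using g c ce by auto
      ultimately show "\<omega> \<in> {\<omega> \<in> space M. W (real (Suc n)) \<omega> \<in> {\<alpha>..\<beta>}}"
        using \<omega> \<sigma> by (simp add: \<alpha>_def \<beta>_def divide_le_eq le_divide_eq mult.commute)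
    qed
    then have "N \<subseteq> {\<omega> \<in> space M. W (real (Suc n)) \<omega> \<in> {\<alpha>..\<beta>}}" unfolding N_def by blast
    then have "prob N \<le> prob {\<omega> \<in> space M. W (real (Suc n)) \<omega> \<in> {\<alpha>..\<beta>}}"
      by (rule finite_measure_mono) measurable
    also have "\<dots> \<le> (\<beta> - \<alpha>) / sqrt (2 * pi * real (Suc n))" by (rule interval_hit_prob_le) (auto simp: ab)
    also have "\<beta> - \<alpha> = L" by (simp add: \<alpha>_def \<beta>_def L_def diff_divide_distrib)
    finally show ?thesis .
  qed
  have "(\<lambda>n. L / sqrt (2 * pi * real (Suc n))) \<longlonglongrightarrow> 0" by real_asymp
  then have "prob N \<le> 0" using bound by (intro LIMSEQ_le_const) auto
  then have "N \<in> null_sets M" using Nev by (auto simp: null_sets_def emeasure_eq_measure measure_le_0_iff)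
  then have "AE \<omega> in M. \<omega> \<notin> N" by (rule AE_not_in)
  then show ?thesis using AE_space
    by eventually_elim (use outside_empty_iff in \<open>auto simp: N_def\<close>)
qed

text \<open>Never leaving is an event of the whole future, but it is null; here the augmentation of
  the filtration enters.\<close>

lemma real_exit_stopping_time:
  assumes c: "0 < c" and ce: "c < e" and x: "0 < x"
  shows "stopping_time (BM_filtration M W) (real_exit c e x)"
  unfolding stopping_time_iff
proof (intro allI impI)
  fix t s :: real assume ts: "t < s"
  interpret S: sigma_algebra "space M" "past_null s" by (rule sigma_algebra_past_null)
  show "{\<omega> \<in> space M. real_exit c e x \<omega> \<le> t} \<in> past_null s"
  proof (cases "0 \<le> t")
    case True
    have "{\<omega> \<in> space M. outside c e x \<omega> = {}} = (\<Inter>n. stays_open c e x (real n))"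
    proof (rule set_eqI)
      fix \<omega>
      show "\<omega> \<in> {\<omega> \<in> space M. outside c e x \<omega> = {}} \<longleftrightarrow> \<omega> \<in> (\<Inter>n. stays_open c e x (real n))"
        by (cases "\<omega> \<in> space M") (simp_all add: outside_empty_iff stays_open_def)
    qed
    moreover have "stays_open c e x (real n) \<in> events" for n
      using stays_open_past[of "real n"] past_subset_events by force
    ultimately have "{\<omega> \<in> space M. outside c e x \<omega> = {}} \<in> events" by auto
    then have "{\<omega> \<in> space M. outside c e x \<omega> = {}} \<in> null_sets M"
      using AE_exits[OF assms] by (subst (asm) AE_iff_null) (auto simp: Collect_conj_eq)
    then have 1: "{\<omega> \<in> space M. outside c e x \<omega> = {}} \<in> past_null s" using null_subset_past_null by blast
    have 2: "stays_open c e x t \<in> past_null s"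
      using stays_open_past[OF True] past_subset_past_null[of t s] ts by fastforce
    have "{\<omega> \<in> space M. real_exit c e x \<omega> \<le> t} = (space M - stays_open c e x t) \<union> {\<omega> \<in> space M. outside c e x \<omega> = {}}"
      using real_exit_le_iff True by auto
    then show ?thesis using 1 2 by auto
  next
    case False
    then have "{\<omega> \<in> space M. real_exit c e x \<omega> \<le> t} = {}"
      by (auto dest: order_trans[OF real_exit_nonneg])
    then show ?thesis by (simp only: S.empty_sets)
  qed
qed

lemma real_exit_AE:
  assumes c: "0 < c" and ce: "c < e" and x: "x \<in> {c..e}"
  shows "AE \<omega> in M. exit_time (gbm r \<sigma> W x) c e \<omega> = ereal (real_exit c e x \<omega>) \<and>
           gbm r \<sigma> W x (real_exit c e x \<omega>) \<omega> \<in> {c, e}"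
proof -
  have "AE \<omega> in M. outside c e x \<omega> \<noteq> {}" using AE_exits[OF c ce] c x by auto
  then show ?thesis using AE_space
  proof eventually_elim
    case (elim \<omega>)
    have eq: "exit_time (gbm r \<sigma> W x) c e \<omega> = ereal (real_exit c e x \<omega>)"
      using outside_Inf(3)[OF elim(2,1)] elim(1) by (simp add: real_exit_def)
    have "gbm r \<sigma> W x (real_exit c e x \<omega>) \<omega> \<in> {c..e}"
      using before_exit[OF elim(2) x, of "real_exit c e x \<omega>"] eq real_exit_nonneg by simp
    moreover have "gbm r \<sigma> W x (real_exit c e x \<omega>) \<omega> \<notin> {c<..<e}"
      using outside_Inf(1)[OF elim(2,1)] elim(1) by (simp add: real_exit_def outside_def)
    ultimately show ?case using eq by auto
  qed
qed

lemma real_exit_admissible: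
  assumes "0 < c" "c < e" "x \<in> {c..e}" "a \<le> c" "e \<le> b"
  shows "real_exit c e x \<in> admissible M W r \<sigma> a b x"
proof -
  have "exit_time (gbm r \<sigma> W x) c e \<omega> \<le> exit_time (gbm r \<sigma> W x) a b \<omega>" for \<omega>
    unfolding exit_time_def using assms by (intro Inf_superset_mono) auto
  then have "AE \<omega> in M. ereal (real_exit c e x \<omega>) \<le> exit_time (gbm r \<sigma> W x) a b \<omega>"
    using real_exit_AE[OF assms(1-3)] by (auto elim!: eventually_mono) metis
  then show ?thesis
    using real_exit_stopping_time[of c e x] real_exit_nonneg assms by (auto simp: admissible_def)
qed

end

section \<open>Solutions of the discounted equation\<close>

text \<open>Derivatives are witnesses instead of values of \<open>deriv\<close>, which keeps closure
  under products and quotients a matter of exhibiting formulas.\<close>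

definition C2_on :: "real set \<Rightarrow> (real \<Rightarrow> real) \<Rightarrow> bool" where
  "C2_on U f \<longleftrightarrow> (\<exists>f1 f2. continuous_on U f2 \<and>
     (\<forall>s\<in>U. (f has_real_derivative f1 s) (at s) \<and> (f1 has_real_derivative f2 s) (at s)))"

lemma continuous_on_of_deriv:
  assumes "\<And>s. s \<in> U \<Longrightarrow> (f has_real_derivative f1 s) (at s)"
  shows "continuous_on U f"
  using assms by (meson DERIV_isCont continuous_at_imp_continuous_on)

lemma C2_on_continuous: "C2_on U f \<Longrightarrow> continuous_on U f"
  unfolding C2_on_def by (meson continuous_on_of_deriv)

lemma C2_on_subset: "C2_on U f \<Longrightarrow> V \<subseteq> U \<Longrightarrow> C2_on V f"
  unfolding C2_on_def by (meson continuous_on_subset subsetD)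

lemma C2_on_diff:
  assumes "C2_on U f" "C2_on U g"
  shows "C2_on U (\<lambda>s. f s - g s)"
proof -
  obtain f1 f2 g1 g2 where "continuous_on U f2" "continuous_on U g2"
    and D: "\<And>s. s \<in> U \<Longrightarrow> (f has_real_derivative f1 s) (at s)" "\<And>s. s \<in> U \<Longrightarrow> (f1 has_real_derivative f2 s) (at s)"
     "\<And>s. s \<in> U \<Longrightarrow> (g has_real_derivative g1 s) (at s)" "\<And>s. s \<in> U \<Longrightarrow> (g1 has_real_derivative g2 s) (at s)"
    using assms unfolding C2_on_def by blast
  then show ?thesis unfolding C2_on_def
    by (intro exI[of _ "\<lambda>s. f1 s - g1 s"] exI[of _ "\<lambda>s. f2 s - g2 s"])
       (auto intro!: continuous_intros DERIV_diff)
qed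

lemma C2_on_mult:
  assumes "C2_on U f" "C2_on U g"
  shows "C2_on U (\<lambda>s. f s * g s)"
proof -
  obtain f1 f2 g1 g2 where c: "continuous_on U f2" "continuous_on U g2"
    and D: "\<And>s. s \<in> U \<Longrightarrow> (f has_real_derivative f1 s) (at s)" "\<And>s. s \<in> U \<Longrightarrow> (f1 has_real_derivative f2 s) (at s)"
     "\<And>s. s \<in> U \<Longrightarrow> (g has_real_derivative g1 s) (at s)" "\<And>s. s \<in> U \<Longrightarrow> (g1 has_real_derivative g2 s) (at s)"
    using assms unfolding C2_on_def by blast
  have c1: "continuous_on U f" "continuous_on U f1" "continuous_on U g" "continuous_on U g1"
    by (rule continuous_on_of_deriv[OF D(1)] continuous_on_of_deriv[OF D(2)]
          continuous_on_of_deriv[OF D(3)] continuous_on_of_deriv[OF D(4)]; assumption)+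
  show ?thesis unfolding C2_on_def
    by (intro exI[of _ "\<lambda>s. f1 s * g s + f s * g1 s"] exI[of _ "\<lambda>s. f2 s * g s + 2 * f1 s * g1 s + f s * g2 s"])
       (auto intro!: continuous_intros c c1 derivative_eq_intros D)
qed

lemma C2_on_inverse:
  assumes "C2_on U f" and nz: "\<And>s. s \<in> U \<Longrightarrow> f s \<noteq> 0"
  shows "C2_on U (\<lambda>s. 1 / f s)"
proof -
  obtain f1 f2 where c: "continuous_on U f2"
    and D: "\<And>s. s \<in> U \<Longrightarrow> (f has_real_derivative f1 s) (at s)" "\<And>s. s \<in> U \<Longrightarrow> (f1 has_real_derivative f2 s) (at s)"
    using assms unfolding C2_on_def by blast
  have c1: "continuous_on U f" "continuous_on U f1"
    by (rule continuous_on_of_deriv[OF D(1)] continuous_on_of_deriv[OF D(2)]; assumption)+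
  have d1: "((\<lambda>s. 1 / f s) has_real_derivative - f1 s / (f s)\<^sup>2) (at s)" if "s \<in> U" for s
    by (rule derivative_eq_intros D[OF that] refl nz[OF that])+ (simp add: power2_eq_square)
  have d2: "((\<lambda>s. - f1 s / (f s)\<^sup>2) has_real_derivative (2 * (f1 s)\<^sup>2 - f2 s * f s) / (f s)^3) (at s)" if "s \<in> U" for s
    by (rule derivative_eq_intros D[OF that] refl nz[OF that] power_not_zero)+
       (use nz[OF that] in \<open>simp add: field_simps power2_eq_square power3_eq_cube\<close>)
  show ?thesis unfolding C2_on_def
    using d1 d2 nz
    by (intro exI[of _ "\<lambda>s. - f1 s / (f s)\<^sup>2"] exI[of _ "\<lambda>s. (2 * (f1 s)\<^sup>2 - f2 s * f s) / (f s)^3"])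
       (auto intro!: continuous_intros c c1)
qed

text \<open>Converts the witnesses to iterated \<open>deriv\<close>. Openness of U is what transfers
  derivatives to a function that agrees with f on U only.\<close>

lemma C2_on_deriv:
  assumes U: "open U" and f: "C2_on U f" and V: "\<And>s. s \<in> U \<Longrightarrow> V s = f s"
  shows "s \<in> U \<Longrightarrow> (deriv V has_real_derivative deriv (deriv V) s) (at s)"
    and "s \<in> U \<Longrightarrow> isCont (deriv (deriv V)) s"
proof -
  obtain f1 f2 where c: "continuous_on U f2"
    and D: "\<And>s. s \<in> U \<Longrightarrow> (f has_real_derivative f1 s) (at s)" "\<And>s. s \<in> U \<Longrightarrow> (f1 has_real_derivative f2 s) (at s)"
    using f unfolding C2_on_def by blast
  have V1: "deriv V s = f1 s" if "s \<in> U" for s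
    using has_field_derivative_transform_within_open[OF D(1)[OF that] U that, of V] V by (auto intro: DERIV_imp_deriv)
  have dV1: "(deriv V has_real_derivative f2 s) (at s)" if "s \<in> U" for s
    using has_field_derivative_transform_within_open[OF D(2)[OF that] U that, of "deriv V"] V1 by auto
  then have V2: "deriv (deriv V) s = f2 s" if "s \<in> U" for s using that by (auto intro: DERIV_imp_deriv)
  show "s \<in> U \<Longrightarrow> (deriv V has_real_derivative deriv (deriv V) s) (at s)" using dV1 V2 by simp
  show "isCont (deriv (deriv V)) s" if s: "s \<in> U"
  proof -
    have "continuous_on U (deriv (deriv V))"
      using c by (rule continuous_on_eq) (simp add: V2)
    then show ?thesis using U s by (simp add: continuous_on_eq_continuous_at)
  qed
qed

context gbm_model
begin

definition ode_sol :: "(real \<Rightarrow> real) \<Rightarrow> (real \<Rightarrow> real) \<Rightarrow> bool" where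
  "ode_sol \<phi> g \<longleftrightarrow> (\<exists>\<phi>1 \<phi>2. continuous_on {0<..} \<phi>2 \<and>
     (\<forall>s>0. (\<phi> has_real_derivative \<phi>1 s) (at s) \<and> (\<phi>1 has_real_derivative \<phi>2 s) (at s) \<and>
        \<sigma>\<^sup>2 / 2 * s\<^sup>2 * \<phi>2 s + r * s * \<phi>1 s - 2 * r * \<phi> s = - g s))"

text \<open>The probabilistic and the analytic reading of (L - 2r) \<phi> = - g, carried together so
  that neither has to be derived from the other.\<close>

definition sol :: "real \<Rightarrow> real \<Rightarrow> (real \<Rightarrow> real) \<Rightarrow> (real \<Rightarrow> real) \<Rightarrow> bool" where
  "sol a b \<phi> g \<longleftrightarrow> dynkin_pair a b \<phi> g \<and> ode_sol \<phi> g"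

lemma sol_power:
  assumes "0 < a"
  shows "sol a b (\<lambda>s. s powr p) (\<lambda>s. - char_poly p * s powr p)"
proof -
  have "ode_sol (\<lambda>s. s powr p) (\<lambda>s. - char_poly p * s powr p)"
    unfolding ode_sol_def
  proof (rule exI[of _ "\<lambda>s. p * s powr (p - 1)"], rule exI[of _ "\<lambda>s. p * ((p - 1) * s powr (p - 1 - 1))"], intro conjI allI impI)
    fix s :: real assume s: "s > 0"
    show "((\<lambda>s. s powr p) has_real_derivative p * s powr (p - 1)) (at s)"
      by (rule has_real_derivative_powr[OF s])
    show "((\<lambda>s. p * s powr (p - 1)) has_real_derivative p * ((p - 1) * s powr (p - 1 - 1))) (at s)"
      by (rule DERIV_cmult[OF has_real_derivative_powr[OF s]])
    show "\<sigma>\<^sup>2 / 2 * s\<^sup>2 * (p * ((p - 1) * s powr (p - 1 - 1))) + r * s * (p * s powr (p - 1)) - 2 * r * s powr p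
       = - (- char_poly p * s powr p)"
      using s by (simp add: powr_diff char_poly_def power2_eq_square) (simp add: algebra_simps)
  qed (auto intro!: continuous_intros)
  then show ?thesis using dynkin_power[OF assms] by (simp add: sol_def)
qed

lemma sol_scale: "sol a b \<phi> g \<Longrightarrow> sol a b (\<lambda>s. k * \<phi> s) (\<lambda>s. k * g s)"
proof -
  assume A: "sol a b \<phi> g"
  then obtain \<phi>1 \<phi>2 where c: "continuous_on {0<..} \<phi>2"
    and D: "\<And>s. s > 0 \<Longrightarrow> (\<phi> has_real_derivative \<phi>1 s) (at s)" "\<And>s. s > 0 \<Longrightarrow> (\<phi>1 has_real_derivative \<phi>2 s) (at s)"
      "\<And>s. s > 0 \<Longrightarrow> \<sigma>\<^sup>2 / 2 * s\<^sup>2 * \<phi>2 s + r * s * \<phi>1 s - 2 * r * \<phi> s = - g s"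
    unfolding sol_def ode_sol_def by blast
  have "ode_sol (\<lambda>s. k * \<phi> s) (\<lambda>s. k * g s)"
    unfolding ode_sol_def
  proof (rule exI[of _ "\<lambda>s. k * \<phi>1 s"], rule exI[of _ "\<lambda>s. k * \<phi>2 s"], intro conjI allI impI)
    fix s :: real assume s: "s > 0"
    have "\<sigma>\<^sup>2 / 2 * s\<^sup>2 * (k * \<phi>2 s) + r * s * (k * \<phi>1 s) - 2 * r * (k * \<phi> s)
      = k * (\<sigma>\<^sup>2 / 2 * s\<^sup>2 * \<phi>2 s + r * s * \<phi>1 s - 2 * r * \<phi> s)" by (simp add: algebra_simps)
    then show "\<sigma>\<^sup>2 / 2 * s\<^sup>2 * (k * \<phi>2 s) + r * s * (k * \<phi>1 s) - 2 * r * (k * \<phi> s) = - (k * g s)"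
      unfolding D(3)[OF s] by simp
  qed (auto intro!: continuous_intros c DERIV_cmult D)
  then show ?thesis using A dynkin_pair_scale by (simp add: sol_def)
qed

lemma sol_add: "sol a b \<phi> g \<Longrightarrow> sol a b \<psi> k \<Longrightarrow> sol a b (\<lambda>s. \<phi> s + \<psi> s) (\<lambda>s. g s + k s)"
proof -
  assume A: "sol a b \<phi> g" and B: "sol a b \<psi> k"
  obtain \<phi>1 \<phi>2 where c: "continuous_on {0<..} \<phi>2"
    and D: "\<And>s. s > 0 \<Longrightarrow> (\<phi> has_real_derivative \<phi>1 s) (at s)" "\<And>s. s > 0 \<Longrightarrow> (\<phi>1 has_real_derivative \<phi>2 s) (at s)"
      "\<And>s. s > 0 \<Longrightarrow> \<sigma>\<^sup>2 / 2 * s\<^sup>2 * \<phi>2 s + r * s * \<phi>1 s - 2 * r * \<phi> s = - g s"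
    using A unfolding sol_def ode_sol_def by blast
  obtain \<psi>1 \<psi>2 where c': "continuous_on {0<..} \<psi>2"
    and D': "\<And>s. s > 0 \<Longrightarrow> (\<psi> has_real_derivative \<psi>1 s) (at s)" "\<And>s. s > 0 \<Longrightarrow> (\<psi>1 has_real_derivative \<psi>2 s) (at s)"
      "\<And>s. s > 0 \<Longrightarrow> \<sigma>\<^sup>2 / 2 * s\<^sup>2 * \<psi>2 s + r * s * \<psi>1 s - 2 * r * \<psi> s = - k s"
    using B unfolding sol_def ode_sol_def by blast
  have "ode_sol (\<lambda>s. \<phi> s + \<psi> s) (\<lambda>s. g s + k s)"
    unfolding ode_sol_def
  proof (rule exI[of _ "\<lambda>s. \<phi>1 s + \<psi>1 s"], rule exI[of _ "\<lambda>s. \<phi>2 s + \<psi>2 s"], intro conjI allI impI)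
    fix s :: real assume s: "s > 0"
    show "\<sigma>\<^sup>2 / 2 * s\<^sup>2 * (\<phi>2 s + \<psi>2 s) + r * s * (\<phi>1 s + \<psi>1 s) - 2 * r * (\<phi> s + \<psi> s) = - (g s + k s)"
      using D(3)[OF s] D'(3)[OF s] by (simp add: distrib_left)
  qed (auto intro!: continuous_intros c c' DERIV_add D D')
  then show ?thesis using A B dynkin_pair_add by (simp add: sol_def)
qed

lemma sol_monomial:
  assumes "0 < a" "char_poly p \<noteq> 0"
  shows "sol a b (\<lambda>s. - (k / char_poly p) * s powr p) (\<lambda>s. k * s powr p)"
proof -
  have "(\<lambda>s. - (k / char_poly p) * (- char_poly p * s powr p)) = (\<lambda>s. k * s powr p)"
    using assms(2) by auto
  then show ?thesis using sol_scale[OF sol_power[OF assms(1)], of b "- (k / char_poly p)" p] by simp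
qed

lemma sol_C2: "sol a b \<phi> g \<Longrightarrow> C2_on {0<..} \<phi>"
  unfolding sol_def ode_sol_def C2_on_def greaterThan_iff Ball_def by blast

lemma ode_sol_deriv:
  assumes U: "open U" "U \<subseteq> {0<..}" and \<phi>: "ode_sol \<phi> g" and V: "\<And>s. s \<in> U \<Longrightarrow> V s = \<phi> s" and s: "s \<in> U"
  shows "\<sigma>\<^sup>2 / 2 * s\<^sup>2 * deriv (deriv V) s + r * s * deriv V s - 2 * r * V s = - g s"
proof -
  obtain f1 f2 where D: "\<And>s. s > 0 \<Longrightarrow> (\<phi> has_real_derivative f1 s) (at s)" "\<And>s. s > 0 \<Longrightarrow> (f1 has_real_derivative f2 s) (at s)"
    "\<And>s. s > 0 \<Longrightarrow> \<sigma>\<^sup>2 / 2 * s\<^sup>2 * f2 s + r * s * f1 s - 2 * r * \<phi> s = - g s"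
    using \<phi> unfolding ode_sol_def by blast
  have pos: "s > 0" if "s \<in> U" for s using that U by auto
  have V1: "deriv V s = f1 s" if "s \<in> U" for s
    using has_field_derivative_transform_within_open[OF D(1)[OF pos[OF that]] U(1) that, of V] V
    by (auto intro: DERIV_imp_deriv)
  have "(deriv V has_real_derivative f2 s) (at s)"
    using has_field_derivative_transform_within_open[OF D(2)[OF pos[OF s]] U(1) s, of "deriv V"] V1 by auto
  then have "deriv (deriv V) s = f2 s" by (rule DERIV_imp_deriv)
  then show ?thesis using D(3)[OF pos[OF s]] V1[OF s] V[OF s] by simp
qed

section \<open>Characteristic roots and homogeneous solutions\<close>

definition \<beta>disc :: real where "\<beta>disc = sqrt ((r - \<sigma>\<^sup>2 / 2)\<^sup>2 + 4 * r * \<sigma>\<^sup>2)"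
definition \<beta>m :: real where "\<beta>m = (- (r - \<sigma>\<^sup>2 / 2) - \<beta>disc) / \<sigma>\<^sup>2"
definition \<beta>p :: real where "\<beta>p = (- (r - \<sigma>\<^sup>2 / 2) + \<beta>disc) / \<sigma>\<^sup>2"
text \<open>The gap between the characteristic roots: the quotient of the two homogeneous powers is
  \<open>s powr \<delta>\<close>, the natural scale of the problem.\<close>

definition \<delta> :: real where "\<delta> = \<beta>p - \<beta>m"

lemma \<delta>_pos: "\<delta> > 0"
proof -
  have "\<beta>disc > 0" unfolding \<beta>disc_def using r \<sigma> by (intro real_sqrt_gt_zero add_nonneg_pos) auto
  moreover have "\<delta> = 2 * \<beta>disc / \<sigma>\<^sup>2" by (simp add: \<delta>_def \<beta>m_def \<beta>p_def flip: diff_divide_distrib)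
  ultimately show ?thesis using \<sigma> by simp
qed

lemma char_poly_roots: "char_poly \<beta>m = 0" "char_poly \<beta>p = 0"
proof -
  have root: "char_poly p = 0" if "\<sigma>\<^sup>2 * p = - (r - \<sigma>\<^sup>2 / 2) + d" "d\<^sup>2 = (r - \<sigma>\<^sup>2 / 2)\<^sup>2 + 4 * r * \<sigma>\<^sup>2" for p d
  proof -
    have "2 * \<sigma>\<^sup>2 * char_poly p = (\<sigma>\<^sup>2 * p + (r - \<sigma>\<^sup>2 / 2))\<^sup>2 - ((r - \<sigma>\<^sup>2 / 2)\<^sup>2 + 4 * r * \<sigma>\<^sup>2)"
      by (simp add: char_poly_def power2_eq_square field_simps)
    also have "\<dots> = 0" unfolding that(1) that(2)[symmetric] by simp
    finally show ?thesis using \<sigma> by simp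
  qed
  have "\<beta>disc\<^sup>2 = (r - \<sigma>\<^sup>2 / 2)\<^sup>2 + 4 * r * \<sigma>\<^sup>2"
    unfolding \<beta>disc_def using r \<sigma> by (intro real_sqrt_pow2) auto
  then show "char_poly \<beta>m = 0" "char_poly \<beta>p = 0"
    using \<sigma> root[of \<beta>m "- \<beta>disc"] root[of \<beta>p \<beta>disc] by (simp_all add: \<beta>m_def \<beta>p_def)
qed

lemma powr_\<beta>p: "s powr \<beta>p = s powr \<beta>m * s powr \<delta>"
  by (simp add: \<delta>_def flip: powr_add)

lemma sol_homogeneous:
  assumes "0 < a"
  shows "sol a b (\<lambda>s. s powr \<beta>m * (A + B * s powr \<delta>)) (\<lambda>_. 0)"
proof -
  have "sol a b (\<lambda>s. A * s powr \<beta>m + B * s powr \<beta>p) (\<lambda>s. A * (- char_poly \<beta>m * s powr \<beta>m) + B * (- char_poly \<beta>p * s powr \<beta>p))"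
    by (intro sol_add sol_scale sol_power assms)
  then show ?thesis by (simp add: char_poly_roots powr_\<beta>p algebra_simps)
qed

lemma homogeneous_interpolation:
  assumes "0 < c" "c < e"
  shows "\<exists>A B. c powr \<beta>m * (A + B * c powr \<delta>) = v \<and> e powr \<beta>m * (A + B * e powr \<delta>) = w"
proof -
  define B where "B = (w / e powr \<beta>m - v / c powr \<beta>m) / (e powr \<delta> - c powr \<delta>)"
  define A where "A = v / c powr \<beta>m - B * c powr \<delta>"
  have "c powr \<delta> < e powr \<delta>" using assms \<delta>_pos by (intro powr_less_mono2) auto
  then have "B * (e powr \<delta> - c powr \<delta>) = w / e powr \<beta>m - v / c powr \<beta>m" by (simp add: B_def)
  then have "A + B * e powr \<delta> = w / e powr \<beta>m" by (simp add: A_def algebra_simps)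
  moreover have "A + B * c powr \<delta> = v / c powr \<beta>m" by (simp add: A_def)
  ultimately show ?thesis using assms by (intro exI[of _ A] exI[of _ B]) auto
qed

lemma stays_in_end:
  assumes "\<tau> \<in> stays_in a b x"
  shows "AE \<omega> in M. gbm r \<sigma> W x (\<tau> \<omega>) \<omega> \<in> {a..b}"
proof -
  have "AE \<omega> in M. \<forall>u\<in>{0..\<tau> \<omega>}. gbm r \<sigma> W x u \<omega> \<in> {a..b}" "\<forall>\<omega>\<in>space M. 0 \<le> \<tau> \<omega>"
    using assms by (auto simp: stays_in_def)
  then show ?thesis using AE_space by (auto elim!: eventually_elim2)
qed

lemma gbm_stopped_measurable:
  assumes "\<tau> \<in> stays_in a b x"
  shows "(\<lambda>\<omega>. gbm r \<sigma> W x (\<tau> \<omega>) \<omega>) \<in> borel_measurable M" "\<tau> \<in> borel_measurable M"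
proof -
  show [measurable]: "\<tau> \<in> borel_measurable M" using assms by (intro stopping_time_measurable) (auto simp: stays_in_def)
  have [measurable]: "(\<lambda>\<omega>. W (\<tau> \<omega>) \<omega>) \<in> borel_measurable M"
    by (rule W_stopped_measurable) (use assms in \<open>auto simp: stays_in_def\<close>)
  show "(\<lambda>\<omega>. gbm r \<sigma> W x (\<tau> \<omega>) \<omega>) \<in> borel_measurable M" unfolding gbm_def by measurable
qed

lemma exit_time_nonneg: "0 \<le> exit_time S a b \<omega>"
  unfolding exit_time_def by (auto intro!: Inf_greatest)

text \<open>The horizon is extended-real because exit times can be infinite. Measurability is needed
  on the whole space before integrands that agree almost everywhere may be exchanged.\<close>

lemma discounted_path_measurable:
  assumes T: "T \<in> borel_measurable M" and g: "g \<in> borel_measurable borel"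
    and T0: "\<And>\<omega>. \<omega> \<in> space M \<Longrightarrow> 0 \<le> T \<omega>"
  shows "(\<lambda>\<omega>. interval_lebesgue_integral lborel 0 (T \<omega>) (\<lambda>u. exp (- 2 * r * u) * g (gbm r \<sigma> W x u \<omega>)))
     \<in> borel_measurable M"
proof -
  note [measurable] = T g
  define F where "F = (\<lambda>(\<omega>, u). if 0 < u \<and> ereal u < T \<omega>
     then exp (- 2 * r * u) * g (x * exp ((r - \<sigma>\<^sup>2 / 2) * u + \<sigma> * W (max 0 u) \<omega>)) else 0)"
  have J: "(\<lambda>z. W (max 0 (snd z)) (fst z)) \<in> borel_measurable (M \<Otimes>\<^sub>M borel)"
    using measurable_compose[OF measurable_pair_swap' joint_measurable] by (simp add: split_beta')
  have "(\<lambda>z. if 0 < snd z \<and> ereal (snd z) < T (fst z)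
     then exp (- 2 * r * snd z) * g (x * exp ((r - \<sigma>\<^sup>2 / 2) * snd z + \<sigma> * W (max 0 (snd z)) (fst z))) else 0)
     \<in> borel_measurable (M \<Otimes>\<^sub>M borel)"
    using J by measurable
  then have "F \<in> borel_measurable (M \<Otimes>\<^sub>M lborel)" by (simp add: F_def split_beta')
  then have "(\<lambda>\<omega>. \<integral>u. F (\<omega>, u) \<partial>lborel) \<in> borel_measurable M" by measurable
  then show ?thesis
  proof (rule measurable_cong[THEN iffD1, rotated])
    fix \<omega> assume \<omega>: "\<omega> \<in> space M"
    show "(\<integral>u. F (\<omega>, u) \<partial>lborel)
        = interval_lebesgue_integral lborel 0 (T \<omega>) (\<lambda>u. exp (- 2 * r * u) * g (gbm r \<sigma> W x u \<omega>))"
      unfolding interval_lebesgue_integral_def set_lebesgue_integral_def using T0[OF \<omega>]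
      by (auto intro!: Bochner_Integration.integral_cong
          simp: F_def gbm_def indicator_def einterval_def max_def zero_ereal_def)
  qed
qed

lemma interval_integral_eq_disc_run:
  assumes t: "0 \<le> t" "\<tau> \<omega> = t" and st: "\<forall>u\<in>{0..t}. gbm r \<sigma> W x u \<omega> \<in> {a..b}"
    and g: "\<And>s. s \<in> {a..b} \<Longrightarrow> g s = gg s"
  shows "interval_lebesgue_integral lborel 0 (ereal t) (\<lambda>u. exp (- 2 * r * u) * g (gbm r \<sigma> W x u \<omega>))
       = disc_run gg x \<tau> \<omega>"
proof -
  have "interval_lebesgue_integral lborel 0 (ereal t) (\<lambda>u. exp (- 2 * r * u) * g (gbm r \<sigma> W x u \<omega>))
     = (LINT u:{0..t}|lborel. exp (- 2 * r * u) * g (gbm r \<sigma> W x u \<omega>))"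
    unfolding zero_ereal_def using t(1) by (rule interval_integral_Icc)
  also have "\<dots> = (LINT u:{0..t}|lborel. exp (- 2 * r * u) * gg (gbm r \<sigma> W x u \<omega>))"
    by (rule set_lebesgue_integral_cong) (use st g in auto)
  finally show ?thesis using t(2) by (simp add: disc_run_def)
qed

lemma exit_time_measurable:
  assumes "0 < c" "c < e" "0 < x"
  shows "exit_time (gbm r \<sigma> W x) c e \<in> borel_measurable M"
proof -
  have ev: "stays_open c e x (real n) \<in> events" for n
    using stays_open_past[of "real n"] past_subset_events by force
  have N: "(\<Inter>n. stays_open c e x (real n)) \<in> events" using ev by auto
  note [measurable] = N stopping_time_measurable[OF real_exit_stopping_time[OF assms]]
  have "(\<lambda>\<omega>. if \<omega> \<in> (\<Inter>n. stays_open c e x (real n)) then \<infinity> else ereal (real_exit c e x \<omega>)) \<in> borel_measurable M"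
    by measurable
  then show ?thesis
  proof (rule measurable_cong[THEN iffD1, rotated])
    fix \<omega> assume \<omega>: "\<omega> \<in> space M"
    show "(if \<omega> \<in> (\<Inter>n. stays_open c e x (real n)) then \<infinity> else ereal (real_exit c e x \<omega>))
        = exit_time (gbm r \<sigma> W x) c e \<omega>"
    proof (cases "outside c e x \<omega> = {}")
      case True
      then show ?thesis using outside_empty_iff[OF \<omega>, of c e x] by (simp add: exit_time_eq_Inf top_ereal_def)
    next
      case False
      then have "\<omega> \<notin> (\<Inter>n. stays_open c e x (real n))" using outside_empty_iff[OF \<omega>, of c e x] by auto
      then show ?thesis using outside_Inf(3)[OF \<omega> False] False by (simp add: real_exit_def)
    qed
  qed
qed

lemma expected_run_mono:
  assumes "sol a b \<phi> g" "sol a b \<phi>' g'" "0 < x" "\<tau> \<in> stays_in a b x"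
    and le: "\<And>s. s \<in> {a..b} \<Longrightarrow> g s \<le> g' s"
  shows "expectation (disc_run g x \<tau>) \<le> expectation (disc_run g' x \<tau>)"
proof (rule integral_mono_AE)
  show "integrable M (disc_run g x \<tau>)" "integrable M (disc_run g' x \<tau>)"
    using assms by (auto simp: sol_def dynkin_pair_def)
  have c: "continuous_on {0<..} g" "continuous_on {0<..} g'" using assms by (auto simp: sol_def dynkin_pair_def)
  have "AE \<omega> in M. \<forall>u\<in>{0..\<tau> \<omega>}. gbm r \<sigma> W x u \<omega> \<in> {a..b}" using assms by (simp add: stays_in_def)
  then show "AE \<omega> in M. disc_run g x \<tau> \<omega> \<le> disc_run g' x \<tau> \<omega>"
    using AE_space
  proof eventually_elim
    case (elim \<omega>)
    show ?case unfolding disc_run_def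
      using elim(1) by (intro set_integral_mono disc_run_set_integrable c assms(3) elim(2)) (auto intro!: mult_left_mono le)
  qed
qed

section \<open>Solutions with zero boundary values on [a,b]\<close>

context
  fixes a b :: real
  assumes a: "0 < a" and ab: "a < b"
begin

lemma exit_stays_in: "x \<in> {a..b} \<Longrightarrow> real_exit a b x \<in> stays_in a b x"
  by (intro admissible_stays_in real_exit_admissible a ab) auto

lemma expected_end_zero:
  assumes x: "x \<in> {a..b}" and \<psi>: "\<psi> a = 0" "\<psi> b = 0" and int: "integrable M (disc_end \<psi> x (real_exit a b x))"
  shows "expectation (disc_end \<psi> x (real_exit a b x)) = 0"
proof -
  have "AE \<omega> in M. disc_end \<psi> x (real_exit a b x) \<omega> = 0"
    using real_exit_AE[OF a ab x] by eventually_elim (use \<psi> in \<open>auto simp: disc_end_def\<close>)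
  then show ?thesis by (rule integral_eq_zero_AE)
qed

text \<open>At the exit time the terminal term is evaluated at a or b, where it vanishes; the rest
  of Dynkin's formula is a Feynman-Kac representation.\<close>

lemma sol_expected_run:
  assumes \<psi>: "sol a b \<psi> g" "\<psi> a = 0" "\<psi> b = 0" and x: "x \<in> {a..b}"
  shows "expectation (disc_run g x (real_exit a b x)) = \<psi> x"
  using expected_end_zero[OF x \<psi>(2,3)] \<psi>(1) exit_stays_in[OF x] x a
  by (auto simp: sol_def dynkin_pair_def)

lemma exp_run_eq_sol:
  assumes \<psi>: "sol a b \<psi> gg" "\<psi> a = 0" "\<psi> b = 0" and x: "x \<in> {a..b}"
    and g: "g \<in> borel_measurable borel" "\<And>s. s \<in> {a..b} \<Longrightarrow> g s = gg s"
  shows "exp_run M W r \<sigma> a b g x = \<psi> x"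
proof -
  have x0: "0 < x" using x a by auto
  have "exp_run M W r \<sigma> a b g x = expectation (disc_run gg x (real_exit a b x))"
    unfolding exp_run_def
  proof (rule integral_cong_AE)
    show "(\<lambda>\<omega>. interval_lebesgue_integral lborel 0 (exit_time (gbm r \<sigma> W x) a b \<omega>)
        (\<lambda>u. exp (- 2 * r * u) * g (gbm r \<sigma> W x u \<omega>))) \<in> borel_measurable M"
      by (intro discounted_path_measurable exit_time_measurable exit_time_nonneg g a ab x0)
    show "disc_run gg x (real_exit a b x) \<in> borel_measurable M"
      using \<psi>(1) exit_stays_in[OF x] x0 by (auto simp: sol_def dynkin_pair_def)
    show "AE \<omega> in M. interval_lebesgue_integral lborel 0 (exit_time (gbm r \<sigma> W x) a b \<omega>)
        (\<lambda>u. exp (- 2 * r * u) * g (gbm r \<sigma> W x u \<omega>)) = disc_run gg x (real_exit a b x) \<omega>"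
      using real_exit_AE[OF a ab x] AE_space
    proof eventually_elim
      case (elim \<omega>)
      then have eq: "exit_time (gbm r \<sigma> W x) a b \<omega> = ereal (real_exit a b x \<omega>)" by blast
      show ?case unfolding eq
        by (rule interval_integral_eq_disc_run[where a = a and b = b])
           (use real_exit_nonneg before_exit[OF elim(2) x] eq g(2) in auto)
    qed
  qed
  then show ?thesis using sol_expected_run[OF \<psi> x] by simp
qed

text \<open>A comparison principle obtained from the probabilistic representation instead of a
  maximum principle.\<close>

lemma sol_mono:
  assumes "sol a b \<psi> g" "\<psi> a = 0" "\<psi> b = 0" "sol a b \<psi>' g'" "\<psi>' a = 0" "\<psi>' b = 0"
    and "\<And>s. s \<in> {a..b} \<Longrightarrow> g s \<le> g' s" and x: "x \<in> {a..b}"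
  shows "\<psi> x \<le> \<psi>' x"
  using expected_run_mono[OF assms(1,4) _ exit_stays_in[OF x] assms(7)] x a
    sol_expected_run[OF assms(1-3) x] sol_expected_run[OF assms(4-6) x] by auto

text \<open>Comparison with the constant source k, for which the expected running term is k / (2r)
  times 1 - E[exp (-2 r \<tau>)]. From an interior point the exit takes positive time, so this is
  strictly positive.\<close>

lemma sol_pos:
  assumes \<psi>: "sol a b \<psi> g" "\<psi> a = 0" "\<psi> b = 0" and k: "k > 0" "\<And>s. s \<in> {a..b} \<Longrightarrow> k \<le> g s"
    and x: "x \<in> {a<..<b}"
  shows "\<psi> x > 0"
proof -
  let ?\<tau> = "real_exit a b x"
  have x': "x \<in> {a..b}" "0 < x" using x a by auto
  have st: "?\<tau> \<in> stays_in a b x" by (rule exit_stays_in[OF x'(1)])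
  \<comment> \<open>The constant k / (2r) solves the equation with source k since
    \<open>char_poly 0\<close> = -2r; writing it with exponent 0 makes it an instance of
    \<open>sol_power\<close>.\<close>
  have S: "sol a b (\<lambda>s. k / (2 * r) * s powr 0) (\<lambda>s. k / (2 * r) * (- char_poly 0 * s powr 0))"
    by (intro sol_scale sol_power a)
  have le: "k / (2 * r) * (- char_poly 0 * s powr 0) \<le> g s" if "s \<in> {a..b}" for s
    using k(2)[OF that] that a r by (simp add: char_poly_def)
  have run: "expectation (disc_run (\<lambda>s. k / (2 * r) * (- char_poly 0 * s powr 0)) x ?\<tau>) \<le> \<psi> x"
    using expected_run_mono[OF S \<psi>(1) x'(2) st le] sol_expected_run[OF \<psi> x'(1)] by simp
  have E: "integrable M (disc_end (\<lambda>s. k / (2 * r) * s powr 0) x ?\<tau>)"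
    "expectation (disc_end (\<lambda>s. k / (2 * r) * s powr 0) x ?\<tau>)
      = k / (2 * r) * x powr 0 - expectation (disc_run (\<lambda>s. k / (2 * r) * (- char_poly 0 * s powr 0)) x ?\<tau>)"
    using S st x'(2) by (auto simp: sol_def dynkin_pair_def)
  have "AE \<omega> in M. outside a b x \<omega> \<noteq> {}" by (rule AE_exits[OF a ab x'(2)])
  then have "AE \<omega> in M. disc_end (\<lambda>s. k / (2 * r) * s powr 0) x ?\<tau> \<omega> < k / (2 * r)"
    using AE_space
  proof eventually_elim
    case (elim \<omega>)
    have "?\<tau> \<omega> \<in> outside a b x \<omega>" using outside_Inf(1)[OF elim(2,1)] elim(1) by (simp add: real_exit_def)
    moreover have "0 \<notin> outside a b x \<omega>" using gbm_0[OF elim(2)] x by (simp add: outside_def)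
    ultimately have "?\<tau> \<omega> > 0" using real_exit_nonneg[of a b x \<omega>] by (metis less_eq_real_def)
    then have "exp (- 2 * r * ?\<tau> \<omega>) < 1" using r by simp
    then have "exp (- 2 * r * ?\<tau> \<omega>) * (k / (2 * r)) < 1 * (k / (2 * r))"
      using k r by (intro mult_strict_right_mono) auto
    then show ?case using gbm_pos[OF x'(2)] by (simp add: disc_end_def less_imp_neq[symmetric])
  qed
  then have "expectation (disc_end (\<lambda>s. k / (2 * r) * s powr 0) x ?\<tau>) < k / (2 * r)"
    by (rule expectation_less[OF E(1)])
  then show ?thesis using run E(2) x'(2) by simp
qed

lemma sol_zero_boundary:
  assumes "sol a b \<phi> g"
  shows "\<exists>\<psi>. sol a b \<psi> g \<and> \<psi> a = 0 \<and> \<psi> b = 0"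
proof -
  obtain A B where AB: "a powr \<beta>m * (A + B * a powr \<delta>) = - \<phi> a" "b powr \<beta>m * (A + B * b powr \<delta>) = - \<phi> b"
    using homogeneous_interpolation[OF a ab] by blast
  have "sol a b (\<lambda>s. \<phi> s + s powr \<beta>m * (A + B * s powr \<delta>)) (\<lambda>s. g s + 0)"
    by (intro sol_add sol_homogeneous assms a)
  then show ?thesis using AB by (intro exI[of _ "\<lambda>s. \<phi> s + s powr \<beta>m * (A + B * s powr \<delta>)"]) auto
qed

end

end

section \<open>The hedging data: the gammas and the regularity of M\<close>

locale hedging = gbm_model M W r \<sigma>
  for M :: "'a measure" and W :: "real \<Rightarrow> 'a \<Rightarrow> real" and r \<sigma> :: real +
  fixes K a b :: real
  assumes K: "K > 0" and ahat_le: "ahat r \<sigma> K \<le> a" and ab: "a < b"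
begin

abbreviation "d \<equiv> dpar r \<sigma>"
text \<open>The coefficient in P'(s) = -\<kappa> s^(-(1+d)), valid on [a,b]; \<open>g1\<close>,
  \<open>g2\<close>, \<open>g3\<close> are the resulting power forms of the integrands of the three
  gammas.\<close>

definition \<kappa> :: real where "\<kappa> = ahat r \<sigma> K powr (1 + d)"

definition g1 :: "real \<Rightarrow> real" where "g1 s = \<sigma>\<^sup>2 * s powr 2"
definition g2 :: "real \<Rightarrow> real" where "g2 s = (- \<kappa> * \<sigma>\<^sup>2) * s powr (1 - d)"
definition g3 :: "real \<Rightarrow> real" where "g3 s = (\<kappa>\<^sup>2 * \<sigma>\<^sup>2) * s powr (- 2 * d)"

lemma d_pos: "d > 0" using r \<sigma> by (simp add: dpar_def)

lemma ahat_pos: "ahat r \<sigma> K > 0" using d_pos K by (simp add: ahat_def add_pos_pos)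

lemma a_pos: "a > 0" using ahat_pos ahat_le by simp

lemma Pd_eq:
  assumes "s \<in> {a..b}"
  shows "Pd r \<sigma> K s = - \<kappa> * s powr (- (1 + d))" and "\<bar>Pd r \<sigma> K s\<bar> \<le> 1"
proof -
  have s: "s > 0" "ahat r \<sigma> K \<le> s" using assms a_pos ahat_le by auto
  have le: "(ahat r \<sigma> K / s) powr (1 + d) \<le> 1"
    using s ahat_pos d_pos by (intro powr_le1) auto
  then have eq: "Pd r \<sigma> K s = - ((ahat r \<sigma> K / s) powr (1 + d))" by (simp add: Pd_def)
  then show "\<bar>Pd r \<sigma> K s\<bar> \<le> 1" using le by simp
  have "(ahat r \<sigma> K / s) powr (1 + d) = \<kappa> / s powr (1 + d)"
    using s ahat_pos unfolding \<kappa>_def by (intro powr_divide)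
  then have "(ahat r \<sigma> K / s) powr (1 + d) = \<kappa> * s powr (- (1 + d))"
    by (simp only: powr_minus divide_inverse)
  then show "Pd r \<sigma> K s = - \<kappa> * s powr (- (1 + d))" using eq by simp
qed

lemma g_eq:
  assumes "s \<in> {a..b}"
  shows "\<sigma>\<^sup>2 * s\<^sup>2 = g1 s" and "Pd r \<sigma> K s * \<sigma>\<^sup>2 * s\<^sup>2 = g2 s"
    and "(Pd r \<sigma> K s)\<^sup>2 * \<sigma>\<^sup>2 * s\<^sup>2 = g3 s"
    and "fcost r \<sigma> K s h = h\<^sup>2 * g1 s + (- 2 * h) * g2 s + g3 s"
proof -
  have s: "s > 0" using assms a_pos by auto
  have s2: "s\<^sup>2 = s powr 2" using s by simp
  show 1: "\<sigma>\<^sup>2 * s\<^sup>2 = g1 s" by (simp add: g1_def s2)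
  have "s powr (- (1 + d)) * s powr 2 = s powr (1 - d)"
    by (subst powr_add[symmetric]) simp
  then show 2: "Pd r \<sigma> K s * \<sigma>\<^sup>2 * s\<^sup>2 = g2 s"
    unfolding Pd_eq(1)[OF assms] g2_def s2 by simp
  have "(s powr (- (1 + d)))\<^sup>2 * s powr 2 = s powr (- 2 * d)"
    unfolding power2_eq_square by (simp flip: powr_add)
  then show 3: "(Pd r \<sigma> K s)\<^sup>2 * \<sigma>\<^sup>2 * s\<^sup>2 = g3 s"
    unfolding Pd_eq(1)[OF assms] g3_def s2 by (simp add: power_mult_distrib)
  show "fcost r \<sigma> K s h = h\<^sup>2 * g1 s + (- 2 * h) * g2 s + g3 s"
    unfolding 1[symmetric] 2[symmetric] 3[symmetric] fcost_def by (simp add: power2_eq_square algebra_simps)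
qed

lemma Pd_measurable [measurable]: "Pd r \<sigma> K \<in> borel_measurable borel"
  unfolding Pd_def[abs_def] by measurable

text \<open>Non-resonance of the three sources: with \<sigma>^2 d / 2 = r the values are \<sigma>^2,
  -2r and 2rd.\<close>

lemma char_poly_nonzero: "char_poly 2 \<noteq> 0" "char_poly (1 - d) \<noteq> 0" "char_poly (- 2 * d) \<noteq> 0"
proof -
  have sd: "\<sigma>\<^sup>2 / 2 * d = r" using \<sigma> by (simp add: dpar_def)
  have "char_poly 2 = \<sigma>\<^sup>2" by (simp add: char_poly_def)
  then show "char_poly 2 \<noteq> 0" using \<sigma> by simp
  have "char_poly (1 - d) = - (\<sigma>\<^sup>2 / 2 * d) * (1 - d) + r * (1 - d) - 2 * r"
    by (simp add: char_poly_def field_simps)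
  also have "\<dots> = - 2 * r" unfolding sd by (simp add: algebra_simps)
  finally show "char_poly (1 - d) \<noteq> 0" using r by simp
  have "char_poly (- 2 * d) = 2 * (\<sigma>\<^sup>2 / 2 * d) * (2 * d + 1) - 2 * r * d - 2 * r"
    by (simp add: char_poly_def algebra_simps)
  also have "\<dots> = 2 * r * d" unfolding sd by (simp add: algebra_simps)
  finally show "char_poly (- 2 * d) \<noteq> 0" using r d_pos by simp
qed

lemma gamma_sols:
  obtains \<psi>1 \<psi>2 \<psi>3 where "sol a b \<psi>1 g1" "\<psi>1 a = 0" "\<psi>1 b = 0" "sol a b \<psi>2 g2" "\<psi>2 a = 0" "\<psi>2 b = 0"
    "sol a b \<psi>3 g3" "\<psi>3 a = 0" "\<psi>3 b = 0"
proof -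
  have "sol a b (\<lambda>s. - (\<sigma>\<^sup>2 / char_poly 2) * s powr 2) g1"
    unfolding g1_def[abs_def] by (intro sol_monomial char_poly_nonzero a_pos)
  moreover have "sol a b (\<lambda>s. - ((- \<kappa> * \<sigma>\<^sup>2) / char_poly (1 - d)) * s powr (1 - d)) g2"
    unfolding g2_def[abs_def] by (intro sol_monomial char_poly_nonzero a_pos)
  moreover have "sol a b (\<lambda>s. - ((\<kappa>\<^sup>2 * \<sigma>\<^sup>2) / char_poly (- 2 * d)) * s powr (- 2 * d)) g3"
    unfolding g3_def[abs_def] by (intro sol_monomial char_poly_nonzero a_pos)
  ultimately show thesis using sol_zero_boundary[OF a_pos ab] that by metis
qed

abbreviation "Mf \<equiv> Mfun M W r \<sigma> K a b"

text \<open>In the interior the denominator \<open>\<psi>1\<close> is positive, so smoothness is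
  inherited. At a and b the quotient is of the form 0 / 0; there |P'| <= 1 gives
  \<open>\<bar>\<psi>2\<bar>\<close> <= \<open>\<psi>1\<close>, so the quotient is at most
  \<open>\<psi>1\<close> and tends to 0.\<close>

lemma Mf_props: "C2_on {a<..<b} Mf" "continuous_on {a..b} Mf"
proof -
  obtain \<psi>1 \<psi>2 \<psi>3 where \<psi>1: "sol a b \<psi>1 g1" "\<psi>1 a = 0" "\<psi>1 b = 0"
    and \<psi>2: "sol a b \<psi>2 g2" "\<psi>2 a = 0" "\<psi>2 b = 0" and \<psi>3: "sol a b \<psi>3 g3" "\<psi>3 a = 0" "\<psi>3 b = 0"
    by (rule gamma_sols)
  have G: "gamma1 M W r \<sigma> a b x = \<psi>1 x" "gamma2 M W r \<sigma> K a b x = \<psi>2 x" "gamma3 M W r \<sigma> K a b x = \<psi>3 x"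
    if "x \<in> {a..b}" for x
    unfolding gamma1_def gamma2_def gamma3_def
    using exp_run_eq_sol[OF a_pos ab \<psi>1 that, of "\<lambda>y. \<sigma>\<^sup>2 * y\<^sup>2"]
      exp_run_eq_sol[OF a_pos ab \<psi>2 that, of "\<lambda>y. Pd r \<sigma> K y * \<sigma>\<^sup>2 * y\<^sup>2"]
      exp_run_eq_sol[OF a_pos ab \<psi>3 that, of "\<lambda>y. (Pd r \<sigma> K y)\<^sup>2 * \<sigma>\<^sup>2 * y\<^sup>2"] g_eq by auto
  \<comment> \<open>At the endpoints all three solutions vanish and 0 / 0 evaluates to 0, in
    agreement with the prescribed value of M.\<close>
  have M_eq: "Mf x = \<psi>3 x - (\<psi>2 x)\<^sup>2 / \<psi>1 x" if "x \<in> {a..b}" for x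
    using that G[OF that] \<psi>1 \<psi>2 \<psi>3 by (cases "x = a"; cases "x = b") (auto simp: Mfun_def)
  have pos: "\<psi>1 x > 0" if "x \<in> {a<..<b}" for x
  proof (rule sol_pos[OF a_pos ab \<psi>1 _ _ that, of "\<sigma>\<^sup>2 * a\<^sup>2"])
    show "\<sigma>\<^sup>2 * a\<^sup>2 > 0" using \<sigma> a_pos by simp
    show "\<sigma>\<^sup>2 * a\<^sup>2 \<le> g1 s" if "s \<in> {a..b}" for s
      using that a_pos unfolding g_eq(1)[OF that, symmetric] by (intro mult_left_mono power_mono) auto
  qed
  have le: "\<bar>\<psi>2 x\<bar> \<le> \<psi>1 x" if x: "x \<in> {a..b}" for x
  proof -
    have "\<bar>g2 s\<bar> \<le> g1 s" if s: "s \<in> {a..b}" for s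
    proof -
      have "\<bar>Pd r \<sigma> K s * \<sigma>\<^sup>2 * s\<^sup>2\<bar> = \<bar>Pd r \<sigma> K s\<bar> * (\<sigma>\<^sup>2 * s\<^sup>2)" by (simp add: abs_mult)
      also have "\<dots> \<le> 1 * (\<sigma>\<^sup>2 * s\<^sup>2)" by (intro mult_right_mono Pd_eq(2)[OF s]) auto
      finally show ?thesis unfolding g_eq(1,2)[OF s] by simp
    qed
    then have g: "g2 s \<le> g1 s" "(-1) * g2 s \<le> g1 s" if "s \<in> {a..b}" for s
      using that by (force simp: abs_le_iff)+
    have "\<psi>2 x \<le> \<psi>1 x" by (rule sol_mono[OF a_pos ab \<psi>2 \<psi>1 g(1) x])
    moreover have "(-1) * \<psi>2 x \<le> \<psi>1 x"
      by (rule sol_mono[OF a_pos ab sol_scale[OF \<psi>2(1)] _ _ \<psi>1 g(2) x]) (use \<psi>2 in auto)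
    ultimately show ?thesis by simp
  qed
  have sub: "{a<..<b} \<subseteq> {0<..}" using a_pos by auto
  have C: "C2_on {a<..<b} \<psi>1" "C2_on {a<..<b} \<psi>2" "C2_on {a<..<b} \<psi>3"
    using \<psi>1(1) \<psi>2(1) \<psi>3(1) by (auto intro: C2_on_subset[OF sol_C2 sub])
  have C2: "C2_on {a<..<b} (\<lambda>x. \<psi>3 x - (\<psi>2 x * \<psi>2 x) * (1 / \<psi>1 x))"
    by (intro C2_on_diff C2_on_mult C2_on_inverse C) (use pos in force)
  show C2M: "C2_on {a<..<b} Mf"
  proof -
    note D = C2_on_deriv[OF open_greaterThanLessThan C2, of Mf]
    have M_eq': "Mf x = \<psi>3 x - (\<psi>2 x * \<psi>2 x) * (1 / \<psi>1 x)" if "x \<in> {a<..<b}" for x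
      using M_eq[of x] that by (simp add: power2_eq_square)
    obtain f1 f2 where f: "\<And>s. s \<in> {a<..<b} \<Longrightarrow> ((\<lambda>x. \<psi>3 x - (\<psi>2 x * \<psi>2 x) * (1 / \<psi>1 x)) has_real_derivative f1 s) (at s)"
        "\<And>s. s \<in> {a<..<b} \<Longrightarrow> (f1 has_real_derivative f2 s) (at s)" "continuous_on {a<..<b} f2"
      using C2 unfolding C2_on_def by blast
    have "(Mf has_real_derivative f1 s) (at s)" if "s \<in> {a<..<b}" for s
      by (rule has_field_derivative_transform_within_open[OF f(1)[OF that] open_greaterThanLessThan that]) (simp add: M_eq')
    then show ?thesis using f unfolding C2_on_def by blast
  qed
  have cont: "continuous_on {a..b} \<psi>1" "continuous_on {a..b} \<psi>2" "continuous_on {a..b} \<psi>3"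
  proof -
    have "continuous_on {a..b} \<psi>" if "sol a b \<psi> g" for \<psi> g
      using sol_C2[OF that] a_pos unfolding C2_on_def
      by (auto intro!: continuous_on_of_deriv[THEN continuous_on_subset, of "{0<..}"])
    then show "continuous_on {a..b} \<psi>1" "continuous_on {a..b} \<psi>2" "continuous_on {a..b} \<psi>3"
      using \<psi>1 \<psi>2 \<psi>3 by auto
  qed
  have quot: "continuous_on {a..b} (\<lambda>x. (\<psi>2 x)\<^sup>2 / \<psi>1 x)"
    unfolding continuous_on_def
  proof
    fix x assume x: "x \<in> {a..b}"
    show "((\<lambda>x. (\<psi>2 x)\<^sup>2 / \<psi>1 x) \<longlongrightarrow> (\<psi>2 x)\<^sup>2 / \<psi>1 x) (at x within {a..b})"
    proof (cases "x \<in> {a<..<b}")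
      case True
      show ?thesis using cont x pos[OF True] unfolding continuous_on_def
        by (intro tendsto_intros) auto
    next
      case False
      then have x0: "\<psi>1 x = 0" using x \<psi>1 by (cases "x = a") auto
      have "(\<psi>1 \<longlongrightarrow> 0) (at x within {a..b})" using cont(1) x x0 unfolding continuous_on_def by force
      then have "((\<lambda>x. (\<psi>2 x)\<^sup>2 / \<psi>1 x) \<longlongrightarrow> 0) (at x within {a..b})"
      proof (rule Lim_null_comparison[rotated])
        have "norm ((\<psi>2 y)\<^sup>2 / \<psi>1 y) \<le> \<psi>1 y" if "y \<in> {a..b}" for y
        proof -
          have "(\<psi>2 y)\<^sup>2 \<le> \<psi>1 y * \<psi>1 y"
            using le[OF that] by (metis abs_ge_zero abs_le_square_iff abs_of_nonneg order_trans power2_eq_square)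
          moreover have "\<psi>1 y \<ge> 0" using le[OF that] by linarith
          ultimately show ?thesis by (cases "\<psi>1 y = 0") (auto simp: divide_le_eq)
        qed
        then show "\<forall>\<^sub>F y in at x within {a..b}. norm ((\<psi>2 y)\<^sup>2 / \<psi>1 y) \<le> \<psi>1 y"
          by (auto simp: eventually_at_filter)
      qed
      then show ?thesis using x0 by simp
    qed
  qed
  have "continuous_on {a..b} (\<lambda>x. \<psi>3 x - (\<psi>2 x)\<^sup>2 / \<psi>1 x)" by (intro continuous_intros cont quot)
  then show "continuous_on {a..b} Mf" by (rule continuous_on_eq) (simp add: M_eq)
qed

end

section \<open>The stopping problem\<close>

locale hedging_problem = hedging M W r \<sigma> K a b
  for M :: "'a measure" and W :: "real \<Rightarrow> 'a \<Rightarrow> real" and r \<sigma> K a b :: real +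
  fixes h :: real and \<phi> :: "real \<Rightarrow> real"
  assumes \<phi>: "sol a b \<phi> (\<lambda>s. h\<^sup>2 * g1 s + (- 2 * h) * g2 s + g3 s)"
begin

definition "gh s = h\<^sup>2 * g1 s + (- 2 * h) * g2 s + g3 s"
text \<open>The reward of the equivalent maximisation problem, in which no running term is
  left.\<close>

definition "obst s = \<phi> s - Mf s"
definition "ya = a powr \<delta>"
definition "yb = b powr \<delta>"
definition "unscale y = y powr (1 / \<delta>)" for y :: real

text \<open>Dividing by the decreasing homogeneous solution and passing to the coordinate \<open>s powr \<delta>\<close>
  turns the homogeneous solutions into affine functions.\<close>

definition "H y = obst (unscale y) / y powr (\<beta>m / \<delta>)"

lemma unscale_powr: "s > 0 \<Longrightarrow> unscale (s powr \<delta>) = s" "y > 0 \<Longrightarrow> unscale y powr \<delta> = y" "y > 0 \<Longrightarrow> unscale y > 0"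
  using \<delta>_pos by (auto simp: unscale_def powr_powr)

lemma obst_eq: "s > 0 \<Longrightarrow> obst s = s powr \<beta>m * H (s powr \<delta>)"
  using \<delta>_pos by (simp add: H_def unscale_powr powr_powr)

lemma ya_pos: "ya > 0" using a_pos by (simp add: ya_def)

lemma ya_less_yb: "ya < yb"
  unfolding ya_def yb_def using a_pos ab \<delta>_pos by (intro powr_less_mono2) auto

lemma powr_mem: "s \<in> {a..b} \<Longrightarrow> s powr \<delta> \<in> {ya..yb}" "s \<in> {a<..<b} \<Longrightarrow> s powr \<delta> \<in> {ya<..<yb}"
  unfolding ya_def yb_def using a_pos \<delta>_pos by (auto intro!: powr_mono2 powr_less_mono2)

lemma unscale_ends: "unscale ya = a" "unscale yb = b"
  using unscale_powr(1) a_pos ab by (auto simp: ya_def yb_def)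

lemma unscale_less: "0 < y \<Longrightarrow> y < z \<Longrightarrow> unscale y < unscale z"
  unfolding unscale_def using \<delta>_pos by (intro powr_less_mono2) auto

lemma unscale_le: "0 < y \<Longrightarrow> y \<le> z \<Longrightarrow> unscale y \<le> unscale z"
  using unscale_less[of y z] by (cases "y = z") auto

lemma unscale_mem: "y \<in> {ya..yb} \<Longrightarrow> unscale y \<in> {a..b}" "y \<in> {ya<..<yb} \<Longrightarrow> unscale y \<in> {a<..<b}"
  using unscale_le[of ya y] unscale_le[of y yb] unscale_less[of ya y] unscale_less[of y yb] ya_pos unscale_ends by auto

lemma obst_continuous: "continuous_on {a..b} obst"
proof -
  have "continuous_on {0<..} \<phi>"
    by (rule C2_on_continuous[OF sol_C2[OF \<phi>]])
  then show ?thesis unfolding obst_def[abs_def]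
    by (intro continuous_intros Mf_props(2)) (rule continuous_on_subset, use a_pos in auto)
qed

lemma obst_C2: "C2_on {a<..<b} obst"
  unfolding obst_def[abs_def]
  by (intro C2_on_diff Mf_props(1) C2_on_subset[OF sol_C2[OF \<phi>]]) (use a_pos in auto)

lemma H_continuous: "continuous_on {ya..yb} H"
proof -
  have "continuous_on {ya..yb} unscale"
    unfolding unscale_def[abs_def] using ya_pos by (auto intro!: continuous_intros)
  then have "continuous_on {ya..yb} (\<lambda>y. obst (unscale y))"
    by (rule continuous_on_compose2[OF obst_continuous]) (use unscale_mem(1) in auto)
  then show ?thesis unfolding H_def[abs_def] using ya_pos by (auto intro!: continuous_intros)
qed

lemma H_differentiable: "y \<in> {ya<..<yb} \<Longrightarrow> \<exists>D. (H has_real_derivative D) (at y)"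
proof -
  assume y: "y \<in> {ya<..<yb}"
  then have y0: "y > 0" using ya_pos by auto
  obtain D where D: "(obst has_real_derivative D) (at (unscale y))"
    using obst_C2 unscale_mem(2)[OF y] unfolding C2_on_def by blast
  have "(unscale has_real_derivative (1 / \<delta>) * y powr (1 / \<delta> - 1)) (at y)"
    unfolding unscale_def[abs_def] by (rule has_real_derivative_powr[OF y0])
  from DERIV_chain2[OF D this]
  have "((\<lambda>y. obst (unscale y)) has_real_derivative D * ((1 / \<delta>) * y powr (1 / \<delta> - 1))) (at y)" .
  from DERIV_divide[OF this has_real_derivative_powr[OF y0, of "\<beta>m / \<delta>"]] y0
  show ?thesis unfolding H_def[abs_def] by auto
qed

sublocale hull: hull_setup ya yb H
  by unfold_locales (rule ya_less_yb H_continuous)+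

abbreviation "env \<equiv> concave_hull ya yb H"
abbreviation "V \<equiv> \<lambda>x. Vfun M W r \<sigma> K a b x h"

section \<open>The cost of a stopping rule and the value function\<close>

definition cost :: "real \<Rightarrow> ('a \<Rightarrow> real) \<Rightarrow> real" where
  "cost x \<tau> = (\<integral>\<omega>. interval_lebesgue_integral lborel 0 (ereal (\<tau> \<omega>))
              (\<lambda>u. exp (- 2 * r * u) * fcost r \<sigma> K (gbm r \<sigma> W x u \<omega>) h)
            + exp (- 2 * r * \<tau> \<omega>) * Mf (gbm r \<sigma> W x (\<tau> \<omega>) \<omega>) \<partial>M)"

lemma Mf_measurable: "Mf \<in> borel_measurable borel"
proof -
  have "(\<lambda>x. indicator {a..b} x *\<^sub>R Mf x) \<in> borel_measurable borel"
    by (rule borel_measurable_continuous_on_indicator[OF _ Mf_props(2)]) auto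
  also have "(\<lambda>x. indicator {a..b} x *\<^sub>R Mf x) = Mf"
    by (auto simp: fun_eq_iff indicator_def Mfun_def)
  finally show ?thesis .
qed

lemma fcost_measurable: "(\<lambda>y. fcost r \<sigma> K y h) \<in> borel_measurable borel"
  unfolding fcost_def[abs_def] by measurable

lemma disc_end_Mf_integrable:
  assumes "\<tau> \<in> stays_in a b x"
  shows "integrable M (disc_end Mf x \<tau>)"
proof -
  note [measurable] = gbm_stopped_measurable[OF assms] Mf_measurable
  have "bounded (Mf ` {a..b})" by (intro compact_imp_bounded compact_continuous_image Mf_props) auto
  then obtain B where B: "\<And>s. s \<in> {a..b} \<Longrightarrow> \<bar>Mf s\<bar> \<le> B"
    unfolding bounded_iff by (metis imageI real_norm_def)
  have B0: "B \<ge> 0" using B[of a] ab by force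
  show ?thesis
  proof (rule integrable_const_bound[where B = B])
    show "disc_end Mf x \<tau> \<in> borel_measurable M" unfolding disc_end_def by measurable
    show "AE \<omega> in M. norm (disc_end Mf x \<tau> \<omega>) \<le> B"
      using stays_in_end[OF assms] AE_space
    proof eventually_elim
      case (elim \<omega>)
      have "0 \<le> \<tau> \<omega>" using assms elim(2) by (simp add: stays_in_def)
      then have "exp (- 2 * r * \<tau> \<omega>) \<le> 1" using r by simp
      then have "exp (- 2 * r * \<tau> \<omega>) * \<bar>Mf (gbm r \<sigma> W x (\<tau> \<omega>) \<omega>)\<bar> \<le> 1 * B"
        by (intro mult_mono B elim) auto
      then show ?case by (simp add: disc_end_def abs_mult)
    qed
  qed
qed

text \<open>Dynkin's formula for \<open>\<phi>\<close> absorbs the running cost, so minimising the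
  cost means maximising a purely terminal reward.\<close>

lemma cost_eq:
  assumes x: "x \<in> {a..b}" and \<tau>: "\<tau> \<in> admissible M W r \<sigma> a b x"
  shows "integrable M (disc_end obst x \<tau>)" and "cost x \<tau> = \<phi> x - expectation (disc_end obst x \<tau>)"
proof -
  have x0: "x > 0" using x a_pos by auto
  have st: "\<tau> \<in> stays_in a b x" by (rule admissible_stays_in[OF x \<tau>])
  note [measurable] = gbm_stopped_measurable[OF st] Mf_measurable
  have D: "integrable M (disc_end \<phi> x \<tau>)" "integrable M (disc_run gh x \<tau>)"
    "expectation (disc_end \<phi> x \<tau>) = \<phi> x - expectation (disc_run gh x \<tau>)"
    using \<phi> st x0 unfolding sol_def dynkin_pair_def gh_def[abs_def] by auto
  note DM = disc_end_Mf_integrable[OF st]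
  have E: "disc_end obst x \<tau> = (\<lambda>\<omega>. disc_end \<phi> x \<tau> \<omega> - disc_end Mf x \<tau> \<omega>)"
    by (simp add: disc_end_def obst_def fun_eq_iff right_diff_distrib)
  show "integrable M (disc_end obst x \<tau>)" unfolding E using D DM by simp
  have "cost x \<tau> = expectation (\<lambda>\<omega>. disc_run gh x \<tau> \<omega> + disc_end Mf x \<tau> \<omega>)"
    unfolding cost_def
  proof (rule integral_cong_AE)
    have "(\<lambda>\<omega>. interval_lebesgue_integral lborel 0 (ereal (\<tau> \<omega>))
              (\<lambda>u. exp (- 2 * r * u) * fcost r \<sigma> K (gbm r \<sigma> W x u \<omega>) h)) \<in> borel_measurable M"
      by (rule discounted_path_measurable[OF _ fcost_measurable]) (use st in \<open>auto simp: stays_in_def\<close>)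
    then show "(\<lambda>\<omega>. interval_lebesgue_integral lborel 0 (ereal (\<tau> \<omega>))
              (\<lambda>u. exp (- 2 * r * u) * fcost r \<sigma> K (gbm r \<sigma> W x u \<omega>) h)
            + exp (- 2 * r * \<tau> \<omega>) * Mf (gbm r \<sigma> W x (\<tau> \<omega>) \<omega>)) \<in> borel_measurable M"
      by measurable
    show "(\<lambda>\<omega>. disc_run gh x \<tau> \<omega> + disc_end Mf x \<tau> \<omega>) \<in> borel_measurable M"
      using D(2) DM by auto
    have "AE \<omega> in M. \<forall>u\<in>{0..\<tau> \<omega>}. gbm r \<sigma> W x u \<omega> \<in> {a..b}" using st by (simp add: stays_in_def)
    then show "AE \<omega> in M. interval_lebesgue_integral lborel 0 (ereal (\<tau> \<omega>))
              (\<lambda>u. exp (- 2 * r * u) * fcost r \<sigma> K (gbm r \<sigma> W x u \<omega>) h)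
            + exp (- 2 * r * \<tau> \<omega>) * Mf (gbm r \<sigma> W x (\<tau> \<omega>) \<omega>) = disc_run gh x \<tau> \<omega> + disc_end Mf x \<tau> \<omega>"
      using AE_space
    proof eventually_elim
      case (elim \<omega>)
      have "0 \<le> \<tau> \<omega>" using st elim(2) by (simp add: stays_in_def)
      from interval_integral_eq_disc_run[where \<tau> = \<tau> and t = "\<tau> \<omega>" and g = "\<lambda>y. fcost r \<sigma> K y h" and gg = gh, OF this refl elim(1)]
      show ?case using g_eq(4) by (simp add: gh_def disc_end_def)
    qed
  qed
  also have "\<dots> = expectation (disc_run gh x \<tau>) + expectation (disc_end Mf x \<tau>)"
    using D(2) DM by simp
  also have "\<dots> = \<phi> x - expectation (disc_end obst x \<tau>)" unfolding E using D DM by simp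
  finally show "cost x \<tau> = \<phi> x - expectation (disc_end obst x \<tau>)" .
qed

lemma homogeneous_end:
  assumes "x > 0" "\<tau> \<in> stays_in a b x"
  shows "integrable M (disc_end (\<lambda>s. s powr \<beta>m * (A + B * s powr \<delta>)) x \<tau>)"
    and "expectation (disc_end (\<lambda>s. s powr \<beta>m * (A + B * s powr \<delta>)) x \<tau>) = x powr \<beta>m * (A + B * x powr \<delta>)"
proof -
  have "disc_run (\<lambda>_. 0) x \<tau> = (\<lambda>_. 0)"
    by (simp add: disc_run_def set_lebesgue_integral_def fun_eq_iff)
  then show "integrable M (disc_end (\<lambda>s. s powr \<beta>m * (A + B * s powr \<delta>)) x \<tau>)"
    and "expectation (disc_end (\<lambda>s. s powr \<beta>m * (A + B * s powr \<delta>)) x \<tau>) = x powr \<beta>m * (A + B * x powr \<delta>)"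
    using sol_homogeneous[OF a_pos, of b A B] assms by (auto simp: sol_def dynkin_pair_def)
qed

lemma cost_ge:
  assumes x: "x \<in> {a..b}" and \<tau>: "\<tau> \<in> admissible M W r \<sigma> a b x"
  shows "cost x \<tau> \<ge> \<phi> x - x powr \<beta>m * env (x powr \<delta>)"
proof -
  have x0: "x > 0" using x a_pos by auto
  have st: "\<tau> \<in> stays_in a b x" by (rule admissible_stays_in[OF x \<tau>])
  have xp: "x powr \<beta>m > 0" using x0 by simp
  have "expectation (disc_end obst x \<tau>) / x powr \<beta>m \<le> env (x powr \<delta>)"
  \<comment> \<open>One affine majorant at a time: at the stopped point it dominates the reward, and
    the discounted mean of the corresponding homogeneous solution equals its starting value.\<close>
  proof (rule hull.hull_greatest)
    fix A B assume AB: "\<And>z. z \<in> {ya..yb} \<Longrightarrow> H z \<le> A + B * z"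
    have "expectation (disc_end obst x \<tau>) \<le> expectation (disc_end (\<lambda>s. s powr \<beta>m * (A + B * s powr \<delta>)) x \<tau>)"
    proof (rule integral_mono_AE[OF cost_eq(1)[OF x \<tau>] homogeneous_end(1)[OF x0 st]])
      show "AE \<omega> in M. disc_end obst x \<tau> \<omega> \<le> disc_end (\<lambda>s. s powr \<beta>m * (A + B * s powr \<delta>)) x \<tau> \<omega>"
        using stays_in_end[OF st]
      proof eventually_elim
        case (elim \<omega>)
        then have "gbm r \<sigma> W x (\<tau> \<omega>) \<omega> > 0" using a_pos by auto
        then show ?case unfolding disc_end_def
          by (subst obst_eq) (auto intro!: mult_left_mono AB powr_mem(1)[OF elim, unfolded atLeastAtMost_iff])
      qed
    qed
    then show "expectation (disc_end obst x \<tau>) / x powr \<beta>m \<le> A + B * x powr \<delta>"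
      unfolding homogeneous_end(2)[OF x0 st] using xp by (simp add: pos_divide_le_eq mult.commute)
  qed
  then have "expectation (disc_end obst x \<tau>) \<le> x powr \<beta>m * env (x powr \<delta>)"
    using xp by (simp add: pos_divide_le_eq mult.commute)
  then show ?thesis using cost_eq(2)[OF x \<tau>] by simp
qed

text \<open>Where the hull lies strictly above \<open>H\<close>, exiting the interval spanned by the two contact points is
  optimal; elsewhere stopping immediately is.\<close>

lemma cost_attained:
  assumes x: "x \<in> {a..b}"
  shows "\<exists>\<tau>\<in>admissible M W r \<sigma> a b x. cost x \<tau> = \<phi> x - x powr \<beta>m * env (x powr \<delta>)"
proof (cases "H (x powr \<delta>) < env (x powr \<delta>)")
  case False
  have x0: "x > 0" using x a_pos by auto
  have eq: "env (x powr \<delta>) = H (x powr \<delta>)" using False hull.le_hull[OF powr_mem(1)[OF x]] by simp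
  have "(\<lambda>_. 0) \<in> admissible M W r \<sigma> a b x"
    by (simp add: admissible_def stopping_time_const exit_time_nonneg flip: zero_ereal_def)
  moreover have "cost x (\<lambda>_. 0) = \<phi> x - x powr \<beta>m * env (x powr \<delta>)"
  proof -
    have "expectation (disc_end obst x (\<lambda>_. 0)) = expectation (\<lambda>_. obst x)"
      by (rule Bochner_Integration.integral_cong) (auto simp: disc_end_def gbm_0)
    then show ?thesis using cost_eq(2)[OF x calculation] obst_eq[OF x0] eq by (simp add: prob_space)
  qed
  ultimately show ?thesis by blast
next
  case True
  have x0: "x > 0" using x a_pos by auto
  let ?y = "x powr \<delta>"
  have "?y \<noteq> ya" "?y \<noteq> yb" using True hull.hull_left hull.hull_right by auto
  then have y: "?y \<in> {ya<..<yb}" using powr_mem(1)[OF x] by auto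
  obtain c' e' A B where ce: "ya \<le> c'" "c' < ?y" "?y < e'" "e' \<le> yb" "H c' = A + B * c'" "H e' = A + B * e'"
      "\<forall>y\<in>{c'..e'}. env y = A + B * y"
    using hull.hull_chord[OF y True] by blast
  define c where "c = unscale c'"
  define e where "e = unscale e'"
  have pos: "c' > 0" "e' > 0" using ce ya_pos by auto
  have c: "0 < c" "a \<le> c" "c < x" "x < e" "e \<le> b"
    using unscale_powr(3)[OF pos(1)] unscale_le[OF ya_pos ce(1)] unscale_less[OF pos(1) ce(2)]
      unscale_less[OF _ ce(3)] unscale_le[OF pos(2) ce(4)] unscale_ends unscale_powr(1)[OF x0] x0
    by (auto simp: c_def e_def)
  have cp: "c powr \<delta> = c'" "e powr \<delta> = e'" using unscale_powr(2) pos by (auto simp: c_def e_def)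
  let ?\<tau> = "real_exit c e x"
  have \<tau>: "?\<tau> \<in> admissible M W r \<sigma> a b x" by (rule real_exit_admissible) (use c in auto)
  have st: "?\<tau> \<in> stays_in a b x" by (rule admissible_stays_in[OF x \<tau>])
  have ends: "obst c = c powr \<beta>m * (A + B * c powr \<delta>)" "obst e = e powr \<beta>m * (A + B * e powr \<delta>)"
    using c ce(5,6) by (auto simp: obst_eq cp)
  have "expectation (disc_end obst x ?\<tau>) = expectation (disc_end (\<lambda>s. s powr \<beta>m * (A + B * s powr \<delta>)) x ?\<tau>)"
  proof (rule integral_cong_AE)
    show "disc_end obst x ?\<tau> \<in> borel_measurable M" using cost_eq(1)[OF x \<tau>] by auto
    show "disc_end (\<lambda>s. s powr \<beta>m * (A + B * s powr \<delta>)) x ?\<tau> \<in> borel_measurable M"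
      using homogeneous_end(1)[OF x0 st] by auto
    have "AE \<omega> in M. gbm r \<sigma> W x (?\<tau> \<omega>) \<omega> \<in> {c, e}"
      using real_exit_AE[of c e x] c by (auto elim!: eventually_mono)
    then show "AE \<omega> in M. disc_end obst x ?\<tau> \<omega> = disc_end (\<lambda>s. s powr \<beta>m * (A + B * s powr \<delta>)) x ?\<tau> \<omega>"
      by eventually_elim (use ends in \<open>auto simp: disc_end_def\<close>)
  qed
  also have "\<dots> = x powr \<beta>m * (A + B * ?y)" by (rule homogeneous_end(2)[OF x0 st])
  also have "\<dots> = x powr \<beta>m * env ?y" using ce by simp
  finally show ?thesis using cost_eq(2)[OF x \<tau>] \<tau> by auto
qed

lemma V_eq:
  assumes x: "x \<in> {a..b}"
  shows "V x = \<phi> x - x powr \<beta>m * env (x powr \<delta>)"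
proof -
  have "V x = Inf (cost x ` admissible M W r \<sigma> a b x)"
    unfolding Vfun_def cost_def ..
  also have "\<dots> = \<phi> x - x powr \<beta>m * env (x powr \<delta>)"
    using cost_attained[OF x] cost_ge[OF x] by (intro cInf_eq_minimum) force+
  finally show ?thesis .
qed

section \<open>Regularity of V and the continuation set\<close>

abbreviation "C \<equiv> contset M W r \<sigma> K a b h"

lemma M_eq: "x > 0 \<Longrightarrow> Mf x = \<phi> x - x powr \<beta>m * H (x powr \<delta>)"
  using obst_eq[of x] by (simp add: obst_def)

lemma V_le_M: "x \<in> {a..b} \<Longrightarrow> V x \<le> Mf x"
  using V_eq[of x] M_eq[of x] hull.le_hull[OF powr_mem(1)] a_pos by (auto intro!: mult_left_mono)

lemma C_iff: "x \<in> C \<longleftrightarrow> x \<in> {a..b} \<and> H (x powr \<delta>) < env (x powr \<delta>)"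
  using V_eq[of x] M_eq[of x] a_pos by (auto simp: contset_def)

lemma C_interior:
  assumes "x \<in> C"
  shows "x \<in> {a<..<b}"
proof -
  have x: "x \<in> {a..b}" "H (x powr \<delta>) < env (x powr \<delta>)" using assms C_iff by auto
  then have "x \<noteq> a" "x \<noteq> b" using hull.hull_left hull.hull_right by (auto simp: ya_def yb_def)
  then show ?thesis using x(1) by auto
qed

lemma V_continuous: "continuous_on {a..b} V"
proof -
  have "continuous_on {0<..} \<phi>"
    by (rule C2_on_continuous[OF sol_C2[OF \<phi>]])
  then have p: "continuous_on {a..b} \<phi>" by (rule continuous_on_subset) (use a_pos in auto)
  have "continuous_on {a..b} (\<lambda>x. x powr \<delta>)" using a_pos by (auto intro!: continuous_intros)
  then have e: "continuous_on {a..b} (\<lambda>x. env (x powr \<delta>))"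
    by (rule continuous_on_compose2[OF hull.hull_continuous]) (use powr_mem(1) in auto)
  have "continuous_on {a..b} (\<lambda>x. \<phi> x - x powr \<beta>m * env (x powr \<delta>))"
    using a_pos by (intro continuous_intros p e) auto
  then show ?thesis by (rule continuous_on_eq) (simp add: V_eq)
qed

lemma V_C1: "\<exists>V1. continuous_on {a<..<b} V1 \<and> (\<forall>x\<in>{a<..<b}. (V has_real_derivative V1 x) (at x))"
proof -
  obtain D where D: "\<And>y. y \<in> {ya<..<yb} \<Longrightarrow> (env has_real_derivative D y) (at y)" "continuous_on {ya<..<yb} D"
    using hull.hull_C1[OF H_differentiable] by blast
  obtain \<phi>1 \<phi>2 where p: "\<And>s. s > 0 \<Longrightarrow> (\<phi> has_real_derivative \<phi>1 s) (at s)" "\<And>s. s > 0 \<Longrightarrow> (\<phi>1 has_real_derivative \<phi>2 s) (at s)"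
    using sol_C2[OF \<phi>] unfolding C2_on_def by auto
  have pc: "continuous_on {a<..<b} \<phi>1" by (rule continuous_on_of_deriv[OF p(2)]) (use a_pos in auto)
  define V1 where "V1 x = \<phi>1 x - (\<beta>m * x powr (\<beta>m - 1) * env (x powr \<delta>) + D (x powr \<delta>) * (\<delta> * x powr (\<delta> - 1)) * x powr \<beta>m)" for x
  have pw: "continuous_on {a<..<b} (\<lambda>x. x powr \<delta>)" using a_pos by (auto intro!: continuous_intros)
  have c1: "continuous_on {a<..<b} (\<lambda>x. env (x powr \<delta>))"
    by (rule continuous_on_compose2[OF hull.hull_continuous pw]) (use powr_mem(2) in force)
  have c2: "continuous_on {a<..<b} (\<lambda>x. D (x powr \<delta>))"
    by (rule continuous_on_compose2[OF D(2) pw]) (use powr_mem(2) in auto)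
  have "continuous_on {a<..<b} V1"
    unfolding V1_def[abs_def] using a_pos by (intro continuous_intros pc c1 c2) auto
  moreover have "(V has_real_derivative V1 x) (at x)" if x: "x \<in> {a<..<b}" for x
  proof -
    have x0: "x > 0" using x a_pos by auto
    have "((\<lambda>x. \<phi> x - x powr \<beta>m * env (x powr \<delta>)) has_real_derivative V1 x) (at x)"
      unfolding V1_def
      by (intro DERIV_diff DERIV_mult p(1)[OF x0] has_real_derivative_powr[OF x0]
            DERIV_chain2[OF D(1)[OF powr_mem(2)[OF x]] has_real_derivative_powr[OF x0]])
    then show ?thesis
      by (rule has_field_derivative_transform_within_open[OF _ open_greaterThanLessThan x]) (simp add: V_eq)
  qed
  ultimately show ?thesis by blast
qed

text \<open>The endpoints are contact points, so relative openness in (a,b) is openness on the line;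
  hence frontier points lie outside \<open>C\<close>.\<close>

lemma C_open: "open C"
proof -
  have "continuous_on {a<..<b} (\<lambda>x. V x - Mf x)"
    by (intro continuous_intros continuous_on_subset[OF V_continuous] continuous_on_subset[OF Mf_props(2)]) auto
  then have "open ({a<..<b} \<inter> (\<lambda>x. V x - Mf x) -` {..<0})"
    by (rule continuous_open_preimage) auto
  also have "{a<..<b} \<inter> (\<lambda>x. V x - Mf x) -` {..<0} = C"
    using C_interior by (auto simp: contset_def)
  finally show ?thesis .
qed

text \<open>Around a point of \<open>C\<close> the hull is a chord, so V is \<open>\<phi>\<close>
  minus a homogeneous solution and again solves the equation with source \<open>gh\<close>.\<close>

lemma C_local_sol:
  assumes "x \<in> C"
  shows "\<exists>c e v. a \<le> c \<and> c < x \<and> x < e \<and> e \<le> b \<and> sol a b v gh \<and> (\<forall>s\<in>{c<..<e}. V s = v s)"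
proof -
  have x: "x \<in> {a<..<b}" by (rule C_interior[OF assms])
  then have x0: "x > 0" using a_pos by auto
  let ?y = "x powr \<delta>"
  obtain c' e' A B where ce: "ya \<le> c'" "c' < ?y" "?y < e'" "e' \<le> yb" "\<forall>y\<in>{c'..e'}. env y = A + B * y"
    using hull.hull_chord[OF powr_mem(2)[OF x]] C_iff[of x] assms by blast
  have pos: "c' > 0" "e' > 0" using ce ya_pos by auto
  have c: "a \<le> unscale c'" "unscale c' < x" "x < unscale e'" "unscale e' \<le> b"
    using unscale_le[OF ya_pos ce(1)] unscale_less[OF pos(1) ce(2)]
      unscale_less[OF _ ce(3)] unscale_le[OF pos(2) ce(4)] unscale_ends unscale_powr(1)[OF x0] x0 by auto
  have "sol a b (\<lambda>s. \<phi> s + (-1) * (s powr \<beta>m * (A + B * s powr \<delta>))) (\<lambda>s. gh s + (-1) * 0)"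
    unfolding gh_def by (intro sol_add sol_scale sol_homogeneous a_pos \<phi>)
  moreover have "V s = \<phi> s + (-1) * (s powr \<beta>m * (A + B * s powr \<delta>))" if s: "s \<in> {unscale c'<..<unscale e'}" for s
  proof -
    have s0: "0 < s" using s unscale_powr(3)[OF pos(1)] by auto
    have "c' \<le> s powr \<delta>" "s powr \<delta> \<le> e'"
      using unscale_less[of "s powr \<delta>" c'] unscale_less[of e' "s powr \<delta>"] s s0 pos unscale_powr(1)[OF s0] by force+
    then have "env (s powr \<delta>) = A + B * s powr \<delta>" using ce(5) by simp
    then show ?thesis using V_eq[of s] s c by simp
  qed
  ultimately show ?thesis using c
    by (intro exI[of _ "unscale c'"] exI[of _ "unscale e'"] exI[of _ "\<lambda>s. \<phi> s + (-1) * (s powr \<beta>m * (A + B * s powr \<delta>))"]) auto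
qed

lemma C_ode:
  assumes "x \<in> C"
  shows "(deriv V has_real_derivative deriv (deriv V) x) (at x)" and "isCont (deriv (deriv V)) x"
    and "\<sigma>\<^sup>2 / 2 * x\<^sup>2 * deriv (deriv V) x + r * x * deriv V x - 2 * r * V x = - fcost r \<sigma> K x h"
proof -
  obtain c e v where v: "a \<le> c" "c < x" "x < e" "e \<le> b" "sol a b v gh" "\<forall>s\<in>{c<..<e}. V s = v s"
    using C_local_sol[OF assms] by blast
  have sub: "{c<..<e} \<subseteq> {0<..}" using v(1) a_pos by auto
  have x: "x \<in> {c<..<e}" using v by auto
  note C2 = C2_on_subset[OF sol_C2[OF v(5)] sub]
  show "(deriv V has_real_derivative deriv (deriv V) x) (at x)" "isCont (deriv (deriv V)) x"
    using C2_on_deriv[OF open_greaterThanLessThan C2, of V x] v(6) x by auto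
  have "\<sigma>\<^sup>2 / 2 * x\<^sup>2 * deriv (deriv V) x + r * x * deriv V x - 2 * r * V x = - gh x"
    using ode_sol_deriv[OF open_greaterThanLessThan sub, of v gh V x] v x by (auto simp: sol_def)
  then show "\<sigma>\<^sup>2 / 2 * x\<^sup>2 * deriv (deriv V) x + r * x * deriv V x - 2 * r * V x = - fcost r \<sigma> K x h"
    using g_eq(4)[of x h] v by (simp add: gh_def)
qed

text \<open>Away from the frontier a point lies either in the open set \<open>C\<close>, where V is
  locally a solution, or in an open set disjoint from the closure of \<open>C\<close>, where V
  coincides with M.\<close>

lemma V_C2_off_frontier:
  assumes x: "x \<in> {a<..<b}" and nf: "x \<notin> frontier C"
  shows "(deriv V has_real_derivative deriv (deriv V) x) (at x)" and "isCont (deriv (deriv V)) x"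
proof -
  have "(deriv V has_real_derivative deriv (deriv V) x) (at x) \<and> isCont (deriv (deriv V)) x"
  proof (cases "x \<in> C")
    case True
    then show ?thesis using C_ode(1,2) by blast
  next
    case False
    then have xc: "x \<notin> closure C" using nf C_open by (simp add: frontier_def interior_open)
    define U where "U = {a<..<b} - closure C"
    have U: "open U" "x \<in> U" using x xc by (auto simp: U_def open_Diff)
    have VM: "V s = Mf s" if "s \<in> U" for s
    proof -
      have "s \<notin> C" using that closure_subset by (auto simp: U_def)
      then show ?thesis using V_le_M[of s] that by (auto simp: contset_def U_def)
    qed
    have "C2_on U Mf" using Mf_props(1) by (rule C2_on_subset) (auto simp: U_def)
    from C2_on_deriv[OF U(1) this VM U(2)] show ?thesis by auto
  qed
  then show "(deriv V has_real_derivative deriv (deriv V) x) (at x)" "isCont (deriv (deriv V)) x" by auto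
qed

text \<open>V - M is nonpositive and vanishes at x0, so it has a local maximum there; both functions
  being differentiable, their derivatives agree.\<close>

lemma smooth_fit:
  assumes x: "x0 \<in> {a<..<b}" and f: "x0 \<in> frontier C"
  shows "V x0 = Mf x0" and "deriv V x0 = deriv Mf x0"
proof -
  have "x0 \<notin> C" using f C_open by (simp add: frontier_def interior_open)
  then show eq: "V x0 = Mf x0" using V_le_M[of x0] x by (auto simp: contset_def)
  obtain v where v: "(V has_real_derivative v) (at x0)" using V_C1 x by blast
  obtain m where m: "(Mf has_real_derivative m) (at x0)" using Mf_props(1) x unfolding C2_on_def by blast
  obtain d where d: "d > 0" "ball x0 d \<subseteq> {a<..<b}" using x open_greaterThanLessThan openE by blast
  have "v - m = 0"
  proof (rule DERIV_local_max[OF DERIV_diff[OF v m] d(1)], intro allI impI)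
    fix y assume "\<bar>x0 - y\<bar> < d"
    then have "y \<in> ball x0 d" by (simp add: dist_real_def)
    then have "y \<in> {a..b}" using d(2) by auto
    then show "V y - Mf y \<le> V x0 - Mf x0" using V_le_M eq by auto
  qed
  then show "deriv V x0 = deriv Mf x0" using DERIV_imp_deriv[OF v] DERIV_imp_deriv[OF m] by simp
qed

text \<open>Inside \<open>C\<close> the equation expresses the second derivative through V, its
  first derivative and the running cost, all continuous at x0; smooth fit then replaces V and V' by
  M and M'.\<close>

lemma second_derivative_limit:
  assumes x: "x0 \<in> {a<..<b}" and f: "x0 \<in> frontier C"
  shows "(deriv (deriv V) \<longlongrightarrow> 2 / (\<sigma>\<^sup>2 * x0\<^sup>2) * (- r * x0 * deriv Mf x0 + 2 * r * Mf x0 - fcost r \<sigma> K x0 h))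
     (at x0 within C)"
proof -
  have x0: "x0 > 0" using x a_pos by auto
  obtain V1 where V1: "continuous_on {a<..<b} V1" "\<And>x. x \<in> {a<..<b} \<Longrightarrow> (V has_real_derivative V1 x) (at x)"
    using V_C1 by blast
  have dV: "deriv V x = V1 x" if "x \<in> {a<..<b}" for x using V1(2)[OF that] by (rule DERIV_imp_deriv)
  have "isCont V1 x0" using V1(1) x by (simp add: continuous_on_eq_continuous_at)
  then have t1: "(V1 \<longlongrightarrow> V1 x0) (at x0 within C)"
    unfolding isCont_def by (rule tendsto_within_subset) auto
  have "isCont V x0" using V1(2)[OF x] by (rule DERIV_isCont)
  then have t2: "(V \<longlongrightarrow> V x0) (at x0 within C)"
    unfolding isCont_def by (rule tendsto_within_subset) auto
  have "isCont gh x0" unfolding gh_def[abs_def] g1_def g2_def g3_def using x0 by (intro continuous_intros) auto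
  then have t3: "(gh \<longlongrightarrow> gh x0) (at x0 within C)"
    unfolding isCont_def by (rule tendsto_within_subset) auto
  have ev: "\<forall>\<^sub>F x in at x0 within C. x \<in> C" by (simp add: eventually_at_filter)
  have "((\<lambda>x. 2 / (\<sigma>\<^sup>2 * x\<^sup>2) * (- r * x * V1 x + 2 * r * V x - gh x)) \<longlongrightarrow>
      2 / (\<sigma>\<^sup>2 * x0\<^sup>2) * (- r * x0 * V1 x0 + 2 * r * V x0 - gh x0)) (at x0 within C)"
    by (intro tendsto_intros t1 t2 t3) (use x0 \<sigma> in auto)
  then have "(deriv (deriv V) \<longlongrightarrow> 2 / (\<sigma>\<^sup>2 * x0\<^sup>2) * (- r * x0 * V1 x0 + 2 * r * V x0 - gh x0)) (at x0 within C)"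
  proof (rule Lim_transform_eventually)
    show "\<forall>\<^sub>F x in at x0 within C. 2 / (\<sigma>\<^sup>2 * x\<^sup>2) * (- r * x * V1 x + 2 * r * V x - gh x) = deriv (deriv V) x"
      using ev
    proof eventually_elim
      case (elim x)
      have xi: "x \<in> {a<..<b}" by (rule C_interior[OF elim])
      have gh: "fcost r \<sigma> K x h = gh x" using g_eq(4)[of x h] xi by (simp add: gh_def)
      have "\<sigma>\<^sup>2 * x\<^sup>2 * deriv (deriv V) x = 2 * (- r * x * V1 x + 2 * r * V x - gh x)"
        using C_ode(3)[OF elim] unfolding dV[OF xi] gh by (simp add: algebra_simps)
      moreover have "\<sigma>\<^sup>2 * x\<^sup>2 \<noteq> 0" using xi a_pos \<sigma> by auto
      ultimately show ?case by (simp add: field_simps)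
    qed
  qed
  moreover have "V1 x0 = deriv Mf x0" using smooth_fit(2)[OF x f] dV[OF x] by simp
  moreover have "fcost r \<sigma> K x0 h = gh x0" using g_eq(4)[of x0 h] x by (simp add: gh_def)
  ultimately show ?thesis using smooth_fit(1)[OF x f] by simp
qed

lemma value_function_regularity:
  "continuous_on {a..b} V \<and> V C1_differentiable_on {a<..<b} \<and>
   deriv V C1_differentiable_on ({a<..<b} - frontier C) \<and>
   (\<forall>x0 \<in> frontier C \<inter> {a<..<b}.
      ((\<lambda>x. deriv (deriv V) x) \<longlongrightarrow> 2 / (\<sigma>\<^sup>2 * x0\<^sup>2) * (- r * x0 * deriv Mf x0 + 2 * r * Mf x0 - fcost r \<sigma> K x0 h))
        (at x0 within C) \<and>
      deriv V x0 = deriv Mf x0)"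
proof (intro conjI ballI)
  show "continuous_on {a..b} V" by (rule V_continuous)
  show "V C1_differentiable_on {a<..<b}"
    using V_C1 unfolding C1_differentiable_on_def has_real_derivative_iff_has_vector_derivative by blast
  have "continuous_on ({a<..<b} - frontier C) (deriv (deriv V))"
    using V_C2_off_frontier(2) by (intro continuous_at_imp_continuous_on) auto
  then show "deriv V C1_differentiable_on ({a<..<b} - frontier C)"
    unfolding C1_differentiable_on_def has_real_derivative_iff_has_vector_derivative[symmetric]
    using V_C2_off_frontier(1) by blast
qed (use second_derivative_limit smooth_fit in auto)

end

theorem mainTheorem9:
  fixes M :: "'a measure" and W :: "real \<Rightarrow> 'a \<Rightarrow> real" and r \<sigma> K a b :: real
  assumes BM: "is_std_BM M W"
    and r: "r > 0" and \<sigma>: "\<sigma> > 0" and K: "K > 0"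
    and ab: "ahat r \<sigma> K \<le> a" "a < b"
    and Z: "\<forall>h\<in>{Pd r \<sigma> K a..Pd r \<sigma> K b}.
              finite {x \<in> {a<..<b}. Gfun M W r \<sigma> K a b x h = 0} \<and>
              card {x \<in> {a<..<b}. Gfun M W r \<sigma> K a b x h = 0} \<le> 2"
  shows "\<forall>h\<in>{Pd r \<sigma> K a..Pd r \<sigma> K b}.
     continuous_on {a..b} (\<lambda>x. Vfun M W r \<sigma> K a b x h) \<and>
     (\<lambda>x. Vfun M W r \<sigma> K a b x h) C1_differentiable_on {a<..<b} \<and>
     deriv (\<lambda>x. Vfun M W r \<sigma> K a b x h) C1_differentiable_on
        ({a<..<b} - frontier (contset M W r \<sigma> K a b h)) \<and>
     (\<forall>x0 \<in> frontier (contset M W r \<sigma> K a b h) \<inter> {a<..<b}.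
        ((\<lambda>x. deriv (deriv (\<lambda>y. Vfun M W r \<sigma> K a b y h)) x) \<longlongrightarrow>
           2 / (\<sigma>\<^sup>2 * x0\<^sup>2) * (- r * x0 * deriv (Mfun M W r \<sigma> K a b) x0
                               + 2 * r * Mfun M W r \<sigma> K a b x0 - fcost r \<sigma> K x0 h))
          (at x0 within contset M W r \<sigma> K a b h) \<and>
        deriv (\<lambda>x. Vfun M W r \<sigma> K a b x h) x0 = deriv (Mfun M W r \<sigma> K a b) x0)"
proof
  fix h
  interpret hedging M W r \<sigma> K a b
    by unfold_locales (rule BM r \<sigma> K ab)+
  obtain \<psi>1 \<psi>2 \<psi>3 where \<psi>: "sol a b \<psi>1 g1" "sol a b \<psi>2 g2" "sol a b \<psi>3 g3" by (rule gamma_sols)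
  \<comment> \<open>Expanding the square in f(.,h) gives the source h^2 g1 - 2h g2 + g3, so a
    particular solution is the same combination of the gamma solutions.\<close>
  interpret hedging_problem M W r \<sigma> K a b h "\<lambda>s. h\<^sup>2 * \<psi>1 s + (- 2 * h) * \<psi>2 s + \<psi>3 s"
    by unfold_locales (intro sol_add sol_scale \<psi>)
  show "continuous_on {a..b} (\<lambda>x. Vfun M W r \<sigma> K a b x h) \<and>
     (\<lambda>x. Vfun M W r \<sigma> K a b x h) C1_differentiable_on {a<..<b} \<and>
     deriv (\<lambda>x. Vfun M W r \<sigma> K a b x h) C1_differentiable_on
        ({a<..<b} - frontier (contset M W r \<sigma> K a b h)) \<and>
     (\<forall>x0 \<in> frontier (contset M W r \<sigma> K a b h) \<inter> {a<..<b}.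
        ((\<lambda>x. deriv (deriv (\<lambda>y. Vfun M W r \<sigma> K a b y h)) x) \<longlongrightarrow>
           2 / (\<sigma>\<^sup>2 * x0\<^sup>2) * (- r * x0 * deriv (Mfun M W r \<sigma> K a b) x0
                               + 2 * r * Mfun M W r \<sigma> K a b x0 - fcost r \<sigma> K x0 h))
          (at x0 within contset M W r \<sigma> K a b h) \<and>
        deriv (\<lambda>x. Vfun M W r \<sigma> K a b x h) x0 = deriv (Mfun M W r \<sigma> K a b) x0)"
    by (rule value_function_regularity)
qed

end
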